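(* Let $Q=Q(d,d_0)$ be a compact connected two-point homogeneous space (normalized as in the context) and let $\eta\in W(d,d_0)$. Then the following hold. (i) There exists a constant $L\ge1$ depending only on $d$ and $d_0$ such that for every $N$-point $t$-design $\mathcal D_N\subset Q$ with $t\ge 2L/\pi$, $$\lambda[\eta,\mathcal D_N]<C\,t^{d-1}\big(\nu[\mathcal D_N,Lt^{-1}]\big)^2 .$$ (ii) For optimal $N$-point $t$-designs $\mathcal D_N\subset Q$ (with $t\ge2L/\pi$), that is, satisfying $c_+t^d\ge N\ge c_-t^d$ with positive constants $c_+,c_-$ independent of $N$ and $t$, $$\lambda[\eta,\mathcal D_N]<C\,N^{1-\frac1d}\big(\nu[\mathcal D_N,c_+^{1/d}LN^{-1/d}]\big)^2 .$$ The constants $C$ in these two bounds are positive and depend only on $d$, $d_0$ and $\eta$.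
   Context: Spaces. $Q=Q(d,d_0)$ is one of the following: the sphere $S^d$, $d\ge 1$, with the convention $d_0=d$; or a projective space $\mathbb{F}P^n$ with $\mathbb F=\mathbb R,\mathbb C,\mathbb H$, $n\ge2$, or the octonionic projective plane $\mathbb{O}P^2$ ($\mathbb F=\mathbb O$, $n=2$), where $d_0=\dim_{\mathbb R}\mathbb F=1,2,4,8$ for $\mathbb F=\mathbb R,\mathbb C,\mathbb H,\mathbb O$ respectively and $d=nd_0$. $Q$ carries the isometry-invariant Riemannian distance $\theta$, rescaled so that $\operatorname{diam}(Q,\theta)=\pi$, and the isometry-invariant Riemannian measure $\mu$ with $\mu(Q)=1$. Concretely, $S^d=\{x\in\mathbb R^{d+1}:\|x\|=1\}$ with $\cos\theta(x_1,x_2)=(x_1,x_2)$; and $\mathbb{F}P^n$ is the set of Hermitian $(n+1)\times(n+1)$ matrices $\Pi$ over $\mathbb F$ with $\Pi^2=\Pi$, $\operatorname{Tr}\Pi=1$, with $\sin\frac12\theta(\Pi_1,\Pi_2)=\frac1{\sqrt2}\|\Pi_1-\Pi_2\|$, $0\le\theta\le\pi$, where $\|A\|^2=\sum_{i,j}|a_{ij}|^2$. Thus $Q$ sits in a Euclidean space $\mathbb R^m$ ($\mathbb R^{d+1}$ for spheres; the real vector space of Hermitian $(n+1)\times(n+1)$ matrices, $m=\frac12(n+1)(d+2)$, for projective spaces). $t$-designs: an $N$-point subset $\mathcal D_N\subset Q$ ($N$ not necessarily different points, counted with multiplicity) is a $t$-design if $\sum_{x\in\mathcal D_N}F(x)=N\int_QF(y)\,d\mu(y)$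 for all polynomials $F$ on $\mathbb R^m$ of total degree at most $t$. Equivalently, $\sum_{x_1,x_2\in\mathcal D_N}f(\cos\theta(x_1,x_2))=N^2\iint_{Q\times Q}f(\cos\theta(y_1,y_2))\,d\mu(y_1)d\mu(y_2)$ for all one-variable polynomials $f$ of degree at most $t$. Balls: $B_r(y)=\{x\in Q:\theta(x,y)<r\}$; $v_r=\mu(B_r(y))$ (independent of $y$). $\nu[\mathcal D_N,r]=\max_{y\in Q}\#\{B_r(y)\cap\mathcal D_N\}$ for $r\in[0,\pi]$, and $\nu[\mathcal D_N,r]=N$ for $r>\pi$. Discrepancies: $\lambda_r[\mathcal D_N]=\int_Q\big(\#\{B_r(y)\cap\mathcal D_N\}-Nv_r\big)^2\,d\mu(y)$, $\lambda[\eta,\mathcal D_N]=\int_0^\pi\lambda_r[\mathcal D_N]\,\eta(r)\,dr$. Weight classes: for $a\ge b\ge1$, $W(a,b)$ is the class of (measurable) functions $\eta\ge0$ on $[0,\pi]$ with $\int_0^\pi(\sin\frac12r)^{a-1}(\cos\frac12r)^{b-1}\eta(r)\,dr<\infty$. *)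

theory Defs
  imports "HOL-Probability.Probability_Measure"
begin

subsection \<open>Quaternions and octonions\<close>

text \<open>
  Both algebras are obtained by Cayley-Dickson doubling,
  $(a,b)(c,d) = (ac - \bar d b, da + b \bar c)$ and $\overline{(a,b)} = (\bar a, -b)$.
  The Euclidean structure is that of the product type, i.e. $|(a,b)|^2 = |a|^2 + |b|^2$.
\<close>

type_synonym quat = "complex \<times> complex"
type_synonym oct = "quat \<times> quat"

definition quat_mult :: "quat \<Rightarrow> quat \<Rightarrow> quat" where
  "quat_mult x y =
    (fst x * fst y - cnj (snd y) * snd x, snd y * fst x + snd x * cnj (fst y))"

definition quat_conj :: "quat \<Rightarrow> quat" where
  "quat_conj x = (cnj (fst x), - snd x)"

definition oct_mult :: "oct \<Rightarrow> oct \<Rightarrow> oct" where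
  "oct_mult x y =
    (quat_mult (fst x) (fst y) - quat_mult (quat_conj (snd y)) (snd x),
     quat_mult (snd y) (fst x) + quat_mult (snd x) (quat_conj (fst y)))"

definition oct_conj :: "oct \<Rightarrow> oct" where
  "oct_conj x = (quat_conj (fst x), - snd x)"

definition oct_one :: oct where
  "oct_one = ((1, 0), (0, 0))"

text \<open>
  The algebras $R \subset C \subset H \subset O$, indexed by their real dimension 1, 2, 4, 8.
  Other values of the index are not used.
\<close>

definition scalars :: "nat \<Rightarrow> oct set" where
  "scalars d\<^sub>0 =
    (if d\<^sub>0 = 1 then range (\<lambda>a::real. ((complex_of_real a, 0), (0, 0)))
     else if d\<^sub>0 = 2 then range (\<lambda>z::complex. ((z, 0), (0, 0)))
     else if d\<^sub>0 = 4 then range (\<lambda>q::quat. (q, (0, 0)))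
     else UNIV)"

lemma norm_quat_mult: "norm (quat_mult x y) = norm x * norm y"
proof -
  have sq: "(norm q)\<^sup>2 = (Re (fst q))\<^sup>2 + (Im (fst q))\<^sup>2 + (Re (snd q))\<^sup>2 + (Im (snd q))\<^sup>2"
    for q :: quat
    by (cases q) (simp add: norm_Pair cmod_power2)
  have "(norm (quat_mult x y))\<^sup>2 = (norm x)\<^sup>2 * (norm y)\<^sup>2"
    unfolding sq quat_mult_def by (simp add: power2_eq_square algebra_simps)
  then show ?thesis
    by (simp flip: power_mult_distrib)
qed

lemma norm_oct_mult: "norm (oct_mult x y) = norm x * norm y"
proof -
  have sq: "(norm q)\<^sup>2 =
      (Re (fst (fst q)))\<^sup>2 + (Im (fst (fst q)))\<^sup>2 + (Re (snd (fst q)))\<^sup>2 + (Im (snd (fst q)))\<^sup>2 +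
      (Re (fst (snd q)))\<^sup>2 + (Im (fst (snd q)))\<^sup>2 + (Re (snd (snd q)))\<^sup>2 + (Im (snd (snd q)))\<^sup>2"
    for q :: oct
    by (cases q rule: prod.exhaust; simp add: norm_prod_def cmod_power2)
  have "(norm (oct_mult x y))\<^sup>2 = (norm x)\<^sup>2 * (norm y)\<^sup>2"
    unfolding sq oct_mult_def quat_mult_def quat_conj_def
    by (simp add: power2_eq_square algebra_simps)
  then show ?thesis
    by (simp flip: power_mult_distrib)
qed


subsection \<open>The spaces \<open>Q(d, d\<^sub>0)\<close>\<close>

text \<open>
  An $(n+1) \times (n+1)$ matrix is a function of two indices, zero outside
  $\{0,\dots,n\}^2$.
\<close>

definition hermitian :: "nat \<Rightarrow> nat \<Rightarrow> (nat \<Rightarrow> nat \<Rightarrow> oct) set" where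
  "hermitian n d\<^sub>0 =
    {A. (\<forall>i j. A i j \<in> scalars d\<^sub>0 \<and> A j i = oct_conj (A i j)) \<and>
        (\<forall>i j. n < i \<or> n < j \<longrightarrow> A i j = 0)}"

definition mat_mult ::
  "nat \<Rightarrow> (nat \<Rightarrow> nat \<Rightarrow> oct) \<Rightarrow> (nat \<Rightarrow> nat \<Rightarrow> oct) \<Rightarrow> nat \<Rightarrow> nat \<Rightarrow> oct" where
  "mat_mult n A B = (\<lambda>i j. \<Sum>k\<le>n. oct_mult (A i k) (B k j))"

definition mat_trace :: "nat \<Rightarrow> (nat \<Rightarrow> nat \<Rightarrow> oct) \<Rightarrow> oct" where
  "mat_trace n A = (\<Sum>i\<le>n. A i i)"

text \<open>
  \<open>hermitian_coords n d\<^sub>0 \<iota>\<close> says that \<open>\<iota>\<close> identifies the Euclidean space \<open>'a\<close> with the real vector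
  space of Hermitian matrices, linearly and isometrically for the Frobenius norm. In particular it
  forces $\dim {}'a = (n+1)(n d_0+2)/2$.
\<close>

definition hermitian_coords ::
  "nat \<Rightarrow> nat \<Rightarrow> ('a::euclidean_space \<Rightarrow> nat \<Rightarrow> nat \<Rightarrow> oct) \<Rightarrow> bool" where
  "hermitian_coords n d\<^sub>0 \<iota> \<longleftrightarrow>
    (\<forall>i j. linear (\<lambda>x. \<iota> x i j)) \<and>
    bij_betw \<iota> UNIV (hermitian n d\<^sub>0) \<and>
    (\<forall>x. (norm x)\<^sup>2 = (\<Sum>i\<le>n. \<Sum>j\<le>n. (norm (\<iota> x i j))\<^sup>2))"

text \<open>
  \<open>homogeneous_space Q \<theta> d d\<^sub>0\<close>: the subset \<open>Q\<close> of the Euclidean space \<open>'a\<close>, with the distance \<open>\<theta>\<close>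
  (of diameter $\pi$), is the space $Q(d,d_0)$ in its standard embedding. The two distances solve
  $\cos\theta = x \cdot y$ and $\sin(\theta/2) = \|x-y\|/\sqrt2$ with $0 \le \theta \le \pi$.
\<close>

inductive homogeneous_space ::
  "'a::euclidean_space set \<Rightarrow> ('a \<Rightarrow> 'a \<Rightarrow> real) \<Rightarrow> nat \<Rightarrow> nat \<Rightarrow> bool" where
  sphere:
    "1 \<le> d \<Longrightarrow> DIM('a) = d + 1 \<Longrightarrow>
     homogeneous_space (sphere (0::'a) 1) (\<lambda>x y. arccos (x \<bullet> y)) d d"
| projective:
    "2 \<le> n \<Longrightarrow> d\<^sub>0 \<in> {1, 2, 4} \<or> d\<^sub>0 = 8 \<and> n = 2 \<Longrightarrow>
     hermitian_coords n d\<^sub>0 (\<iota> :: 'a \<Rightarrow> nat \<Rightarrow> nat \<Rightarrow> oct) \<Longrightarrow>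
     homogeneous_space
       {x. mat_mult n (\<iota> x) (\<iota> x) = \<iota> x \<and> mat_trace n (\<iota> x) = oct_one}
       (\<lambda>x y. 2 * arcsin (norm (x - y) / sqrt 2)) (n * d\<^sub>0) d\<^sub>0"

text \<open>
  The normalized Riemannian measure is the isometry-invariant Borel probability measure on \<open>Q\<close>
  (unique, because the isometry group of the compact space \<open>Q\<close> acts transitively).
\<close>

definition invariant_measure ::
  "'a::euclidean_space set \<Rightarrow> ('a \<Rightarrow> 'a \<Rightarrow> real) \<Rightarrow> 'a measure \<Rightarrow> bool" where
  "invariant_measure Q \<theta> \<mu> \<longleftrightarrow>
    sets \<mu> = sets (restrict_space borel Q) \<and> prob_space \<mu> \<and>
    (\<forall>g. bij_betw g Q Q \<and> (\<forall>x\<in>Q. \<forall>y\<in>Q. \<theta> (g x) (g y) = \<theta> x y) \<longrightarrow> distr \<mu> \<mu> g = \<mu>)"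

definition geo_ball :: "'a set \<Rightarrow> ('a \<Rightarrow> 'a \<Rightarrow> real) \<Rightarrow> real \<Rightarrow> 'a \<Rightarrow> 'a set" where
  "geo_ball Q \<theta> r y = {x \<in> Q. \<theta> x y < r}"


subsection \<open>Designs and discrepancies\<close>

text \<open>
  Polynomials of total degree at most \<open>t\<close> in the coordinates with respect to the standard basis; the
  exponent functions \<open>\<alpha>\<close> range over a finite set.
\<close>

definition poly_fun_le :: "nat \<Rightarrow> ('a::euclidean_space \<Rightarrow> real) \<Rightarrow> bool" where
  "poly_fun_le t F \<longleftrightarrow>
    (\<exists>c :: ('a \<Rightarrow> nat) \<Rightarrow> real. \<forall>x.
      F x = (\<Sum>\<alpha> \<in> {\<alpha> \<in> PiE Basis (\<lambda>_. {..t}). (\<Sum>b\<in>Basis. \<alpha> b) \<le> t}.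
               c \<alpha> * (\<Prod>b\<in>Basis. (x \<bullet> b) ^ \<alpha> b)))"

definition is_design ::
  "'a::euclidean_space set \<Rightarrow> 'a measure \<Rightarrow> nat \<Rightarrow> nat \<Rightarrow> 'a multiset \<Rightarrow> bool" where
  "is_design Q \<mu> N t D \<longleftrightarrow>
    1 \<le> N \<and> size D = N \<and> set_mset D \<subseteq> Q \<and>
    (\<forall>F. poly_fun_le t F \<longrightarrow> (\<Sum>x\<in>#D. F x) = real N * (LINT y|\<mu>. F y))"

definition ball_count ::
  "'a set \<Rightarrow> ('a \<Rightarrow> 'a \<Rightarrow> real) \<Rightarrow> 'a multiset \<Rightarrow> real \<Rightarrow> 'a \<Rightarrow> nat" where
  "ball_count Q \<theta> D r y = size (filter_mset (\<lambda>x. x \<in> geo_ball Q \<theta> r y) D)"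

definition max_count ::
  "'a set \<Rightarrow> ('a \<Rightarrow> 'a \<Rightarrow> real) \<Rightarrow> 'a multiset \<Rightarrow> real \<Rightarrow> nat" where
  "max_count Q \<theta> D r = (if r \<le> pi then Max (ball_count Q \<theta> D r ` Q) else size D)"

text \<open>
  The volume $v_r$ is written as the measure of the ball about the current centre \<open>y\<close>; it does not
  depend on \<open>y\<close>.
\<close>

definition ball_discrepancy ::
  "'a set \<Rightarrow> ('a \<Rightarrow> 'a \<Rightarrow> real) \<Rightarrow> 'a measure \<Rightarrow> 'a multiset \<Rightarrow> real \<Rightarrow> real" where
  "ball_discrepancy Q \<theta> \<mu> D r =
    (LINT y|\<mu>. (real (ball_count Q \<theta> D r y) - real (size D) * measure \<mu> (geo_ball Q \<theta> r y))\<^sup>2)"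

definition discrepancy ::
  "'a set \<Rightarrow> ('a \<Rightarrow> 'a \<Rightarrow> real) \<Rightarrow> 'a measure \<Rightarrow> (real \<Rightarrow> real) \<Rightarrow> 'a multiset \<Rightarrow> real" where
  "discrepancy Q \<theta> \<mu> \<eta> D = (LINT r:{0..pi}|lebesgue. ball_discrepancy Q \<theta> \<mu> D r * \<eta> r)"

definition weight_class :: "nat \<Rightarrow> nat \<Rightarrow> (real \<Rightarrow> real) set" where
  "weight_class a b =
    {\<eta>. set_borel_measurable lebesgue {0..pi} \<eta> \<and> (\<forall>r\<in>{0..pi}. 0 \<le> \<eta> r) \<and>
        set_integrable lebesgue {0..pi} (\<lambda>r. sin (r/2) ^ (a - 1) * cos (r/2) ^ (b - 1) * \<eta> r)}"

end

theory Submission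
  imports Defs "HOL-Probability.Probability"
begin

text \<open>
  Put $X = 1 - \cos\theta$ and let $J$ be the radial part of the Laplacian, the Jacobi operator
  $X(2-X) f'' + (d - \frac{d+d_0}{2} X) f'$. Integrating by parts along one-parameter groups of isometries
  gives Green's formula for zonal functions and hence
  $\int (Jf)(X(x,y))\,g(X(z,y))\,d\mu(y) = \int f(X(x,y))\,(Jg)(X(z,y))\,d\mu(y)$ for all $x, z$.
  So the Jacobi polynomials with different centres are orthogonal, and the distribution of the
  distance from a point is known. The discrepancy $\lambda_r$ of a $t$-design is therefore a
  nonnegative combination of the squared Jacobi coefficients $\beta_l(r)^2$ of the ball of radius $r$
  with $l > t$. As functions of $r$ these coefficients solve a Sturm-Liouville equation, and an energy
  estimate bounds $\beta_l(r)^2$ by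
  $C (\sin\frac r2)^{d-1} (\cos\frac r2)^{d_0-1} t^d \int_{L/2t}^{L/t} \beta_l(s)^2\,ds$. Summing over $l$ reduces
  $\lambda_r$ to the discrepancies of balls of radius at most $L/t$, which are trivially at most
  $\nu[L/t]^2$. Part (ii) follows because every design has at least $c t^d$ points: test it on a power
  of the Dirichlet kernel.
\<close>

section \<open>Sturm-type estimates for the radial equation\<close>

text \<open>A single small ball cannot control all frequencies, since its Jacobi coefficients may
  vanish at some of them. Averaging over the radii in \<open>[L/2t, L/t]\<close> removes these
  zeros, provided the interval is long enough compared with the wavelength; this is where
  \<open>L\<close> comes from. The estimate concerns the coefficient as a function of the radius and
  not the Jacobi polynomial, because the normal form of its equation has singular terms of a
  favourable sign at both ends in every dimension. In the discrepancy the radius enters only through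
  these coefficients, the points only through factors free of the radius. This separation rests on
  orthogonality about two different centres, which does the work of an addition formula. The measure
  is known only through its invariance, so the orthogonality must come from explicit isometries. In
  the octonionic plane these cannot be composed from matrix products; they are two-row rotations,
  checked entry by entry with Moufang's identity where associativity fails. Truncated expansions
  stand in for Parseval's identity at the cost of factors 2.\<close>

lemma x_cos_x_le_sin_x:
  fixes x :: real
  assumes "0 \<le> x" "x \<le> pi"
  shows "x * cos x \<le> sin x"
proof -
  have "sin 0 - 0 * cos 0 \<le> sin x - x * cos x"
  proof (rule DERIV_nonneg_imp_nondecreasing[where f = "\<lambda>x. sin x - x * cos x"])
    fix y assume y: "0 \<le> y" "y \<le> x"
    have "((\<lambda>x. sin x - x * cos x) has_real_derivative y * sin y) (at y)"
      by (auto intro!: derivative_eq_intros)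
    moreover have "0 \<le> y * sin y" using y assms by (intro mult_nonneg_nonneg sin_ge_zero) auto
    ultimately show "\<exists>z. ((\<lambda>x. sin x - x * cos x) has_real_derivative z) (at y) \<and> 0 \<le> z" by blast
  qed (use assms in auto)
  thus ?thesis by simp
qed

text \<open>If the potential were the constant \<open>lam\<close>, the energy \<open>F\<close> would
  be conserved. The singular terms and \<open>\<gamma>\<close> change it at a rate at most
  \<open>2 |z v|\<close> times their sum, and \<open>2 |z v| \<le> F / sqrt lam\<close>. Hence the
  logarithm of \<open>F\<close> varies by at most the increment of \<open>\<Psi>\<close>, a
  primitive of that sum, divided by \<open>sqrt lam\<close>. Both directions are used later, to
  bound the energy above and below by its value at \<open>pi/2\<close>.\<close>

lemma sturm_gronwall:
  fixes v z :: "real \<Rightarrow> real"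
  assumes A: "A \<ge> 0" and B: "B \<ge> 0" and g: "\<gamma> \<ge> 0" and l: "lam > 0"
  assumes dv: "\<And>r. 0 < r \<Longrightarrow> r < pi \<Longrightarrow> (v has_real_derivative z r) (at r)"
  assumes dz: "\<And>r. 0 < r \<Longrightarrow> r < pi \<Longrightarrow> (z has_real_derivative
     - (lam + \<gamma> - A / (sin (r/2))\<^sup>2 - B / (cos (r/2))\<^sup>2) * v r) (at r)"
  defines "F \<equiv> \<lambda>r. (z r)\<^sup>2 + lam * (v r)\<^sup>2"
  defines "\<Psi> \<equiv> \<lambda>r. \<gamma> * r - 2 * A * (cos (r/2) / sin (r/2)) + 2 * B * (sin (r/2) / cos (r/2))"
  assumes r: "0 < r" "r \<le> s" "s < pi"
  shows "F r \<le> F s * exp ((\<Psi> s - \<Psi> r) / sqrt lam)" and "F s \<le> F r * exp ((\<Psi> s - \<Psi> r) / sqrt lam)"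
proof -
  define q where "q x = \<gamma> + A / (sin (x/2))\<^sup>2 + B / (cos (x/2))\<^sup>2" for x
  have pos: "sin (x/2) > 0" "cos (x/2) > 0" if "0 < x" "x < pi" for x
    using that by (auto intro!: sin_gt_zero cos_gt_zero)
  have dPsi: "(\<Psi> has_real_derivative q x) (at x)" if x: "0 < x" "x < pi" for x
  proof -
    note p = pos[OF x]
    have cot': "((\<lambda>r. cos (r/2) / sin (r/2)) has_real_derivative - 1 / (2 * (sin (x/2))\<^sup>2)) (at x)"
      using p sin_cos_squared_add[of "x/2"]
      by (auto intro!: derivative_eq_intros simp: divide_simps power2_eq_square) (argo | algebra)?
    have tan': "((\<lambda>r. sin (r/2) / cos (r/2)) has_real_derivative 1 / (2 * (cos (x/2))\<^sup>2)) (at x)"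
      using p sin_cos_squared_add[of "x/2"]
      by (auto intro!: derivative_eq_intros simp: divide_simps power2_eq_square) (argo | algebra)?
    have "((\<lambda>r. \<gamma> * r - 2 * A * (cos (r/2) / sin (r/2)) + 2 * B * (sin (r/2) / cos (r/2))) has_real_derivative
        \<gamma> * 1 - 2 * A * (- 1 / (2 * (sin (x/2))\<^sup>2)) + 2 * B * (1 / (2 * (cos (x/2))\<^sup>2))) (at x)"
      by (intro DERIV_add DERIV_diff DERIV_cmult DERIV_ident cot' tan')
    thus ?thesis unfolding \<Psi>_def q_def by simp
  qed
  have dF: "(F has_real_derivative 2 * z x * v x * (lam - (lam + \<gamma> - A / (sin (x/2))\<^sup>2 - B / (cos (x/2))\<^sup>2))) (at x)"
    if x: "0 < x" "x < pi" for x
    unfolding F_def by (rule derivative_eq_intros dv[OF x] dz[OF x] refl)+ (simp add: algebra_simps)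
  have bd: "\<bar>2 * z x * v x * (lam - (lam + \<gamma> - A / (sin (x/2))\<^sup>2 - B / (cos (x/2))\<^sup>2))\<bar> \<le> F x * (q x / sqrt lam)" for x
  proof -
    have "0 \<le> (\<bar>z x\<bar> - sqrt lam * \<bar>v x\<bar>)\<^sup>2" by simp
    hence "2 * (sqrt lam * \<bar>z x * v x\<bar>) \<le> F x"
      unfolding F_def using l by (simp add: power2_diff power_mult_distrib abs_mult algebra_simps)
    hence 1: "\<bar>2 * z x * v x\<bar> \<le> F x / sqrt lam" using l by (simp add: field_simps abs_mult)
    have a: "0 \<le> A / (sin (x/2))\<^sup>2" "0 \<le> B / (cos (x/2))\<^sup>2" using A B by auto
    have 2: "\<bar>lam - (lam + \<gamma> - A / (sin (x/2))\<^sup>2 - B / (cos (x/2))\<^sup>2)\<bar> \<le> q x"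
      using a g unfolding q_def by linarith
    have F0: "0 \<le> F x" unfolding F_def using l by simp
    have "\<bar>2 * z x * v x\<bar> * \<bar>lam - (lam + \<gamma> - A / (sin (x/2))\<^sup>2 - B / (cos (x/2))\<^sup>2)\<bar> \<le> (F x / sqrt lam) * q x"
      by (rule mult_mono[OF 1 2]) (use F0 l in auto)
    thus ?thesis by (simp add: abs_mult)
  qed
  have "F r * exp (\<Psi> r / sqrt lam) \<le> F s * exp (\<Psi> s / sqrt lam)"
  proof (rule DERIV_nonneg_imp_nondecreasing[OF r(2)])
    fix x assume "r \<le> x" "x \<le> s"
    hence x: "0 < x" "x < pi" using r by auto
    let ?D = "2 * z x * v x * (lam - (lam + \<gamma> - A / (sin (x/2))\<^sup>2 - B / (cos (x/2))\<^sup>2))"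
    have "((\<lambda>x. F x * exp (\<Psi> x / sqrt lam)) has_real_derivative (?D + F x * (q x / sqrt lam)) * exp (\<Psi> x / sqrt lam)) (at x)"
      using DERIV_mult[OF dF[OF x] DERIV_fun_exp[OF DERIV_cdivide[OF dPsi[OF x], of "sqrt lam"]]]
      by (simp add: algebra_simps)
    moreover have "0 \<le> (?D + F x * (q x / sqrt lam)) * exp (\<Psi> x / sqrt lam)"
      using bd[of x] by (intro mult_nonneg_nonneg) (simp_all only: abs_le_iff exp_ge_zero, linarith)
    ultimately show "\<exists>y. ((\<lambda>x. F x * exp (\<Psi> x / sqrt lam)) has_real_derivative y) (at x) \<and> 0 \<le> y" by blast
  qed
  thus "F r \<le> F s * exp ((\<Psi> s - \<Psi> r) / sqrt lam)"
    by (simp add: diff_divide_distrib exp_diff field_simps)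
  have "F s * exp (- \<Psi> s / sqrt lam) \<le> F r * exp (- \<Psi> r / sqrt lam)"
  proof (rule DERIV_nonpos_imp_nonincreasing[OF r(2)])
    fix x assume "r \<le> x" "x \<le> s"
    hence x: "0 < x" "x < pi" using r by auto
    let ?D = "2 * z x * v x * (lam - (lam + \<gamma> - A / (sin (x/2))\<^sup>2 - B / (cos (x/2))\<^sup>2))"
    have "((\<lambda>x. F x * exp (- \<Psi> x / sqrt lam)) has_real_derivative (?D - F x * (q x / sqrt lam)) * exp (- \<Psi> x / sqrt lam)) (at x)"
      using DERIV_mult[OF dF[OF x] DERIV_fun_exp[OF DERIV_cdivide[OF DERIV_minus[OF dPsi[OF x]], of "sqrt lam"]]]
      by (simp add: algebra_simps)
    moreover have "(?D - F x * (q x / sqrt lam)) * exp (- \<Psi> x / sqrt lam) \<le> 0"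
      using bd[of x] by (intro mult_nonpos_nonneg) (simp_all only: abs_le_iff exp_ge_zero, linarith)
    ultimately show "\<exists>y. ((\<lambda>x. F x * exp (- \<Psi> x / sqrt lam)) has_real_derivative y) (at x) \<and> y \<le> 0" by blast
  qed
  thus "F s \<le> F r * exp ((\<Psi> s - \<Psi> r) / sqrt lam)"
    by (simp add: diff_divide_distrib exp_diff exp_minus field_simps)
qed

lemma sturm_left:
  fixes v z :: "real \<Rightarrow> real"
  assumes A: "A \<ge> 0" and B: "B \<ge> 0" and g: "\<gamma> \<ge> 0" and l: "lam \<ge> 1"
  assumes dv: "\<And>r. 0 < r \<Longrightarrow> r < pi \<Longrightarrow> (v has_real_derivative z r) (at r)"
  assumes dz: "\<And>r. 0 < r \<Longrightarrow> r < pi \<Longrightarrow> (z has_real_derivative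
     - (lam + \<gamma> - A / (sin (r/2))\<^sup>2 - B / (cos (r/2))\<^sup>2) * v r) (at r)"
  assumes cont: "continuous_on {0..pi/2} v" and v0: "v 0 = 0"
  assumes e: "0 < \<epsilon>" "\<epsilon> \<le> 1" "A = 0 \<or> \<epsilon>\<^sup>2 * (1 + \<gamma>) \<le> 4 * A"
  defines "F \<equiv> \<lambda>r. (z r)\<^sup>2 + lam * (v r)\<^sup>2"
  defines "K \<equiv> exp (2 * (\<gamma> * pi + 4 * A / \<epsilon> + 2 * B))"
  shows "\<epsilon> / sqrt lam \<le> r \<Longrightarrow> r \<le> pi/2 \<Longrightarrow> F r \<le> K * F (pi/2)"
    and "\<epsilon> / sqrt lam \<le> r \<Longrightarrow> r \<le> pi/2 \<Longrightarrow> F (pi/2) \<le> K * F r"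
    and "0 < r \<Longrightarrow> r \<le> pi/2 \<Longrightarrow> lam * (v r)\<^sup>2 \<le> K * F (pi/2)"
proof -
  define \<Psi> where "\<Psi> r = \<gamma> * r - 2 * A * (cos (r/2) / sin (r/2)) + 2 * B * (sin (r/2) / cos (r/2))" for r
  have F0: "0 \<le> F r" for r unfolding F_def using l by simp
  have sl: "1 \<le> sqrt lam" using l by simp
  have el: "\<epsilon> / sqrt lam \<le> 1" using order_trans[OF e(2) sl] sl by (subst divide_le_eq_1_pos) (linarith | simp)+
  have Psi: "\<bar>\<Psi> r\<bar> \<le> (\<gamma> * pi + 4 * A / \<epsilon> + 2 * B) * sqrt lam"
    if r: "0 < r" "r \<le> pi/2" "A = 0 \<or> \<epsilon> / sqrt lam \<le> r" for r
  proof -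
    have s: "sin (r/2) > 0" "cos (r/2) > 0" using r by (auto intro!: sin_gt_zero cos_gt_zero)
    have 1: "\<bar>\<gamma> * r\<bar> \<le> \<gamma> * pi * sqrt lam"
    proof -
      have "\<gamma> * r \<le> \<gamma> * pi" using g r pi_gt_zero by (intro mult_left_mono) auto
      also have "... \<le> \<gamma> * pi * sqrt lam" using mult_left_mono[OF sl, of "\<gamma> * pi"] g by simp
      finally show ?thesis using g r by simp
    qed
    have 2: "\<bar>2 * A * (cos (r/2) / sin (r/2))\<bar> \<le> 4 * A / \<epsilon> * sqrt lam"
    proof (cases "A = 0")
      case False
      hence r': "\<epsilon> / sqrt lam \<le> r" using r by auto
      have "r / 2 * cos (r/2) \<le> sin (r/2)"
        using x_cos_x_le_sin_x[of "r/2"] r by simp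
      hence "cos (r/2) / sin (r/2) \<le> 2 / r" using s r by (simp add: field_simps)
      also have "... \<le> 2 * sqrt lam / \<epsilon>" using r r' e sl by (simp add: field_simps)
      finally have "2 * A * (cos (r/2) / sin (r/2)) \<le> 2 * A * (2 * sqrt lam / \<epsilon>)"
        using A by (intro mult_left_mono) auto
      thus ?thesis using s A by (simp add: abs_mult)
    qed auto
    have 3: "\<bar>2 * B * (sin (r/2) / cos (r/2))\<bar> \<le> 2 * B * sqrt lam"
    proof -
      have "sin (r/2) \<le> cos (r/2)"
      proof -
        have "sin (r/2) \<le> sin (pi/2 - r/2)" using r by (intro sin_monotone_2pi_le) auto
        thus ?thesis by (simp add: sin_diff)
      qed
      also have "1 * cos (r/2) \<le> sqrt lam * cos (r/2)" by (rule mult_right_mono[OF sl less_imp_le[OF s(2)]])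
      hence "cos (r/2) \<le> sqrt lam * cos (r/2)" by (simp only: mult_1)
      finally have "sin (r/2) / cos (r/2) \<le> sqrt lam" using s by (simp only: pos_divide_le_eq)
      hence "2 * B * (sin (r/2) / cos (r/2)) \<le> 2 * B * sqrt lam" using B by (intro mult_left_mono) auto
      thus ?thesis using B s by (simp add: abs_mult)
    qed
    have "\<bar>\<Psi> r\<bar> \<le> \<gamma> * pi * sqrt lam + 4 * A / \<epsilon> * sqrt lam + 2 * B * sqrt lam"
      unfolding \<Psi>_def using 1 2 3 by linarith
    thus ?thesis by (simp only: distrib_right)
  qed
  have cmp: "F r \<le> K * F (pi/2) \<and> F (pi/2) \<le> K * F r" if r: "0 < r" "r \<le> pi/2" "A = 0 \<or> \<epsilon> / sqrt lam \<le> r" for r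
  proof -
    have "\<epsilon> / sqrt lam \<le> pi/2" using pi_gt3 el by linarith
    hence h: "0 < pi/2" "pi/2 \<le> pi/2" "A = 0 \<or> \<epsilon> / sqrt lam \<le> pi/2" by auto
    have "\<Psi> (pi/2) - \<Psi> r \<le> 2 * (\<gamma> * pi + 4 * A / \<epsilon> + 2 * B) * sqrt lam"
      using Psi[OF r] Psi[OF h] by linarith
    hence "(\<Psi> (pi/2) - \<Psi> r) / sqrt lam \<le> 2 * (\<gamma> * pi + 4 * A / \<epsilon> + 2 * B)"
      using sl by (simp add: divide_le_eq)
    hence K: "exp ((\<Psi> (pi/2) - \<Psi> r) / sqrt lam) \<le> K" unfolding K_def by simp
    have l0: "lam > 0" using l by simp
    have "F r \<le> F (pi/2) * exp ((\<Psi> (pi/2) - \<Psi> r) / sqrt lam)"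
      unfolding F_def \<Psi>_def using sturm_gronwall(1)[OF A B g l0 dv dz r(1,2)] by simp
    moreover have "F (pi/2) \<le> F r * exp ((\<Psi> (pi/2) - \<Psi> r) / sqrt lam)"
      unfolding F_def \<Psi>_def using sturm_gronwall(2)[OF A B g l0 dv dz r(1,2)] by simp
    ultimately show ?thesis using mult_left_mono[OF K F0] by (metis mult.commute order_trans)
  qed
  show "\<epsilon> / sqrt lam \<le> r \<Longrightarrow> r \<le> pi/2 \<Longrightarrow> F r \<le> K * F (pi/2)"
       "\<epsilon> / sqrt lam \<le> r \<Longrightarrow> r \<le> pi/2 \<Longrightarrow> F (pi/2) \<le> K * F r"
    using cmp[of r] divide_pos_pos[OF e(1), of "sqrt lam"] sl by (auto dest: less_le_trans)
  have far: "lam * (v r)\<^sup>2 \<le> K * F (pi/2)" if "0 < r" "r \<le> pi/2" "A = 0 \<or> \<epsilon> / sqrt lam \<le> r" for r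
    using cmp[OF that] unfolding F_def by (meson le_add_same_cancel2 order_trans zero_le_power2)
  assume r: "0 < r" "r \<le> pi/2"
  show "lam * (v r)\<^sup>2 \<le> K * F (pi/2)"
  proof (cases "A = 0 \<or> \<epsilon> / sqrt lam \<le> r")
    case True thus ?thesis using far r by blast
  next
    case False
    define s where "s = \<epsilon> / sqrt lam"
    have s: "0 < s" "r < s" "s \<le> 1" "A \<noteq> 0" using False e(1) l el unfolding s_def by auto
    \<comment> \<open>In the inner zone \<open>sin (x/2) \<le> \<epsilon> / (2 sqrt lam)\<close>,
      and the condition on \<open>\<epsilon>\<close> turns this into
      \<open>A / sin^2 \<ge> lam (1 + \<gamma>)\<close>.\<close>
    have q: "lam + \<gamma> - A / (sin (x/2))\<^sup>2 - B / (cos (x/2))\<^sup>2 \<le> 0" if x: "0 < x" "x \<le> s" for x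
    proof -
      have x1: "x < pi" using x s pi_gt3 by linarith
      have sp: "0 < sin (x/2)" using x x1 by (intro sin_gt_zero) auto
      have "sin (x/2) \<le> x/2" using x by (intro sin_x_le_x) auto
      also have "... \<le> \<epsilon> / (2 * sqrt lam)" using x unfolding s_def by simp
      finally have "(sin (x/2))\<^sup>2 \<le> (\<epsilon> / (2 * sqrt lam))\<^sup>2" using sp by (intro power_mono) auto
      hence "(sin (x/2))\<^sup>2 * (4 * lam) \<le> \<epsilon>\<^sup>2" using l by (simp add: power_divide power_mult_distrib field_simps)
      hence "(sin (x/2))\<^sup>2 * (4 * lam) * (1 + \<gamma>) \<le> \<epsilon>\<^sup>2 * (1 + \<gamma>)" using g by (intro mult_right_mono) auto
      also have "... \<le> 4 * A" using e s by auto
      finally have 1: "lam * (1 + \<gamma>) \<le> A / (sin (x/2))\<^sup>2" using sp by (simp add: field_simps)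
      have "\<gamma> \<le> lam * \<gamma>" using g l by (simp add: mult_le_cancel_right1)
      hence "lam + \<gamma> \<le> A / (sin (x/2))\<^sup>2" using 1 by (simp add: algebra_simps)
      moreover have "0 \<le> B / (cos (x/2))\<^sup>2" using B by simp
      ultimately show ?thesis by linarith
    qed
    \<comment> \<open>\<open>v z\<close> is nondecreasing, its derivative being \<open>z^2\<close>
      minus a nonpositive potential times \<open>v^2\<close>. If it were negative at
      \<open>x\<close>, it would be at most that value on all of \<open>(0, x)\<close>, and
      \<open>v^2\<close> would decrease at a fixed rate starting from
      \<open>v 0 = 0\<close>.\<close>
    have vz: "0 \<le> v x * z x" if x: "0 < x" "x \<le> s" for x
    proof -
      have mono: "v y * z y \<le> v x * z x" if y: "0 < y" "y \<le> x" for y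
      proof (rule DERIV_nonneg_imp_nondecreasing[OF y(2)])
        fix t assume t: "y \<le> t" "t \<le> x"
        hence t': "0 < t" "t < pi" "t \<le> s" using x y s pi_gt3 by auto
        let ?q = "lam + \<gamma> - A / (sin (t/2))\<^sup>2 - B / (cos (t/2))\<^sup>2"
        have "((\<lambda>t. v t * z t) has_real_derivative (z t)\<^sup>2 + (- ?q) * (v t)\<^sup>2) (at t)"
          using DERIV_mult[OF dv[OF t'(1,2)] dz[OF t'(1,2)]] by (simp add: power2_eq_square algebra_simps)
        moreover have "0 \<le> (z t)\<^sup>2 + (- ?q) * (v t)\<^sup>2" using q[OF t'(1,3)]
          by (intro add_nonneg_nonneg mult_nonneg_nonneg) auto
        ultimately show "\<exists>d. ((\<lambda>t. v t * z t) has_real_derivative d) (at t) \<and> 0 \<le> d" by blast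
      qed
      show ?thesis
      proof (rule ccontr)
        assume neg: "\<not> 0 \<le> v x * z x"
        define c where "c = - 2 * (v x * z x)"
        have c: "c > 0" using neg by (simp add: c_def)
        have "(v x)\<^sup>2 + c * x \<le> (v 0)\<^sup>2 + c * 0"
        proof (rule DERIV_nonpos_imp_decreasing_open[of 0 x "\<lambda>t. (v t)\<^sup>2 + c * t"])
          fix t assume t: "0 < t" "t < x"
          hence t': "0 < t" "t < pi" using x s pi_gt3 by auto
          have "((\<lambda>t. (v t)\<^sup>2 + c * t) has_real_derivative 2 * (v t * z t) + c) (at t)"
            by (rule derivative_eq_intros dv[OF t'] refl)+ simp
          thus "\<exists>y. ((\<lambda>t. (v t)\<^sup>2 + c * t) has_real_derivative y) (at t) \<and> y \<le> 0"
            using mono[of t] t by (intro exI[of _ "2 * (v t * z t) + c"]) (auto simp: c_def)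
        next
          have "{0..x} \<subseteq> {0..pi/2}" using x s pi_gt3 by auto
          thus "continuous_on {0..x} (\<lambda>t. (v t)\<^sup>2 + c * t)"
            by (intro continuous_intros continuous_on_subset[OF cont])
        qed (use x in auto)
        moreover have "0 < c * x" using c x by simp
        moreover have "0 \<le> (v x)\<^sup>2" by simp
        ultimately show False using v0 by simp
      qed
    qed
    have "(v r)\<^sup>2 \<le> (v s)\<^sup>2"
    proof (rule DERIV_nonneg_imp_nondecreasing[of r s "\<lambda>x. (v x)\<^sup>2"])
      show "r \<le> s" using s by simp
      fix x assume x: "r \<le> x" "x \<le> s"
      hence x': "0 < x" "x < pi" using r s pi_gt3 by auto
      have "((\<lambda>x. (v x)\<^sup>2) has_real_derivative 2 * (v x * z x)) (at x)"
        by (rule derivative_eq_intros dv[OF x'] refl)+ simp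
      thus "\<exists>y. ((\<lambda>x. (v x)\<^sup>2) has_real_derivative y) (at x) \<and> 0 \<le> y"
        using vz[of x] x x' by (intro exI[of _ "2 * (v x * z x)"]) auto
    qed
    hence "lam * (v r)\<^sup>2 \<le> lam * (v s)\<^sup>2" using l by simp
    also have "... \<le> K * F (pi/2)"
    proof (rule far)
      show "s \<le> pi/2" using s pi_gt3 by linarith
    qed (use s in \<open>auto simp: s_def\<close>)
    finally show ?thesis .
  qed
qed

text \<open>Integrating the derivative of \<open>v z\<close> over \<open>[L/2t, L/t]\<close> trades
  the integral of the energy for one of \<open>v^2\<close>, up to boundary terms. On this interval
  the energy is at least \<open>F (pi/2) / K\<close>, so its integral grows with the length
  \<open>L/2t\<close>, whereas the boundary terms stay below \<open>K F (pi/2) / t\<close>. With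
  \<open>L \<ge> 4 K^2\<close> half of the main term absorbs them. The value \<open>v r\<close> at
  an arbitrary radius is in turn bounded through \<open>F (pi/2)\<close>.\<close>

lemma sturm_energy:
  fixes v z :: "real \<Rightarrow> real"
  assumes A: "A \<ge> 0" and B: "B \<ge> 0" and g: "\<gamma> \<ge> 0" and l: "lam \<ge> 1"
  assumes dv: "\<And>r. 0 < r \<Longrightarrow> r < pi \<Longrightarrow> (v has_real_derivative z r) (at r)"
  assumes dz: "\<And>r. 0 < r \<Longrightarrow> r < pi \<Longrightarrow> (z has_real_derivative
     - (lam + \<gamma> - A / (sin (r/2))\<^sup>2 - B / (cos (r/2))\<^sup>2) * v r) (at r)"
  assumes cont: "continuous_on {0..pi} v" and v0: "v 0 = 0" and vpi: "v pi = 0"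
  assumes e: "0 < \<epsilon>" "\<epsilon> \<le> 1" "A = 0 \<or> \<epsilon>\<^sup>2 * (1 + \<gamma>) \<le> 4 * A" "B = 0 \<or> \<epsilon>\<^sup>2 * (1 + \<gamma>) \<le> 4 * B"
  defines "K \<equiv> exp (2 * (\<gamma> * pi + 4 * A / \<epsilon> + 4 * B / \<epsilon>))"
  assumes L: "L \<ge> 4 * K\<^sup>2" and t: "t > 0" "t \<le> sqrt lam" "L / t \<le> pi/2"
  assumes r: "0 < r" "r < pi"
  shows "(v r)\<^sup>2 \<le> 4 * K\<^sup>2 * (2 + \<gamma>) * (t / L) * integral {L/(2*t)..L/t} (\<lambda>x. (v x)\<^sup>2)"
proof -
  define F where "F r = (z r)\<^sup>2 + lam * (v r)\<^sup>2" for r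
  have F0: "0 \<le> F r" for r unfolding F_def using l by simp
  have BB: "4 * B \<le> 4 * B / \<epsilon>" and AA: "4 * A \<le> 4 * A / \<epsilon>"
    using e A B by (simp_all add: field_simps mult_left_le)
  have K1: "exp (2 * (\<gamma> * pi + 4 * A / \<epsilon> + 2 * B)) \<le> K" unfolding K_def using BB B by simp
  have K2: "exp (2 * (\<gamma> * pi + 4 * B / \<epsilon> + 2 * A)) \<le> K" unfolding K_def using AA A by simp
  have K0: "1 \<le> K" unfolding K_def using A B g e by simp
  have Kp: "0 < K" using K0 by simp
  have cl: "continuous_on {0..pi/2} v" by (rule continuous_on_subset[OF cont]) (use pi_gt_zero in auto)
  note left = sturm_left[where v = v and z = z, OF A B g l dv dz cl v0 e(1,2,3)]
  have cmp: "F x \<le> K * F (pi/2)" "F (pi/2) \<le> K * F x" if "\<epsilon> / sqrt lam \<le> x" "x \<le> pi/2" for x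
    using left(1,2)[of x] that mult_right_mono[OF K1 F0] unfolding F_def by (meson order_trans)+
  have m: "((\<lambda>r. pi - r) has_real_derivative -1) (at r)" for r
    by (auto intro!: derivative_eq_intros)
  \<comment> \<open>Reflection at \<open>pi/2\<close> exchanges \<open>A\<close> and
    \<open>B\<close>, so the bound near 0 also serves the right half.\<close>
  have dv': "((\<lambda>r. v (pi - r)) has_real_derivative - z (pi - r)) (at r)" if "0 < r" "r < pi" for r
    using DERIV_chain'[OF m dv[of "pi - r"]] that by simp
  have dz': "((\<lambda>r. - z (pi - r)) has_real_derivative - (lam + \<gamma> - B / (sin (r/2))\<^sup>2 - A / (cos (r/2))\<^sup>2) * v (pi - r)) (at r)"
    if "0 < r" "r < pi" for r
  proof -
    have "sin ((pi - r)/2) = cos (r/2)" "cos ((pi - r)/2) = sin (r/2)"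
      by (simp_all add: diff_divide_distrib sin_diff cos_diff)
    thus ?thesis
      using DERIV_minus[OF DERIV_chain'[OF m dz[of "pi - r"]]] that by (simp add: algebra_simps)
  qed
  have cr: "continuous_on {0..pi/2} (\<lambda>r. v (pi - r))"
    by (rule continuous_on_compose2[OF cont]) (auto intro!: continuous_intros)
  have lamv: "lam * (v r)\<^sup>2 \<le> K * F (pi/2)"
  proof (cases "r \<le> pi/2")
    case True
    thus ?thesis using left(3)[of r] r mult_right_mono[OF K1 F0] unfolding F_def by (meson order_trans)
  next
    case False
    have "lam * (v (pi - (pi - r)))\<^sup>2 \<le> exp (2 * (\<gamma> * pi + 4 * B / \<epsilon> + 2 * A)) * ((- z (pi - pi/2))\<^sup>2 + lam * (v (pi - pi/2))\<^sup>2)"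
      by (rule sturm_left(3)[where v = "\<lambda>r. v (pi - r)" and z = "\<lambda>r. - z (pi - r)", OF B A g l dv' dz' cr _ e(1,2,4)])
         (use False r vpi in auto)
    also have "... \<le> K * F (pi/2)" using mult_right_mono[OF K2 F0[of "pi/2"]] unfolding F_def by simp
    finally show ?thesis by simp
  qed
  define a b where "a = L/(2*t)" and "b = L/t"
  have sl: "1 \<le> sqrt lam" using l by simp
  have "1 \<le> K\<^sup>2" using K0 by (rule one_le_power)
  hence L4: "4 \<le> L" using L by simp
  have ab: "0 < a" "a < b" "b \<le> pi/2" "b - a = L/(2*t)" using t L4 unfolding a_def b_def by (auto simp: field_simps)
  \<comment> \<open>The averaging interval lies outside the inner zone, because
    \<open>L \<ge> 4\<close> and \<open>t \<le> sqrt lam\<close>.\<close>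
  have ea: "\<epsilon> / sqrt lam \<le> a"
  proof -
    have "\<epsilon> / sqrt lam \<le> 1 / t" using e t sl by (intro frac_le) auto
    also have "1 / t \<le> L / (2*t)" using t L4 by (simp add: field_simps)
    finally show ?thesis unfolding a_def .
  qed
  define Q where "Q x = lam + \<gamma> - A / (sin (x/2))\<^sup>2 - B / (cos (x/2))\<^sup>2" for x
  define F1 where "F1 = F (pi/2)"
  have in_ab: "0 < x" "x < pi" "\<epsilon> / sqrt lam \<le> x" "x \<le> pi/2" if "x \<in> {a..b}" for x
    using that ab ea pi_gt3 by auto
  have vzb: "\<bar>v x * z x\<bar> \<le> K * F1 / (2 * sqrt lam)" if "x \<in> {a..b}" for x
  proof -
    have "0 \<le> (\<bar>z x\<bar> - sqrt lam * \<bar>v x\<bar>)\<^sup>2" by simp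
    hence "2 * (sqrt lam * \<bar>v x * z x\<bar>) \<le> F x"
      unfolding F_def using l by (simp add: power2_diff power_mult_distrib abs_mult algebra_simps)
    also have "... \<le> K * F1" unfolding F1_def using cmp(1) in_ab[OF that] by blast
    finally show ?thesis using sl by (simp add: field_simps)
  qed
  have cv: "continuous_on {a..b} v" "continuous_on {a..b} z"
    using in_ab by (auto intro!: continuous_at_imp_continuous_on DERIV_isCont dv dz)
  have cv2: "(\<lambda>x. (v x)\<^sup>2) integrable_on {a..b}"
    by (intro integrable_continuous_interval continuous_intros cv)
  have "((\<lambda>x. (z x)\<^sup>2 - Q x * (v x)\<^sup>2) has_integral (v b * z b - v a * z a)) {a..b}"
  proof (rule fundamental_theorem_of_calculus)
    show "a \<le> b" using ab by simp
    fix x assume "x \<in> {a..b}"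
    note x = in_ab[OF this]
    have "((\<lambda>x. v x * z x) has_real_derivative (z x)\<^sup>2 - Q x * (v x)\<^sup>2) (at x)"
      using DERIV_mult[OF dv[OF x(1,2)] dz[OF x(1,2)]] unfolding Q_def by (simp add: power2_eq_square algebra_simps)
    thus "((\<lambda>x. v x * z x) has_vector_derivative (z x)\<^sup>2 - Q x * (v x)\<^sup>2) (at x within {a..b})"
      by (simp add: has_real_derivative_iff_has_vector_derivative has_vector_derivative_at_within)
  qed
  moreover have "((\<lambda>x. (2 + \<gamma>) * lam * (v x)\<^sup>2) has_integral ((2 + \<gamma>) * lam * integral {a..b} (\<lambda>x. (v x)\<^sup>2))) {a..b}"
    using cv2 by (intro has_integral_mult_right integrable_integral)
  ultimately have up: "((\<lambda>x. ((z x)\<^sup>2 - Q x * (v x)\<^sup>2) + (2 + \<gamma>) * lam * (v x)\<^sup>2) has_integral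
      ((v b * z b - v a * z a) + (2 + \<gamma>) * lam * integral {a..b} (\<lambda>x. (v x)\<^sup>2))) {a..b}"
    by (rule has_integral_add)
  have lo: "((\<lambda>x. F1 / K) has_integral (F1 / K * (b - a))) {a..b}"
    using has_integral_const_real[of "F1 / K" a b] ab by (simp add: mult.commute)
  have "F1 / K \<le> ((z x)\<^sup>2 - Q x * (v x)\<^sup>2) + (2 + \<gamma>) * lam * (v x)\<^sup>2" if "x \<in> {a..b}" for x
  proof -
    have "F1 / K \<le> F x" unfolding F1_def using cmp(2) in_ab[OF that] Kp by (simp add: divide_le_eq mult.commute)
    moreover have "(lam + Q x) * (v x)\<^sup>2 \<le> (2 + \<gamma>) * lam * (v x)\<^sup>2"
    proof (rule mult_right_mono)
      have "\<gamma> \<le> \<gamma> * lam" using g l by (simp add: mult_le_cancel_left1)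
      moreover have "Q x \<le> lam + \<gamma>" unfolding Q_def using divide_nonneg_nonneg[OF A, of "(sin (x/2))\<^sup>2"] divide_nonneg_nonneg[OF B, of "(cos (x/2))\<^sup>2"] by simp
      ultimately show "lam + Q x \<le> (2 + \<gamma>) * lam" by (simp add: algebra_simps)
    qed auto
    ultimately show ?thesis unfolding F_def by (simp add: algebra_simps)
  qed
  hence main: "F1 / K * (b - a) \<le> (v b * z b - v a * z a) + (2 + \<gamma>) * lam * integral {a..b} (\<lambda>x. (v x)\<^sup>2)"
    by (rule has_integral_le[OF lo up])
  have "v b * z b - v a * z a \<le> 2 * (K * F1 / (2 * sqrt lam))"
  proof -
    have "\<bar>v a * z a\<bar> \<le> K * F1 / (2 * sqrt lam)" "\<bar>v b * z b\<bar> \<le> K * F1 / (2 * sqrt lam)"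
      using vzb ab by auto
    thus ?thesis by linarith
  qed
  also have "... \<le> K * F1 / t" using mult_pos_pos[of "sqrt lam" t] t l Kp F0[of "pi/2"] unfolding F1_def by (auto intro!: divide_left_mono mult_nonneg_nonneg)
  also have "... \<le> F1 / (2*K) * (b - a)"
  proof -
    have "K * (2*K) * (2 * t) \<le> L * t" using L t by (simp add: power2_eq_square)
    hence "K / t \<le> 1 / (2*K) * (b - a)" using Kp t ab(4) by (simp add: field_simps)
    from mult_right_mono[OF this F0[of "pi/2"]] show ?thesis unfolding F1_def by (simp add: mult_ac)
  qed
  finally have "F1 / (2*K) * (b - a) \<le> (2 + \<gamma>) * lam * integral {a..b} (\<lambda>x. (v x)\<^sup>2)"
    using main by simp
  hence "K * F1 \<le> 4 * K\<^sup>2 * (2 + \<gamma>) * (t/L) * lam * integral {a..b} (\<lambda>x. (v x)\<^sup>2)"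
  proof -
    assume "F1 / (2*K) * (b - a) \<le> (2 + \<gamma>) * lam * integral {a..b} (\<lambda>x. (v x)\<^sup>2)"
    hence "4 * K\<^sup>2 * (t/L) * (F1 / (2*K) * (b - a)) \<le> 4 * K\<^sup>2 * (t/L) * ((2 + \<gamma>) * lam * integral {a..b} (\<lambda>x. (v x)\<^sup>2))"
      using t L4 by (intro mult_left_mono) auto
    moreover have "4 * K\<^sup>2 * (t/L) * (F1 / (2*K) * (b - a)) = K * F1"
      unfolding ab(4) using Kp t L4 by (simp add: field_simps power2_eq_square)
    ultimately show ?thesis by (simp only: mult_ac)
  qed
  with lamv have "lam * (v r)\<^sup>2 \<le> lam * (4 * K\<^sup>2 * (2 + \<gamma>) * (t/L) * integral {a..b} (\<lambda>x. (v x)\<^sup>2))"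
    unfolding F1_def by (simp add: mult_ac)
  thus ?thesis using l unfolding a_def b_def by (simp only: mult_le_cancel_left_pos[of lam])
qed

section \<open>Jacobi polynomials\<close>

definition jacobi_op :: "nat \<Rightarrow> nat \<Rightarrow> real poly \<Rightarrow> real poly" where
  "jacobi_op d d\<^sub>0 p = [:0, 2, -1:] * pderiv (pderiv p) + [:real d, - (real d + real d\<^sub>0) / 2:] * pderiv p"

definition jacobi_eigenvalue :: "nat \<Rightarrow> nat \<Rightarrow> nat \<Rightarrow> real" where
  "jacobi_eigenvalue d d\<^sub>0 l = real l * (real l + (real d + real d\<^sub>0) / 2 - 1)"

text \<open>The Jacobi operator sends \<open>X^k\<close> to \<open>k (2k - 2 + d) X^(k-1)\<close>
  minus the \<open>k\<close>-th eigenvalue times \<open>X^k\<close>. Comparing coefficients in the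
  eigenvalue equation gives this recursion, normalised by the value 1 at \<open>X = 0\<close>; the
  factor at \<open>k = l\<close> vanishes, so the series stops. In the variable \<open>cos r\<close>
  these are multiples of the classical Jacobi polynomials with parameters \<open>d/2 - 1\<close> and
  \<open>d\<^sub>0/2 - 1\<close>.\<close>

fun jacobi_coeff :: "nat \<Rightarrow> nat \<Rightarrow> nat \<Rightarrow> nat \<Rightarrow> real" where
  "jacobi_coeff d d\<^sub>0 l 0 = 1"
| "jacobi_coeff d d\<^sub>0 l (Suc k) = jacobi_coeff d d\<^sub>0 l k *
     (jacobi_eigenvalue d d\<^sub>0 k - jacobi_eigenvalue d d\<^sub>0 l) / (real (Suc k) * (2 * real k + real d))"

definition jacobi_poly :: "nat \<Rightarrow> nat \<Rightarrow> nat \<Rightarrow> real poly" where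
  "jacobi_poly d d\<^sub>0 l = (\<Sum>k\<le>l. monom (jacobi_coeff d d\<^sub>0 l k) k)"

text \<open>Up to normalisation the density of the distance to a fixed point. For a sphere, where
  \<open>d\<^sub>0 = d\<close>, it is a multiple of \<open>sin r ^ (d - 1)\<close>.\<close>

definition weight :: "nat \<Rightarrow> nat \<Rightarrow> real \<Rightarrow> real" where
  "weight d d\<^sub>0 r = sin (r/2) ^ (d - 1) * cos (r/2) ^ (d\<^sub>0 - 1)"

lemma jacobi_coeff_eq_0: "k > l \<Longrightarrow> jacobi_coeff d d\<^sub>0 l k = 0"
proof (induction k)
  case (Suc k)
  thus ?case by (cases "k = l") auto
qed simp

lemma coeff_jacobi_poly: "coeff (jacobi_poly d d\<^sub>0 l) k = jacobi_coeff d d\<^sub>0 l k"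
  using jacobi_coeff_eq_0[of l k d d\<^sub>0] by (cases "k \<le> l") (auto simp: jacobi_poly_def coeff_sum)

lemma jacobi_eigenvalue_strict_mono:
  assumes "1 \<le> d" "1 \<le> d\<^sub>0" "k < l"
  shows "jacobi_eigenvalue d d\<^sub>0 k < jacobi_eigenvalue d d\<^sub>0 l"
proof -
  have "real k + 1 \<le> real l" using assms by linarith
  moreover have "1 \<le> real d" "1 \<le> real d\<^sub>0" using assms by simp_all
  hence "1 \<le> (real d + real d\<^sub>0)/2" by (simp add: field_simps)
  ultimately have "real k * (real k + ((real d + real d\<^sub>0) / 2 - 1)) < real l * (real l + ((real d + real d\<^sub>0) / 2 - 1))"
    by (intro mult_strict_mono) auto
  thus ?thesis unfolding jacobi_eigenvalue_def by (simp only: add_diff_eq)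
qed

lemma jacobi_eigenvalue_ge:
  assumes "1 \<le> d" "1 \<le> d\<^sub>0" shows "(real l)\<^sup>2 \<le> jacobi_eigenvalue d d\<^sub>0 l"
  using assms unfolding jacobi_eigenvalue_def power2_eq_square by (intro mult_left_mono) auto

lemma jacobi_coeff_nonzero:
  assumes "1 \<le> d" "1 \<le> d\<^sub>0"
  shows "k \<le> l \<Longrightarrow> jacobi_coeff d d\<^sub>0 l k \<noteq> 0"
proof (induction k)
  case (Suc k)
  thus ?case using jacobi_eigenvalue_strict_mono[OF assms, of k l] assms by auto
qed simp

lemma degree_jacobi_poly:
  assumes "1 \<le> d" "1 \<le> d\<^sub>0"
  shows "degree (jacobi_poly d d\<^sub>0 l) = l"
  using jacobi_coeff_nonzero[OF assms, of l l] jacobi_coeff_eq_0[of l _ d d\<^sub>0]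
  by (intro antisym degree_le le_degree) (auto simp: coeff_jacobi_poly)

lemma jacobi_poly_0: "jacobi_poly d d\<^sub>0 0 = 1"
  by (simp add: jacobi_poly_def)

lemma jacobi_op_jacobi_poly:
  assumes "1 \<le> d"
  shows "jacobi_op d d\<^sub>0 (jacobi_poly d d\<^sub>0 l) = smult (- jacobi_eigenvalue d d\<^sub>0 l) (jacobi_poly d d\<^sub>0 l)"
proof (rule poly_eqI)
  fix k
  let ?c = "jacobi_coeff d d\<^sub>0 l"
  have rec: "?c (Suc k) * (real (Suc k) * (2 * real k + real d)) = ?c k * (jacobi_eigenvalue d d\<^sub>0 k - jacobi_eigenvalue d d\<^sub>0 l)" for k
    using assms by simp
  have "coeff (jacobi_op d d\<^sub>0 (jacobi_poly d d\<^sub>0 l)) k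
      = ?c (Suc k) * (real (Suc k) * (2 * real k + real d)) - ?c k * jacobi_eigenvalue d d\<^sub>0 k"
    unfolding jacobi_op_def jacobi_eigenvalue_def
    by (cases k; cases "k - 1")
       (auto simp: coeff_pderiv coeff_jacobi_poly coeff_pCons mult_pCons_left field_simps simp del: jacobi_coeff.simps)
  thus "coeff (jacobi_op d d\<^sub>0 (jacobi_poly d d\<^sub>0 l)) k = coeff (smult (- jacobi_eigenvalue d d\<^sub>0 l) (jacobi_poly d d\<^sub>0 l)) k"
    unfolding rec by (simp add: coeff_jacobi_poly algebra_simps)
qed

lemma poly_eq_sum_jacobi_poly:
  assumes "1 \<le> d" "1 \<le> d\<^sub>0" "degree q \<le> n"
  shows "\<exists>c. q = (\<Sum>l\<le>n. smult (c l) (jacobi_poly d d\<^sub>0 l))"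
  using assms(3)
proof (induction n arbitrary: q)
  case 0
  then obtain a where "q = [:a:]" by (metis degree_0_id le_zero_eq degree_eq_zeroE)
  thus ?case by (intro exI[of _ "\<lambda>_. a"]) (simp add: jacobi_poly_0)
next
  case (Suc n)
  define a where "a = coeff q (Suc n) / jacobi_coeff d d\<^sub>0 (Suc n) (Suc n)"
  have "degree (q - smult a (jacobi_poly d d\<^sub>0 (Suc n))) \<le> n"
  proof (rule degree_le, intro allI impI)
    fix i assume i: "n < i"
    show "coeff (q - smult a (jacobi_poly d d\<^sub>0 (Suc n))) i = 0"
    proof (cases "i = Suc n")
      case True
      thus ?thesis using jacobi_coeff_nonzero[OF assms(1,2), of "Suc n" "Suc n"]
        by (simp add: a_def coeff_jacobi_poly del: jacobi_coeff.simps)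
    next
      case False
      hence "coeff q i = 0" using Suc.prems i by (intro coeff_eq_0) auto
      thus ?thesis using False i jacobi_coeff_eq_0[of "Suc n" i d d\<^sub>0] by (simp add: coeff_jacobi_poly del: jacobi_coeff.simps)
    qed
  qed
  from Suc.IH[OF this] obtain c where c: "q - smult a (jacobi_poly d d\<^sub>0 (Suc n)) = (\<Sum>l\<le>n. smult (c l) (jacobi_poly d d\<^sub>0 l))" by blast
  have "q = (\<Sum>l\<le>n. smult (c l) (jacobi_poly d d\<^sub>0 l)) + smult a (jacobi_poly d d\<^sub>0 (Suc n))"
    unfolding c[symmetric] by simp
  also have "... = (\<Sum>l\<le>Suc n. smult ((c(Suc n := a)) l) (jacobi_poly d d\<^sub>0 l))"
    by simp
  finally show ?case by blast
qed

section \<open>The flux of an eigenpolynomial and its Liouville form\<close>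

text \<open>The Sturm-Liouville flux: the weight times the derivative in \<open>r\<close> of
  \<open>p (1 - cos r)\<close>. For an eigenpolynomial it is a primitive of \<open>- lam\<close>
  times weight times polynomial, hence up to constants the Jacobi coefficient of a ball as a
  function of its radius.\<close>

definition jacobi_flux :: "nat \<Rightarrow> nat \<Rightarrow> real poly \<Rightarrow> real \<Rightarrow> real" where
  "jacobi_flux d d\<^sub>0 p r = weight d d\<^sub>0 r * sin r * poly (pderiv p) (1 - cos r)"

lemma poly_jacobi_op:
  "poly (jacobi_op d d\<^sub>0 p) (1 - cos r) = (sin r)\<^sup>2 * poly (pderiv (pderiv p)) (1 - cos r) +
     (real d - (real d + real d\<^sub>0) * (sin (r/2))\<^sup>2) * poly (pderiv p) (1 - cos r)"
proof -
  have c: "cos r = 1 - 2 * (sin (r/2))\<^sup>2" using cos_double_sin[of "r/2"] by simp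
  have s: "(sin r)\<^sup>2 = 1 - (cos r)\<^sup>2" by (simp add: sin_squared_eq)
  show ?thesis unfolding jacobi_op_def s unfolding c by (simp add: power2_eq_square field_simps)
qed

text \<open>Multiplication by \<open>sin r\<close> keeps the formula for the logarithmic derivative
  valid at the endpoints and for exponents 0.\<close>

lemma weight_deriv:
  assumes "1 \<le> d" "1 \<le> d\<^sub>0"
  obtains w' where "(weight d d\<^sub>0 has_real_derivative w') (at r)"
    "w' * sin r = weight d d\<^sub>0 r * ((real d - 1) * (cos (r/2))\<^sup>2 - (real d\<^sub>0 - 1) * (sin (r/2))\<^sup>2)"
proof -
  obtain a b where ab: "d = Suc a" "d\<^sub>0 = Suc b" using assms by (metis Suc_le_D One_nat_def)
  let ?w = "(real a * sin (r/2) ^ (a - 1) * (cos (r/2) / 2)) * cos (r/2) ^ b + (real b * cos (r/2) ^ (b - 1) * (- sin (r/2) / 2)) * sin (r/2) ^ a"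
  have "(weight d d\<^sub>0 has_real_derivative ?w) (at r)"
    unfolding weight_def ab by (auto intro!: derivative_eq_intros simp: field_simps)
  moreover have "?w * sin r = weight d d\<^sub>0 r * ((real d - 1) * (cos (r/2))\<^sup>2 - (real d\<^sub>0 - 1) * (sin (r/2))\<^sup>2)"
  proof -
    have s: "sin r = 2 * sin (r/2) * cos (r/2)" using sin_double[of "r/2"] by simp
    show ?thesis unfolding s weight_def ab
      by (cases a; cases b) (simp_all add: power2_eq_square algebra_simps)
  qed
  ultimately show ?thesis using that by blast
qed

lemma jacobi_flux_deriv:
  assumes "1 \<le> d" "1 \<le> d\<^sub>0" and P: "jacobi_op d d\<^sub>0 P = smult (- lam) P"
  shows "(jacobi_flux d d\<^sub>0 P has_real_derivative - lam * (weight d d\<^sub>0 r * poly P (1 - cos r))) (at r)"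
proof -
  obtain w' where w: "(weight d d\<^sub>0 has_real_derivative w') (at r)"
    "w' * sin r = weight d d\<^sub>0 r * ((real d - 1) * (cos (r/2))\<^sup>2 - (real d\<^sub>0 - 1) * (sin (r/2))\<^sup>2)"
    using weight_deriv[OF assms(1,2)] by blast
  have c: "cos r = 1 - 2 * (sin (r/2))\<^sup>2" using cos_double_sin[of "r/2"] by simp
  have c2: "(cos (r/2))\<^sup>2 = 1 - (sin (r/2))\<^sup>2" by (simp add: cos_squared_eq)
  have p: "- lam * poly P (1 - cos r) = (sin r)\<^sup>2 * poly (pderiv (pderiv P)) (1 - cos r) +
     (real d - (real d + real d\<^sub>0) * (sin (r/2))\<^sup>2) * poly (pderiv P) (1 - cos r)"
    using poly_jacobi_op[of d d\<^sub>0 P r] unfolding P by simp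
  have dp: "((\<lambda>r. poly (pderiv P) (1 - cos r)) has_real_derivative poly (pderiv (pderiv P)) (1 - cos r) * sin r) (at r)"
  proof -
    have "((\<lambda>r. 1 - cos r) has_real_derivative sin r) (at r)" by (auto intro!: derivative_eq_intros)
    from DERIV_chain'[OF this poly_DERIV[of "pderiv P"]] show ?thesis by (simp add: mult.commute)
  qed
  have "(jacobi_flux d d\<^sub>0 P has_real_derivative (w' * sin r + cos r * weight d d\<^sub>0 r) * poly (pderiv P) (1 - cos r)
      + poly (pderiv (pderiv P)) (1 - cos r) * sin r * (weight d d\<^sub>0 r * sin r)) (at r)"
    unfolding jacobi_flux_def[abs_def] by (intro DERIV_mult w DERIV_sin dp)
  also have "(w' * sin r + cos r * weight d d\<^sub>0 r) * poly (pderiv P) (1 - cos r)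
      + poly (pderiv (pderiv P)) (1 - cos r) * sin r * (weight d d\<^sub>0 r * sin r) = weight d d\<^sub>0 r * (- lam * poly P (1 - cos r))"
    unfolding w(2) p unfolding c2 by (simp add: c algebra_simps power2_eq_square)
  finally show ?thesis by (simp add: mult_ac)
qed

lemma weight_pos: "0 < r \<Longrightarrow> r < pi \<Longrightarrow> 0 < weight d d\<^sub>0 r"
  unfolding weight_def by (intro mult_pos_pos zero_less_power sin_gt_zero cos_gt_zero) auto

lemma weight_nonneg: "0 \<le> r \<Longrightarrow> r \<le> pi \<Longrightarrow> 0 \<le> weight d d\<^sub>0 r"
  unfolding weight_def by (intro mult_nonneg_nonneg zero_le_power sin_ge_zero cos_ge_zero) auto

lemma continuous_on_weight [continuous_intros]: "continuous_on S (weight d d\<^sub>0)"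
  unfolding weight_def by (intro continuous_intros) auto

text \<open>With \<open>w\<close> the weight, the flux \<open>u\<close> satisfies
  \<open>(u' / w)' = - lam u / w\<close>, and \<open>v = u / sqrt w\<close> removes the first-order
  term. Since \<open>1/w\<close> stands where the equation of the polynomial has \<open>w\<close>,
  the singular coefficients are \<open>\<alpha> (\<alpha> + 2) / 16\<close> and
  \<open>\<beta> (\<beta> + 2) / 16\<close>, which are never negative. For the polynomial itself the
  first would be \<open>\<alpha> (\<alpha> - 2) / 16\<close>, negative at
  \<open>\<alpha> = 1\<close>.\<close>

lemma jacobi_liouville_form:
  assumes d: "1 \<le> d" "1 \<le> d\<^sub>0" and P: "jacobi_op d d\<^sub>0 P = smult (- lam) P"
  defines "\<alpha> \<equiv> real d - 1" and "\<beta> \<equiv> real d\<^sub>0 - 1"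
  defines "v \<equiv> \<lambda>r. sqrt (weight d d\<^sub>0 r) * (sin r * poly (pderiv P) (1 - cos r))"
  defines "z \<equiv> \<lambda>r. sqrt (weight d d\<^sub>0 r) * (- lam * poly P (1 - cos r)
     - (\<alpha>/2 - (\<alpha> + \<beta>)/4 * (1 - cos r)) * poly (pderiv P) (1 - cos r))"
  assumes r: "0 < r" "r < pi"
  shows "(v has_real_derivative z r) (at r)"
    and "(z has_real_derivative - (lam + (\<alpha> + \<beta>)\<^sup>2/16 - (\<alpha>\<^sup>2 + 2*\<alpha>)/16 / (sin (r/2))\<^sup>2
       - (\<beta>\<^sup>2 + 2*\<beta>)/16 / (cos (r/2))\<^sup>2) * v r) (at r)"
proof -
  obtain w' where w: "(weight d d\<^sub>0 has_real_derivative w') (at r)"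
    "w' * sin r = weight d d\<^sub>0 r * (\<alpha> * (cos (r/2))\<^sup>2 - \<beta> * (sin (r/2))\<^sup>2)"
    using weight_deriv[OF d] unfolding \<alpha>_def \<beta>_def by blast
  have wp: "0 < weight d d\<^sub>0 r" using weight_pos r by blast
  define m where "m = sqrt (weight d d\<^sub>0 r)"
  have mp: "0 < m" "m * m = weight d d\<^sub>0 r" using wp by (auto simp: m_def)
  define s c where "s = sin (r/2)" and "c = cos (r/2)"
  have sc: "s > 0" "c > 0" unfolding s_def c_def using r by (auto intro!: sin_gt_zero cos_gt_zero)
  have c2: "c * c = 1 - s * s" unfolding s_def c_def using cos_squared_eq[of "r/2"] by (simp add: power2_eq_square)
  have sn: "sin r = 2 * s * c" unfolding s_def c_def using sin_double[of "r/2"] by simp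
  have cs: "cos r = 1 - 2 * (s * s)" unfolding s_def using cos_double_sin[of "r/2"] by (simp add: power2_eq_square)
  have snp: "sin r > 0" using r by (intro sin_gt_zero) auto
  \<comment> \<open>\<open>\<kappa> / sin r\<close> is the logarithmic derivative of the square root
    of the weight.\<close>
  define \<kappa> where "\<kappa> = (\<alpha> * (c * c) - \<beta> * (s * s)) / 2"
  have kap: "\<alpha>/2 - (\<alpha> + \<beta>)/4 * (1 - cos r) = \<kappa>" unfolding \<kappa>_def cs c2 by (simp add: field_simps)
  define m' where "m' = inverse m / 2 * w'"
  have m's: "m' * sin r = m * \<kappa>"
  proof -
    have "m' * sin r = inverse m / 2 * (w' * sin r)" by (simp add: m'_def)
    also have "... = m * \<kappa>" unfolding w(2) mp(2)[symmetric] \<kappa>_def s_def c_def using mp(1) by (simp add: power2_eq_square)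
    finally show ?thesis .
  qed
  have dm: "((\<lambda>r. sqrt (weight d d\<^sub>0 r)) has_real_derivative m') (at r)"
    unfolding m'_def m_def by (rule DERIV_chain2[OF DERIV_real_sqrt[OF wp] w(1)])
  define p0 p1 p2 where "p0 = poly P (1 - cos r)" and "p1 = poly (pderiv P) (1 - cos r)" and "p2 = poly (pderiv (pderiv P)) (1 - cos r)"
  have dX: "((\<lambda>r. 1 - cos r) has_real_derivative sin r) (at r)" by (auto intro!: derivative_eq_intros)
  have dp: "((\<lambda>r. poly q (1 - cos r)) has_real_derivative poly (pderiv q) (1 - cos r) * sin r) (at r)" for q
    using DERIV_chain'[OF dX poly_DERIV[of q]] by (simp add: mult.commute)
  have ode: "sin r * (sin r * p2) = - lam * p0 - (real d - (real d + real d\<^sub>0) * (s * s)) * p1"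
    using poly_jacobi_op[of d d\<^sub>0 P r] unfolding P p0_def p1_def p2_def s_def by (simp add: power2_eq_square)
  have "(v has_real_derivative m' * (sin r * p1) + (cos r * p1 + p2 * sin r * sin r) * m) (at r)"
    unfolding v_def m_def p1_def p2_def by (intro DERIV_mult dm DERIV_sin dp)
  also have "m' * (sin r * p1) + (cos r * p1 + p2 * sin r * sin r) * m = (m' * sin r) * p1 + (cos r * p1 + sin r * (sin r * p2)) * m"
    by (simp add: algebra_simps)
  also have "... = z r"
    unfolding m's ode z_def kap unfolding m_def[symmetric] p0_def[symmetric] p1_def[symmetric] unfolding cs \<kappa>_def c2 \<alpha>_def \<beta>_def
    by (simp add: field_simps)
  finally show "(v has_real_derivative z r) (at r)" .
  have "(z has_real_derivative m' * (- lam * p0 - \<kappa> * p1) + (- lam * (p1 * sin r) - ((- ((\<alpha> + \<beta>)/4 * sin r)) * p1 + p2 * sin r * \<kappa>)) * m) (at r)"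
  proof -
    have "((\<lambda>r. \<alpha>/2 - (\<alpha> + \<beta>)/4 * (1 - cos r)) has_real_derivative - ((\<alpha> + \<beta>)/4 * sin r)) (at r)"
      using DERIV_diff[OF DERIV_const DERIV_cmult[OF dX, of "(\<alpha> + \<beta>)/4"], of "\<alpha>/2"] by (simp only: diff_0)
    from DERIV_mult[OF dm DERIV_diff[OF DERIV_cmult[OF dp] DERIV_mult[OF this dp]], of "- lam" P "pderiv P"]
    show ?thesis unfolding z_def kap unfolding m_def[symmetric] p0_def[symmetric] p1_def[symmetric] p2_def[symmetric] .
  qed
  moreover have "m' * (- lam * p0 - \<kappa> * p1) + (- lam * (p1 * sin r) - ((- ((\<alpha> + \<beta>)/4 * sin r)) * p1 + p2 * sin r * \<kappa>)) * m
     = - (lam + (\<alpha> + \<beta>)\<^sup>2/16 - (\<alpha>\<^sup>2 + 2*\<alpha>)/16 / (sin (r/2))\<^sup>2 - (\<beta>\<^sup>2 + 2*\<beta>)/16 / (cos (r/2))\<^sup>2) * v r" (is "?l = ?r")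
  proof -
    have "sin r * ?l = (m' * sin r) * (- lam * p0 - \<kappa> * p1) + (- lam * p1 * (sin r * sin r) + (\<alpha> + \<beta>)/4 * (sin r * sin r) * p1 - \<kappa> * (sin r * (sin r * p2))) * m"
      by (simp add: algebra_simps)
    also have "... = m * p1 * (- \<kappa> * \<kappa> - lam * (4 * (s * s) * (c * c)) + (\<alpha> + \<beta>) * ((s * s) * (c * c)) + \<kappa> * (real d - (real d + real d\<^sub>0) * (s * s)))"
      unfolding m's ode unfolding sn by (simp add: algebra_simps)
    also have "... = m * p1 * (- 4 * ((lam + (\<alpha> + \<beta>)\<^sup>2/16) * ((s * s) * (c * c)) - (\<alpha>\<^sup>2 + 2*\<alpha>)/16 * (c * c) - (\<beta>\<^sup>2 + 2*\<beta>)/16 * (s * s)))"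
    proof -
      have d: "real d = \<alpha> + 1" "real d\<^sub>0 = \<beta> + 1" by (simp_all add: \<alpha>_def \<beta>_def)
      show ?thesis unfolding \<kappa>_def d c2 power2_eq_square by (simp add: field_simps)
    qed
    also have "... = sin r * ?r"
    proof -
      have g: "sin r * (- q * (m * (sin r * p1))) = m * p1 * (- 4 * (q * ((s * s) * (c * c))))" for q
        unfolding sn by algebra
      note g[of "lam + (\<alpha> + \<beta>)\<^sup>2/16 - (\<alpha>\<^sup>2 + 2*\<alpha>)/16 / (s * s) - (\<beta>\<^sup>2 + 2*\<beta>)/16 / (c * c)"]
      also have "(lam + (\<alpha> + \<beta>)\<^sup>2/16 - (\<alpha>\<^sup>2 + 2*\<alpha>)/16 / (s * s) - (\<beta>\<^sup>2 + 2*\<beta>)/16 / (c * c)) * ((s * s) * (c * c))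
        = (lam + (\<alpha> + \<beta>)\<^sup>2/16) * ((s * s) * (c * c)) - (\<alpha>\<^sup>2 + 2*\<alpha>)/16 * (c * c) - (\<beta>\<^sup>2 + 2*\<beta>)/16 * (s * s)"
        using sc by (simp add: left_diff_distrib)
      finally have "sin r * (- (lam + (\<alpha> + \<beta>)\<^sup>2/16 - (\<alpha>\<^sup>2 + 2*\<alpha>)/16 / (s * s) - (\<beta>\<^sup>2 + 2*\<beta>)/16 / (c * c)) * (m * (sin r * p1))) =
        m * p1 * (- 4 * ((lam + (\<alpha> + \<beta>)\<^sup>2/16) * ((s * s) * (c * c)) - (\<alpha>\<^sup>2 + 2*\<alpha>)/16 * (c * c) - (\<beta>\<^sup>2 + 2*\<beta>)/16 * (s * s)))" .
      moreover have "v r = m * (sin r * p1)" "(sin (r/2))\<^sup>2 = s * s" "(cos (r/2))\<^sup>2 = c * c"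
        by (simp_all add: v_def m_def p1_def s_def c_def power2_eq_square)
      ultimately show ?thesis by (simp only:)
    qed
    finally show "?l = ?r" using snp by simp
  qed
  ultimately show "(z has_real_derivative - (lam + (\<alpha> + \<beta>)\<^sup>2/16 - (\<alpha>\<^sup>2 + 2*\<alpha>)/16 / (sin (r/2))\<^sup>2
       - (\<beta>\<^sup>2 + 2*\<beta>)/16 / (cos (r/2))\<^sup>2) * v r) (at r)" by simp
qed

text \<open>The power \<open>t ^ d\<close> is one factor \<open>t\<close> from the inverse length of
  the averaging interval and \<open>t ^ (d - 1)\<close> from the inverse of the weight there. One
  pair \<open>L\<close>, \<open>C\<close> serves all eigenvalues and all \<open>t\<close>, and no
  space occurs, so the constants can be fixed before the space is given.\<close>

definition flux_bound :: "nat \<Rightarrow> nat \<Rightarrow> real \<Rightarrow> real \<Rightarrow> bool" where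
  "flux_bound d d\<^sub>0 L C \<longleftrightarrow> (\<forall>lam P t r. jacobi_op d d\<^sub>0 P = smult (- lam) P \<longrightarrow> 1 \<le> lam \<longrightarrow> 0 < t \<longrightarrow>
     t \<le> sqrt lam \<longrightarrow> L / t \<le> pi/2 \<longrightarrow> 0 \<le> r \<longrightarrow> r \<le> pi \<longrightarrow>
     (jacobi_flux d d\<^sub>0 P r)\<^sup>2 \<le> C * weight d d\<^sub>0 r * t ^ d * integral {L/(2*t)..L/t} (\<lambda>x. (jacobi_flux d d\<^sub>0 P x)\<^sup>2))"

theorem jacobi_flux_bound:
  assumes d: "1 \<le> d" "1 \<le> d\<^sub>0"
  obtains L C where "L \<ge> 1" "C > 0" and
    "flux_bound d d\<^sub>0 L C"
proof -
  define \<alpha> where "\<alpha> = real d - 1"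
  define \<beta> where "\<beta> = real d\<^sub>0 - 1"
  have ab: "\<alpha> \<ge> 0" "\<beta> \<ge> 0" using d by (auto simp: \<alpha>_def \<beta>_def)
  define A where "A = (\<alpha>\<^sup>2 + 2*\<alpha>)/16"
  define B where "B = (\<beta>\<^sup>2 + 2*\<beta>)/16"
  define \<gamma> where "\<gamma> = (\<alpha> + \<beta>)\<^sup>2/16"
  have pos: "A \<ge> 0" "B \<ge> 0" "\<gamma> \<ge> 0" using ab by (auto simp: A_def B_def \<gamma>_def)
  have aux: "1 \<le> x \<Longrightarrow> 1 \<le> y \<Longrightarrow> 3/4 \<le> 4 * ((x + 2 * y)/16)" for x y :: real
  proof -
    assume "1 \<le> x" "1 \<le> y"
    hence "3 \<le> x + 2 * y" by simp
    hence "12 / 16 \<le> 4 * ((x + 2 * y)/16)" by (subst times_divide_eq_right) (rule divide_right_mono, auto)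
    thus ?thesis by simp
  qed
  \<comment> \<open>\<open>\<alpha>\<close> is an integer, so \<open>A\<close> is zero or at least
    3/16. This gap, and the same one for \<open>B\<close>, allow a single \<open>\<epsilon>\<close>
    with \<open>\<epsilon>^2 (1 + \<gamma>) = 3/4\<close>.\<close>
  have A0: "A = 0 \<or> 3/4 \<le> 4 * A"
  proof (cases "d = 1")
    case False
    hence a: "1 \<le> \<alpha>" using d by (auto simp: \<alpha>_def)
    hence "1 \<le> \<alpha>\<^sup>2" by (rule one_le_power)
    hence "3/4 \<le> 4 * A" using a unfolding A_def by (rule aux)
    thus ?thesis ..
  qed (simp add: A_def \<alpha>_def)
  have B0: "B = 0 \<or> 3/4 \<le> 4 * B"
  proof (cases "d\<^sub>0 = 1")
    case False
    hence a: "1 \<le> \<beta>" using d by (auto simp: \<beta>_def)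
    hence "1 \<le> \<beta>\<^sup>2" by (rule one_le_power)
    hence "3/4 \<le> 4 * B" using a unfolding B_def by (rule aux)
    thus ?thesis ..
  qed (simp add: B_def \<beta>_def)
  define \<epsilon> where "\<epsilon> = sqrt (3/4 / (1 + \<gamma>))"
  have e2: "\<epsilon>\<^sup>2 * (1 + \<gamma>) = 3/4"
  proof -
    have "\<epsilon>\<^sup>2 = 3/4 / (1 + \<gamma>)" unfolding \<epsilon>_def using pos by (intro real_sqrt_pow2) simp
    moreover have "1 + \<gamma> \<noteq> 0" using pos by simp
    ultimately show ?thesis by (metis nonzero_eq_divide_eq)
  qed
  have e: "0 < \<epsilon>" "\<epsilon> \<le> 1" using pos by (auto simp: \<epsilon>_def)
  have e': "A = 0 \<or> \<epsilon>\<^sup>2 * (1 + \<gamma>) \<le> 4 * A" "B = 0 \<or> \<epsilon>\<^sup>2 * (1 + \<gamma>) \<le> 4 * B" unfolding e2 using A0 B0 by auto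
  define K where "K = exp (2 * (\<gamma> * pi + 4 * A / \<epsilon> + 4 * B / \<epsilon>))"
  define L where "L = 4 * K\<^sup>2"
  have K1: "1 \<le> K" unfolding K_def using pos e by simp
  hence "1 \<le> K\<^sup>2" by (rule one_le_power)
  hence L1: "1 \<le> L" by (simp add: L_def)
  \<comment> \<open>On the averaging interval \<open>sin (x/2) \<ge> L/8t\<close> and
    \<open>cos (x/2) \<ge> 1/2\<close>, so the weight is at least \<open>c / t ^ (d - 1)\<close>.
    This converts \<open>v^2\<close> back into the squared flux.\<close>
  define c where "c = (L / 8) ^ (d - 1) * (1/2) ^ (d\<^sub>0 - 1)"
  have c: "c > 0" unfolding c_def using L1 by simp
  define C where "C = 4 * K\<^sup>2 * (2 + \<gamma>) / L / c"
  have C: "C > 0" unfolding C_def using K1 pos L1 c by (auto intro!: divide_pos_pos mult_pos_pos)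
  show ?thesis
  proof (rule that[OF L1 C], unfold flux_bound_def, intro allI impI)
    fix lam P t r
    assume P: "jacobi_op d d\<^sub>0 P = smult (- lam) P" and lam: "1 \<le> lam" and t: "0 < t" "t \<le> sqrt lam" "L / t \<le> pi/2"
       and r: "0 \<le> r" "r \<le> pi"
    define v where "v = (\<lambda>r. sqrt (weight d d\<^sub>0 r) * (sin r * poly (pderiv P) (1 - cos r)))"
    define z where "z = (\<lambda>r. sqrt (weight d d\<^sub>0 r) * (- lam * poly P (1 - cos r)
       - (\<alpha>/2 - (\<alpha> + \<beta>)/4 * (1 - cos r)) * poly (pderiv P) (1 - cos r)))"
    let ?u = "jacobi_flux d d\<^sub>0 P"
    have u: "(?u r)\<^sup>2 = weight d d\<^sub>0 r * (v r)\<^sup>2" if "0 \<le> r" "r \<le> pi" for r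
      using weight_nonneg[OF that, of d d\<^sub>0] by (simp add: jacobi_flux_def v_def power_mult_distrib power2_eq_square)
    have cv: "continuous_on S v" for S unfolding v_def by (intro continuous_intros)
    have cu: "continuous_on S ?u" for S unfolding jacobi_flux_def[abs_def] by (intro continuous_intros)
    have I0: "0 \<le> integral {L/(2*t)..L/t} (\<lambda>x. (?u x)\<^sup>2)" by (rule integral_nonneg) (auto intro!: integrable_continuous_interval continuous_intros cu)
    show "(?u r)\<^sup>2 \<le> C * weight d d\<^sub>0 r * t ^ d * integral {L/(2*t)..L/t} (\<lambda>x. (?u x)\<^sup>2)"
    proof (cases "0 < r \<and> r < pi")
      case False
      hence "r = 0 \<or> r = pi" using r by auto
      hence "?u r = 0" by (auto simp: jacobi_flux_def)
      thus ?thesis using I0 C weight_nonneg[OF r, of d d\<^sub>0] t by simp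
    next
      case True
      have "(v r)\<^sup>2 \<le> 4 * K\<^sup>2 * (2 + \<gamma>) * (t / L) * integral {L/(2*t)..L/t} (\<lambda>x. (v x)\<^sup>2)"
        unfolding K_def
      proof (rule sturm_energy[where z = z, OF pos lam _ _ _ _ _ e e'])
        fix r :: real assume "0 < r" "r < pi"
        from jacobi_liouville_form[OF d P this]
        show "(v has_real_derivative z r) (at r)"
          "(z has_real_derivative - (lam + \<gamma> - A / (sin (r/2))\<^sup>2 - B / (cos (r/2))\<^sup>2) * v r) (at r)"
          unfolding v_def z_def \<alpha>_def \<beta>_def A_def B_def \<gamma>_def by blast+
      qed (use True t cv L_def K_def in \<open>auto simp: v_def\<close>)
      also have "... \<le> 4 * K\<^sup>2 * (2 + \<gamma>) * (t / L) * (t ^ (d - 1) / c * integral {L/(2*t)..L/t} (\<lambda>x. (?u x)\<^sup>2))"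
      proof (rule mult_left_mono)
        have "integral {L/(2*t)..L/t} (\<lambda>x. (v x)\<^sup>2) \<le> integral {L/(2*t)..L/t} (\<lambda>x. t ^ (d - 1) / c * (?u x)\<^sup>2)"
        proof (rule integral_le)
          fix x assume x: "x \<in> {L/(2*t)..L/t}"
          have "0 < L / (2*t)" using L1 t by simp
          hence x0: "0 < x" using x by (auto intro: less_le_trans)
          have "x \<le> L/t" using x by simp
          hence xp: "x \<le> pi/2" using t(3) by (rule order_trans)
          moreover have "pi/2 < pi" by simp
          ultimately have "x < pi" by (rule le_less_trans)
          note x' = x0 xp this
          have "cos (pi/3) \<le> cos (x/2)" using x' by (intro cos_monotone_0_pi_le) auto
          hence c1: "1/2 \<le> cos (x/2)" by (simp add: cos_60)
          have "L / (8*t) \<le> x/2 * (1/2)" using x t by (simp add: field_simps)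
          also have "... \<le> x/2 * cos (x/2)" using c1 x' by (intro mult_left_mono) auto
          also have "... \<le> sin (x/2)" using x' by (intro x_cos_x_le_sin_x) auto
          finally have s1: "L / (8*t) \<le> sin (x/2)" .
          have "(L / (8*t)) ^ (d - 1) * (1/2) ^ (d\<^sub>0 - 1) \<le> weight d d\<^sub>0 x"
            unfolding weight_def using s1 c1 L1 t sin_ge_zero[of "x/2"] x' by (intro mult_mono power_mono) auto
          hence "c / t ^ (d - 1) \<le> weight d d\<^sub>0 x" unfolding c_def by (simp add: power_divide power_mult_distrib mult_ac)
          hence "c / t ^ (d - 1) * (v x)\<^sup>2 \<le> (?u x)\<^sup>2" using u[of x] x' mult_right_mono[of "c / t ^ (d - 1)" "weight d d\<^sub>0 x" "(v x)\<^sup>2"] by simp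
          thus "(v x)\<^sup>2 \<le> t ^ (d - 1) / c * (?u x)\<^sup>2" using c t by (simp add: field_simps)
        qed (intro integrable_continuous_interval continuous_intros cv cu)+
        thus "integral {L/(2*t)..L/t} (\<lambda>x. (v x)\<^sup>2) \<le> t ^ (d - 1) / c * integral {L/(2*t)..L/t} (\<lambda>x. (?u x)\<^sup>2)" by simp
      qed (use pos t L1 in auto)
      also have "... = C * t ^ d * integral {L/(2*t)..L/t} (\<lambda>x. (?u x)\<^sup>2)"
        unfolding C_def using d(1) power_eq_if[of t d] by simp
      finally have "weight d d\<^sub>0 r * (v r)\<^sup>2 \<le> weight d d\<^sub>0 r * (C * t ^ d * integral {L/(2*t)..L/t} (\<lambda>x. (?u x)\<^sup>2))"
        using weight_nonneg[OF r] by (intro mult_left_mono)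
      thus ?thesis using u[OF r] by (simp add: mult_ac)
    qed
  qed
qed

section \<open>Zonal expansions and designs\<close>

text \<open>Unlike integrability this property is closed under products, so on a probability space
  the integrability of products of zonal functions follows by structural rules.\<close>

definition bounded_measurable :: "'a measure \<Rightarrow> ('a \<Rightarrow> real) \<Rightarrow> bool" where
  "bounded_measurable M f \<longleftrightarrow> f \<in> borel_measurable M \<and> (\<exists>B. \<forall>x\<in>space M. \<bar>f x\<bar> \<le> B)"

named_theorems bm_intros

lemma bounded_measurable_const [bm_intros]: "bounded_measurable M (\<lambda>_. c)"
  unfolding bounded_measurable_def by auto

lemma bounded_measurable_add [bm_intros]:
  assumes "bounded_measurable M f" "bounded_measurable M g"
  shows "bounded_measurable M (\<lambda>x. f x + g x)"
proof -
  obtain B C where "\<forall>x\<in>space M. \<bar>f x\<bar> \<le> B" "\<forall>x\<in>space M. \<bar>g x\<bar> \<le> C"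
    using assms unfolding bounded_measurable_def by auto
  hence "\<forall>x\<in>space M. \<bar>f x + g x\<bar> \<le> B + C" by (meson abs_triangle_ineq add_mono order_trans)
  thus ?thesis using assms unfolding bounded_measurable_def by auto
qed

lemma bounded_measurable_mult [bm_intros]:
  assumes "bounded_measurable M f" "bounded_measurable M g"
  shows "bounded_measurable M (\<lambda>x. f x * g x)"
proof -
  obtain B C where "\<forall>x\<in>space M. \<bar>f x\<bar> \<le> B" "\<forall>x\<in>space M. \<bar>g x\<bar> \<le> C"
    using assms unfolding bounded_measurable_def by auto
  hence "\<bar>f x * g x\<bar> \<le> B * C" if "x \<in> space M" for x
    unfolding abs_mult using that by (intro mult_mono) (auto intro: order_trans[OF abs_ge_zero])
  thus ?thesis using assms unfolding bounded_measurable_def by auto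
qed

lemma bounded_measurable_diff [bm_intros]:
  assumes "bounded_measurable M f" "bounded_measurable M g"
  shows "bounded_measurable M (\<lambda>x. f x - g x)"
  using bounded_measurable_add[OF assms(1) bounded_measurable_mult[OF bounded_measurable_const[of M "-1"] assms(2)]] by simp

lemma bounded_measurable_power [bm_intros]:
  "bounded_measurable M f \<Longrightarrow> bounded_measurable M (\<lambda>x. f x ^ n)"
  by (induction n) (auto intro: bm_intros)

lemma bounded_measurable_sum [bm_intros]:
  "(\<And>i. i \<in> I \<Longrightarrow> bounded_measurable M (f i)) \<Longrightarrow> bounded_measurable M (\<lambda>x. \<Sum>i\<in>I. f i x)"
  by (induction I rule: infinite_finite_induct) (auto intro: bm_intros)

lemma bounded_measurable_indicator [bm_intros]:
  "A \<in> sets M \<Longrightarrow> bounded_measurable M (indicator A)"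
  unfolding bounded_measurable_def by (auto intro!: exI[of _ 1] simp: indicator_def)

lemma (in prob_space) bounded_measurable_integrable:
  "bounded_measurable M f \<Longrightarrow> integrable M f"
  unfolding bounded_measurable_def by (auto intro!: integrable_const_bound AE_I2)

lemma poly_bounded_on_interval:
  fixes q :: "real poly"
  obtains B where "\<And>x. 0 \<le> x \<Longrightarrow> x \<le> 2 \<Longrightarrow> \<bar>poly q x\<bar> \<le> B"
proof -
  have "compact (poly q ` {0..2})" by (intro compact_continuous_image continuous_intros) auto
  hence "bounded (poly q ` {0..2})" by (rule compact_imp_bounded)
  then obtain B where "\<forall>y\<in>poly q ` {0..2}. norm y \<le> B" unfolding bounded_iff by blast
  thus ?thesis by (intro that[of B]) auto
qed

lemma bounded_measurable_poly [bm_intros]: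
  assumes "Y \<in> borel_measurable M" "\<And>x. x \<in> space M \<Longrightarrow> 0 \<le> Y x" "\<And>x. x \<in> space M \<Longrightarrow> Y x \<le> 2"
  shows "bounded_measurable M (\<lambda>x. poly q (Y x))"
proof -
  obtain B where "\<And>x. 0 \<le> x \<Longrightarrow> x \<le> 2 \<Longrightarrow> \<bar>poly q x\<bar> \<le> B" using poly_bounded_on_interval[of q] by blast
  moreover have "(\<lambda>x. poly q (Y x)) \<in> borel_measurable M"
    using assms(1) by (intro borel_measurable_continuous_on[OF _ assms(1)] continuous_intros)
  ultimately show ?thesis using assms unfolding bounded_measurable_def by auto
qed

lemma weierstrass_poly:
  fixes f :: "real \<Rightarrow> real"
  assumes "continuous_on {0..2} f" "0 < e"
  obtains q where "\<And>x. 0 \<le> x \<Longrightarrow> x \<le> 2 \<Longrightarrow> \<bar>f x - poly q x\<bar> < e"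
proof -
  obtain g where g: "real_polynomial_function g" "\<And>x. x \<in> {0..2} \<Longrightarrow> \<bar>f x - g x\<bar> < e"
    using Stone_Weierstrass_real_polynomial_function[of "{0..2}" f e] assms by auto
  then obtain a n where "g = (\<lambda>x. \<Sum>i\<le>n. a i * x ^ i)" using real_polynomial_function_iff_sum by blast
  hence "g x = poly (\<Sum>i\<le>n. monom (a i) i) x" for x by (simp add: poly_sum poly_monom)
  thus ?thesis using that[of "\<Sum>i\<le>n. monom (a i) i"] g(2) by auto
qed

lemma (in prob_space) integral_approx:
  assumes "bounded_measurable M f" "bounded_measurable M g" "\<And>x. x \<in> space M \<Longrightarrow> \<bar>f x - g x\<bar> \<le> e"
  shows "\<bar>(\<integral>x. f x \<partial>M) - (\<integral>x. g x \<partial>M)\<bar> \<le> e"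
proof -
  have i: "integrable M f" "integrable M g" using assms bounded_measurable_integrable by auto
  hence "(\<integral>x. f x \<partial>M) - (\<integral>x. g x \<partial>M) = (\<integral>x. f x - g x \<partial>M)" by simp
  also have "\<bar>...\<bar> \<le> (\<integral>x. \<bar>f x - g x\<bar> \<partial>M)" by (rule integral_abs_bound)
  also have "... \<le> (\<integral>x. e \<partial>M)" using i assms(3) by (intro integral_mono) auto
  finally show ?thesis by (simp add: prob_space)
qed

lemma bounded_measurable_continuous_bounded:
  assumes "continuous_on UNIV f" "\<And>x. \<bar>f x\<bar> \<le> B" "Y \<in> borel_measurable M"
  shows "bounded_measurable M (\<lambda>x. f (Y x :: real) :: real)"
  unfolding bounded_measurable_def using assms by (auto intro: borel_measurable_continuous_on)

text \<open>Weierstrass approximation on \<open>[0, 2]\<close> carries equality of integrals from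
  polynomials to bounded continuous functions. Cosine and sine then give equal characteristic
  functions, and Levy's uniqueness theorem concludes.\<close>

lemma distr_eq_if_moments_eq:
  fixes Y Z
  assumes M: "prob_space M" and N: "prob_space N" and Y: "Y \<in> borel_measurable M" and Z: "Z \<in> borel_measurable N"
    and Yr: "\<And>x. x \<in> space M \<Longrightarrow> 0 \<le> Y x \<and> Y x \<le> (2::real)"
    and Zr: "\<And>x. x \<in> space N \<Longrightarrow> 0 \<le> Z x \<and> Z x \<le> (2::real)"
    and eq: "\<And>q. (\<integral>x. poly q (Y x) \<partial>M) = (\<integral>x. poly q (Z x) \<partial>N)"
  shows "distr M borel Y = distr N borel Z"
proof -
  interpret M: prob_space M by fact
  interpret N: prob_space N by fact
  have cont: "(\<integral>x. f (Y x) \<partial>M) = (\<integral>x. f (Z x) \<partial>N)" if f: "continuous_on UNIV f" "\<And>x. \<bar>f x\<bar> \<le> 1" for f :: "real \<Rightarrow> real"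
  proof (rule ccontr)
    assume ne: "(\<integral>x. f (Y x) \<partial>M) \<noteq> (\<integral>x. f (Z x) \<partial>N)"
    define e where "e = \<bar>(\<integral>x. f (Y x) \<partial>M) - (\<integral>x. f (Z x) \<partial>N)\<bar> / 3"
    have e: "e > 0" "3 * e = \<bar>(\<integral>x. f (Y x) \<partial>M) - (\<integral>x. f (Z x) \<partial>N)\<bar>" using ne by (simp_all add: e_def)
    obtain q where q: "\<And>x. 0 \<le> x \<Longrightarrow> x \<le> 2 \<Longrightarrow> \<bar>f x - poly q x\<bar> < e"
      using weierstrass_poly[OF continuous_on_subset[OF f(1)] e(1)] by blast
    have "\<bar>(\<integral>x. f (Y x) \<partial>M) - (\<integral>x. poly q (Y x) \<partial>M)\<bar> \<le> e"
      using Yr q by (intro M.integral_approx bounded_measurable_continuous_bounded[OF f Y] bounded_measurable_poly[OF Y]) (auto intro: less_imp_le)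
    moreover have "\<bar>(\<integral>x. f (Z x) \<partial>N) - (\<integral>x. poly q (Z x) \<partial>N)\<bar> \<le> e"
      using Zr q by (intro N.integral_approx bounded_measurable_continuous_bounded[OF f Z] bounded_measurable_poly[OF Z]) (auto intro: less_imp_le)
    ultimately show False using eq[of q] e by linarith
  qed
  have rd: "real_distribution (distr M borel Y)" "real_distribution (distr N borel Z)"
    using Y Z by (auto intro: M.real_distribution_distr N.real_distribution_distr)
  show ?thesis
  proof (rule Levy_uniqueness[OF rd], rule ext)
    fix t
    have iM: "integrable M (\<lambda>x. iexp (t * Y x))" using Y by (intro M.integrable_const_bound[of _ 1]) auto
    have iN: "integrable N (\<lambda>x. iexp (t * Z x))" using Z by (intro N.integrable_const_bound[of _ 1]) auto
    have "(CLINT x|M. iexp (t * Y x)) = (CLINT x|N. iexp (t * Z x))"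
    proof (rule complex_eqI)
      show "Re (CLINT x|M. iexp (t * Y x)) = Re (CLINT x|N. iexp (t * Z x))"
        using cont[of "\<lambda>x. cos (t * x)"] iM iN by (simp add: continuous_intros Re_exp flip: integral_Re)
      show "Im (CLINT x|M. iexp (t * Y x)) = Im (CLINT x|N. iexp (t * Z x))"
        using cont[of "\<lambda>x. sin (t * x)"] iM iN by (simp add: continuous_intros Im_exp flip: integral_Im)
    qed
    thus "char (distr M borel Y) t = char (distr N borel Z) t"
      using Y Z by (simp add: char_def integral_distr)
  qed
qed

section \<open>The law of the distance to a point\<close>

definition weight_mass :: "nat \<Rightarrow> nat \<Rightarrow> real" where
  "weight_mass d d\<^sub>0 = integral {0..pi} (weight d d\<^sub>0)"

definition radial_measure :: "nat \<Rightarrow> nat \<Rightarrow> real measure" where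
  "radial_measure d d\<^sub>0 = density lborel (\<lambda>r. ennreal (indicator {0..pi} r * weight d d\<^sub>0 r / weight_mass d d\<^sub>0))"

lemma weight_mass_pos: "weight_mass d d\<^sub>0 > 0"
proof -
  have "0 \<le> weight_mass d d\<^sub>0" unfolding weight_mass_def
    by (intro integral_nonneg integrable_continuous_interval continuous_intros) (auto intro: weight_nonneg)
  moreover have "weight_mass d d\<^sub>0 \<noteq> 0"
  proof
    assume "weight_mass d d\<^sub>0 = 0"
    hence "(weight d d\<^sub>0 has_integral 0) (cbox 0 pi)" unfolding weight_mass_def
      using integrable_integral[OF integrable_continuous_interval[OF continuous_on_weight[of "{0..pi}" d d\<^sub>0]]] by simp
    moreover have "box 0 pi \<noteq> ({} :: real set)" using pi_gt_zero by (auto simp: box_ne_empty simp del: box_real)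
    ultimately have "weight d d\<^sub>0 (pi/2) = 0"
      by (intro has_integral_0_cbox_imp_0[OF continuous_on_weight, of 0 pi]) (auto intro: weight_nonneg)
    thus False using weight_pos[of "pi/2" d d\<^sub>0] pi_gt_zero pi_half_gt_zero by linarith
  qed
  ultimately show ?thesis by simp
qed

lemma radial_measure_integral:
  assumes f: "continuous_on UNIV f" and b: "0 \<le> b" "b \<le> pi"
  shows "(\<integral>s. indicator {..<b} s * f s \<partial>radial_measure d d\<^sub>0) = integral {0..b} (\<lambda>s. weight d d\<^sub>0 s * f s) / weight_mass d d\<^sub>0"
    and "(\<integral>s. f s \<partial>radial_measure d d\<^sub>0) = integral {0..pi} (\<lambda>s. weight d d\<^sub>0 s * f s) / weight_mass d d\<^sub>0"
proof -
  have m: "weight d d\<^sub>0 \<in> borel_measurable borel" "f \<in> borel_measurable borel"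
    using f continuous_on_weight by (auto intro: borel_measurable_continuous_onI)
  have pos: "0 \<le> indicator {0..pi} r * weight d d\<^sub>0 r / weight_mass d d\<^sub>0" for r
    using weight_nonneg[of r d d\<^sub>0] weight_mass_pos[of d d\<^sub>0] by (auto simp: indicator_def)
  have set: "(LINT s|lborel. indicator {0..b} s * (weight d d\<^sub>0 s * f s)) = integral {0..b} (\<lambda>s. weight d d\<^sub>0 s * f s)" for b
    using set_borel_integral_eq_integral(2)[OF borel_integrable_atLeastAtMost'[of 0 b "\<lambda>s. weight d d\<^sub>0 s * f s"]]
      continuous_on_subset[OF f] by (simp add: set_lebesgue_integral_def continuous_intros)
  have "(\<integral>s. indicator {..<b} s * f s \<partial>radial_measure d d\<^sub>0) = (LINT s|lborel. (indicator {0..pi} s * weight d d\<^sub>0 s / weight_mass d d\<^sub>0) * (indicator {..<b} s * f s))"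
    unfolding radial_measure_def using m pos by (subst integral_density) auto
  also have "... = (LINT s|lborel. (indicator {0..b} s * (weight d d\<^sub>0 s * f s)) / weight_mass d d\<^sub>0)"
  proof (rule integral_cong_AE)
    show "AE s in lborel. (indicator {0..pi} s * weight d d\<^sub>0 s / weight_mass d d\<^sub>0) * (indicator {..<b} s * f s) = (indicator {0..b} s * (weight d d\<^sub>0 s * f s)) / weight_mass d d\<^sub>0"
      using AE_lborel_singleton[of b] by eventually_elim (use b in \<open>auto simp: indicator_def\<close>)
  qed (use m in measurable)
  finally show "(\<integral>s. indicator {..<b} s * f s \<partial>radial_measure d d\<^sub>0) = integral {0..b} (\<lambda>s. weight d d\<^sub>0 s * f s) / weight_mass d d\<^sub>0"
    using set[of b] by simp
  have "(\<integral>s. f s \<partial>radial_measure d d\<^sub>0) = (LINT s|lborel. (indicator {0..pi} s * weight d d\<^sub>0 s / weight_mass d d\<^sub>0) * f s)"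
    unfolding radial_measure_def using m pos by (subst integral_density) auto
  also have "... = (LINT s|lborel. (indicator {0..pi} s * (weight d d\<^sub>0 s * f s)) / weight_mass d d\<^sub>0)"
    by (intro Bochner_Integration.integral_cong) auto
  finally show "(\<integral>s. f s \<partial>radial_measure d d\<^sub>0) = integral {0..pi} (\<lambda>s. weight d d\<^sub>0 s * f s) / weight_mass d d\<^sub>0"
    using set[of pi] by simp
qed

lemma prob_space_radial_measure: "prob_space (radial_measure d d\<^sub>0)"
proof
  have i: "integrable lborel (\<lambda>r. indicator {0..pi} r * weight d d\<^sub>0 r / weight_mass d d\<^sub>0)"
    using borel_integrable_atLeastAtMost'[OF continuous_on_weight[of "{0..pi}" d d\<^sub>0]] by (simp add: set_integrable_def)
  have pos: "0 \<le> indicator {0..pi} r * weight d d\<^sub>0 r / weight_mass d d\<^sub>0" for r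
    using weight_nonneg[of r d d\<^sub>0] weight_mass_pos[of d d\<^sub>0] by (auto simp: indicator_def)
  have "emeasure (radial_measure d d\<^sub>0) (space (radial_measure d d\<^sub>0)) = (\<integral>\<^sup>+ r. ennreal (indicator {0..pi} r * weight d d\<^sub>0 r / weight_mass d d\<^sub>0) \<partial>lborel)"
    unfolding radial_measure_def using borel_measurable_integrable[OF i] by (subst emeasure_density) (auto simp: indicator_def)
  also have "... = ennreal (LINT r|lborel. indicator {0..pi} r * weight d d\<^sub>0 r / weight_mass d d\<^sub>0)"
    using pos by (intro nn_integral_eq_integral[OF i]) auto
  also have "(LINT r|lborel. indicator {0..pi} r * weight d d\<^sub>0 r / weight_mass d d\<^sub>0) = 1"
    using set_borel_integral_eq_integral(2)[OF borel_integrable_atLeastAtMost'[OF continuous_on_weight[of "{0..pi}" d d\<^sub>0]]]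
      weight_mass_pos[of d d\<^sub>0] by (simp add: set_lebesgue_integral_def weight_mass_def)
  finally show "emeasure (radial_measure d d\<^sub>0) (space (radial_measure d d\<^sub>0)) = 1" by simp
qed

lemma AE_radial_measure: "AE s in radial_measure d d\<^sub>0. 0 \<le> s \<and> s \<le> pi"
proof -
  have "weight d d\<^sub>0 \<in> borel_measurable borel" using continuous_on_weight by (rule borel_measurable_continuous_onI)
  thus ?thesis unfolding radial_measure_def by (subst AE_density) (auto simp: indicator_def split: if_splits)
qed

text \<open>Fundamental theorem of calculus for the flux, which vanishes at 0.\<close>

lemma jacobi_poly_weight_integral:
  assumes "1 \<le> d" "1 \<le> d\<^sub>0" "1 \<le> l" "0 \<le> r"
  shows "integral {0..r} (\<lambda>s. weight d d\<^sub>0 s * poly (jacobi_poly d d\<^sub>0 l) (1 - cos s))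
     = - jacobi_flux d d\<^sub>0 (jacobi_poly d d\<^sub>0 l) r / jacobi_eigenvalue d d\<^sub>0 l"
proof -
  let ?lam = "jacobi_eigenvalue d d\<^sub>0 l" and ?P = "jacobi_poly d d\<^sub>0 l"
  have lam: "?lam > 0" using jacobi_eigenvalue_strict_mono[OF assms(1,2), of 0 l] assms by (simp add: jacobi_eigenvalue_def)
  have "((\<lambda>s. - ?lam * (weight d d\<^sub>0 s * poly ?P (1 - cos s))) has_integral (jacobi_flux d d\<^sub>0 ?P r - jacobi_flux d d\<^sub>0 ?P 0)) {0..r}"
    using assms jacobi_flux_deriv[OF assms(1,2) jacobi_op_jacobi_poly[OF assms(1)]]
    by (intro fundamental_theorem_of_calculus) (auto simp flip: has_real_derivative_iff_has_vector_derivative intro: has_field_derivative_at_within)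
  from integral_unique[OF this] have "- ?lam * integral {0..r} (\<lambda>s. weight d d\<^sub>0 s * poly ?P (1 - cos s)) = jacobi_flux d d\<^sub>0 ?P r"
    by (simp add: jacobi_flux_def)
  thus ?thesis using lam by (simp add: field_simps)
qed

section \<open>Zonal functions and their Jacobi expansion\<close>

text \<open>This is all that the analysis takes from the geometry. Symmetry of the Jacobi operator
  is demanded for two different centres; it yields the orthogonality of zonal polynomials about
  different points and also the law of the distance, so that no volume density is computed on
  \<open>Q\<close>.\<close>

locale zonal_space = prob_space \<mu> for \<mu> :: "'a measure" +
  fixes X :: "'a \<Rightarrow> 'a \<Rightarrow> real" and d d\<^sub>0 :: nat
  assumes d_pos: "1 \<le> d" and d0_pos: "1 \<le> d\<^sub>0"
    and X_measurable: "x \<in> space \<mu> \<Longrightarrow> X x \<in> borel_measurable \<mu>"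
    and X_nonneg: "x \<in> space \<mu> \<Longrightarrow> y \<in> space \<mu> \<Longrightarrow> 0 \<le> X x y"
    and X_le_2: "x \<in> space \<mu> \<Longrightarrow> y \<in> space \<mu> \<Longrightarrow> X x y \<le> 2"
    and X_sym: "x \<in> space \<mu> \<Longrightarrow> y \<in> space \<mu> \<Longrightarrow> X x y = X y x"
    and X_refl: "x \<in> space \<mu> \<Longrightarrow> X x x = 0"
    and jacobi_op_symmetric: "x \<in> space \<mu> \<Longrightarrow> z \<in> space \<mu> \<Longrightarrow>
      (\<integral>y. poly (jacobi_op d d\<^sub>0 f) (X x y) * poly g (X z y) \<partial>\<mu>) = (\<integral>y. poly f (X x y) * poly (jacobi_op d d\<^sub>0 g) (X z y) \<partial>\<mu>)"
begin

abbreviation "P \<equiv> jacobi_poly d d\<^sub>0"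
abbreviation "\<Lambda> \<equiv> jacobi_eigenvalue d d\<^sub>0"

definition \<tau> :: "real measure" where
  "\<tau> = distr (radial_measure d d\<^sub>0) borel (\<lambda>s. 1 - cos s)"

sublocale radial: prob_space "radial_measure d d\<^sub>0" by (rule prob_space_radial_measure)

lemma cos_measurable_radial [measurable]: "(\<lambda>s. 1 - cos s) \<in> borel_measurable (radial_measure d d\<^sub>0)"
  by (simp add: radial_measure_def)

sublocale tau: prob_space \<tau> unfolding \<tau>_def by (rule radial.prob_space_distr) simp

lemma sets_tau [simp, measurable_cong]: "sets \<tau> = sets borel" by (simp add: \<tau>_def)
lemma space_tau [simp]: "space \<tau> = UNIV" by (simp add: \<tau>_def)

lemma bounded_measurable_X [bm_intros]: "x \<in> space \<mu> \<Longrightarrow> bounded_measurable \<mu> (\<lambda>y. poly q (X x y))"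
  by (intro bounded_measurable_poly X_measurable X_nonneg X_le_2)

lemma poly_X_integrable: "x \<in> space \<mu> \<Longrightarrow> integrable \<mu> (\<lambda>y. poly q (X x y))"
  by (intro bounded_measurable_integrable bm_intros)

text \<open>Eigenvectors of a symmetric operator for different eigenvalues, with one factor centred
  at \<open>x\<close> and the other at \<open>z\<close>.\<close>

lemma jacobi_orthogonal:
  assumes "x \<in> space \<mu>" "z \<in> space \<mu>" "l \<noteq> k"
  shows "(\<integral>y. poly (P l) (X x y) * poly (P k) (X z y) \<partial>\<mu>) = 0"
proof -
  have "\<Lambda> l \<noteq> \<Lambda> k" using jacobi_eigenvalue_strict_mono[OF d_pos d0_pos, of l k]
      jacobi_eigenvalue_strict_mono[OF d_pos d0_pos, of k l] assms(3) by (cases l k rule: linorder_cases) auto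
  moreover have "- \<Lambda> l * (\<integral>y. poly (P l) (X x y) * poly (P k) (X z y) \<partial>\<mu>) = - \<Lambda> k * (\<integral>y. poly (P l) (X x y) * poly (P k) (X z y) \<partial>\<mu>)"
    using jacobi_op_symmetric[OF assms(1,2), of "P l" "P k"]
    by (simp add: jacobi_op_jacobi_poly[OF d_pos] mult.assoc mult.left_commute[of _ "\<Lambda> k"])
  ultimately show ?thesis by simp
qed

lemma jacobi_integral_zero:
  assumes "x \<in> space \<mu>" "1 \<le> l"
  shows "(\<integral>y. poly (P l) (X x y) \<partial>\<mu>) = 0"
  using jacobi_orthogonal[OF assms(1,1), of l 0] assms(2) by (simp add: jacobi_poly_0)

lemma radial_jacobi_integral_zero:
  assumes "1 \<le> l" shows "(\<integral>s. poly (P l) (1 - cos s) \<partial>radial_measure d d\<^sub>0) = 0"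
  using radial_measure_integral(2)[of "\<lambda>s. poly (P l) (1 - cos s)" 0 d d\<^sub>0]
    jacobi_poly_weight_integral[OF d_pos d0_pos assms, of pi] by (simp add: continuous_intros jacobi_flux_def)

lemma bounded_measurable_radial [bm_intros]: "bounded_measurable (radial_measure d d\<^sub>0) (\<lambda>s. poly q (1 - cos s))"
proof (rule bounded_measurable_poly)
  fix s :: real
  show "0 \<le> 1 - cos s" "1 - cos s \<le> 2" using cos_ge_minus_one[of s] cos_le_one[of s] by linarith+
qed simp

text \<open>Both integrals annihilate every Jacobi polynomial of positive degree and agree on
  constants, and these polynomials span. On the space the annihilation is orthogonality to
  \<open>P 0\<close>; for the radial measure it is the vanishing of the flux at 0 and
  \<open>pi\<close>.\<close>

lemma moments_eq:
  assumes x: "x \<in> space \<mu>"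
  shows "(\<integral>y. poly q (X x y) \<partial>\<mu>) = (\<integral>s. poly q (1 - cos s) \<partial>radial_measure d d\<^sub>0)"
proof -
  obtain c where c: "q = (\<Sum>l\<le>degree q. smult (c l) (P l))"
    using poly_eq_sum_jacobi_poly[OF d_pos d0_pos order_refl] by blast
  have "(\<integral>y. poly q (X x y) \<partial>\<mu>) = (\<Sum>l\<le>degree q. c l * (\<integral>y. poly (P l) (X x y) \<partial>\<mu>))"
    using x by (subst c) (simp add: poly_sum poly_X_integrable)
  also have "... = (\<Sum>l\<le>degree q. c l * (\<integral>s. poly (P l) (1 - cos s) \<partial>radial_measure d d\<^sub>0))"
  proof (intro sum.cong refl)
    fix l show "c l * (\<integral>y. poly (P l) (X x y) \<partial>\<mu>) = c l * (\<integral>s. poly (P l) (1 - cos s) \<partial>radial_measure d d\<^sub>0)"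
      using jacobi_integral_zero[OF x, of l] radial_jacobi_integral_zero[of l]
      by (cases "l = 0") (simp_all add: jacobi_poly_0 prob_space radial.prob_space)
  qed
  also have "... = (\<integral>s. poly q (1 - cos s) \<partial>radial_measure d d\<^sub>0)"
    by (subst (2) c) (simp add: poly_sum radial.bounded_measurable_integrable bm_intros)
  finally show ?thesis .
qed

lemma distr_X:
  assumes x: "x \<in> space \<mu>"
  shows "distr \<mu> borel (X x) = \<tau>"
  unfolding \<tau>_def
proof (rule distr_eq_if_moments_eq[OF prob_space_axioms prob_space_radial_measure X_measurable[OF x] cos_measurable_radial])
  fix s :: real show "0 \<le> 1 - cos s \<and> 1 - cos s \<le> 2" using cos_ge_minus_one[of s] cos_le_one[of s] by linarith
qed (use x moments_eq X_nonneg X_le_2 in auto)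

lemma integral_X:
  fixes F :: "real \<Rightarrow> real"
  assumes "x \<in> space \<mu>" "F \<in> borel_measurable borel"
  shows "(\<integral>y. F (X x y) \<partial>\<mu>) = (\<integral>u. F u \<partial>\<tau>)"
  using X_measurable[OF assms(1)] assms(2) unfolding distr_X[OF assms(1), symmetric] by (simp add: integral_distr)

lemma integral_tau:
  fixes F :: "real \<Rightarrow> real"
  shows "F \<in> borel_measurable borel \<Longrightarrow> (\<integral>u. F u \<partial>\<tau>) = (\<integral>s. F (1 - cos s) \<partial>radial_measure d d\<^sub>0)"
  unfolding \<tau>_def by (subst integral_distr) auto

lemma AE_tau: "AE u in \<tau>. 0 \<le> u \<and> u \<le> 2"
proof -
  have "0 \<le> 1 - cos s \<and> 1 - cos s \<le> 2" for s :: real using cos_ge_minus_one[of s] cos_le_one[of s] by linarith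
  thus ?thesis unfolding \<tau>_def by (subst AE_distr_iff) auto
qed

end

text \<open>The indicator is a limit of continuous ramps in mean square, by dominated convergence,
  and a ramp is a uniform limit of polynomials on \<open>[0, 2]\<close>.\<close>

lemma indicator_poly_approx:
  fixes M :: "real measure"
  assumes M: "prob_space M" "sets M = sets borel" and ae: "AE u in M. 0 \<le> u \<and> u \<le> 2" and e: "0 < e"
  obtains q where "(\<integral>u. (indicator {..<\<xi>} u - poly q u)\<^sup>2 \<partial>M) < e"
proof -
  interpret prob_space M by fact
  note [measurable_cong] = M(2)
  \<comment> \<open>The ramp falls from 1 to 0 on an interval that ends at \<open>\<xi>\<close> and
    shrinks as \<open>k\<close> grows. It is already 0 at \<open>\<xi>\<close>, which is outside the
    open half-line, so the convergence holds at every point.\<close>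
  define h where "h k u = max 0 (min 1 (real k * (\<xi> - u)))" for k u
  have hb: "0 \<le> h k u" "h k u \<le> 1" for k u by (auto simp: h_def)
  have hm [measurable]: "h k \<in> borel_measurable borel" for k unfolding h_def by measurable
  have lim: "(\<lambda>k. \<integral>u. (indicator {..<\<xi>} u - h k u)\<^sup>2 \<partial>M) \<longlonglongrightarrow> (\<integral>u. 0 \<partial>M)"
  proof (rule integral_dominated_convergence[where w = "\<lambda>_. 1"])
    show "AE u in M. (\<lambda>k. (indicator {..<\<xi>} u - h k u)\<^sup>2) \<longlonglongrightarrow> 0"
    proof (rule AE_I2)
      fix u
      show "(\<lambda>k. (indicator {..<\<xi>} u - h k u)\<^sup>2) \<longlonglongrightarrow> 0"
      proof (cases "u < \<xi>")
        case True
        obtain k0 :: nat where k0: "1 / (\<xi> - u) \<le> real k0" using real_arch_simple by blast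
        have "(indicator {..<\<xi>} u - h k u)\<^sup>2 = 0" if "k \<ge> k0" for k
        proof -
          have "1 / (\<xi> - u) \<le> real k" using k0 that by linarith
          hence "1 \<le> real k * (\<xi> - u)" using True by (simp add: field_simps)
          thus ?thesis using True by (simp add: h_def)
        qed
        hence "eventually (\<lambda>k. (indicator {..<\<xi>} u - h k u)\<^sup>2 = 0) sequentially" by (auto simp: eventually_sequentially)
        thus ?thesis by (rule tendsto_eventually)
      next
        case False
        have "h k u = 0" for k using False mult_nonneg_nonpos[of "real k" "\<xi> - u"] by (simp add: h_def)
        hence "(indicator {..<\<xi>} u - h k u)\<^sup>2 = 0" for k using False by simp
        thus ?thesis by simp
      qed
    qed
    show "AE u in M. norm ((indicator {..<\<xi>} u - h k u)\<^sup>2) \<le> 1" for k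
    proof (rule AE_I2)
      fix u
      have "\<bar>indicator {..<\<xi>} u - h k u\<bar> \<le> 1" using hb[of k u] by (auto simp: indicator_def abs_le_iff)
      thus "norm ((indicator {..<\<xi>} u - h k u)\<^sup>2) \<le> 1" by (simp add: abs_square_le_1)
    qed
  qed (use M in simp_all)
  hence "(\<lambda>k. \<integral>u. (indicator {..<\<xi>} u - h k u)\<^sup>2 \<partial>M) \<longlonglongrightarrow> 0" by simp
  from order_tendstoD(2)[OF this, of "e/4"] e obtain k where k: "(\<integral>u. (indicator {..<\<xi>} u - h k u)\<^sup>2 \<partial>M) < e/4"
    by (auto simp: eventually_sequentially)
  have "continuous_on {0..2} (h k)" unfolding h_def by (intro continuous_intros)
  then obtain q where q: "\<And>x. 0 \<le> x \<Longrightarrow> x \<le> 2 \<Longrightarrow> \<bar>h k x - poly q x\<bar> < sqrt (e/4)"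
    using weierstrass_poly[of "h k" "sqrt (e/4)"] e by auto
  have i1: "integrable M (\<lambda>u. (indicator {..<\<xi>} u - h k u)\<^sup>2)"
  proof (rule integrable_const_bound[of _ 1])
    show "AE u in M. norm ((indicator {..<\<xi>} u - h k u)\<^sup>2) \<le> 1"
    proof (rule AE_I2)
      fix u
      have "\<bar>indicator {..<\<xi>} u - h k u\<bar> \<le> 1" using hb[of k u] by (auto simp: indicator_def abs_le_iff)
      thus "norm ((indicator {..<\<xi>} u - h k u)\<^sup>2) \<le> 1" by (simp add: abs_square_le_1)
    qed
  qed measurable
  have pm: "poly q \<in> borel_measurable borel" by (intro borel_measurable_continuous_onI continuous_intros)
  have b: "AE u in M. (indicator {..<\<xi>} u - poly q u)\<^sup>2 \<le> 2 * (indicator {..<\<xi>} u - h k u)\<^sup>2 + 2 * (e/4)"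
    using ae
  proof eventually_elim
    case (elim u)
    hence "\<bar>h k u - poly q u\<bar> \<le> sqrt (e/4)" using q[of u] by auto
    hence "(h k u - poly q u)\<^sup>2 \<le> e/4" using e by (metis abs_ge_zero abs_le_square_iff abs_of_nonneg power2_abs real_sqrt_ge_0_iff real_sqrt_pow2 less_eq_real_def zero_less_divide_iff zero_less_numeral)
    moreover have "(a + b)\<^sup>2 \<le> 2 * a\<^sup>2 + 2 * b\<^sup>2" for a b :: real
      using zero_le_power2[of "a - b"] by (simp add: power2_eq_square algebra_simps)
    from this[of "indicator {..<\<xi>} u - h k u" "h k u - poly q u"]
    have "(indicator {..<\<xi>} u - poly q u)\<^sup>2 \<le> 2 * (indicator {..<\<xi>} u - h k u)\<^sup>2 + 2 * (h k u - poly q u)\<^sup>2" by simp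
    ultimately show ?case by linarith
  qed
  have "(\<integral>u. (indicator {..<\<xi>} u - poly q u)\<^sup>2 \<partial>M) \<le> (\<integral>u. 2 * (indicator {..<\<xi>} u - h k u)\<^sup>2 + 2 * (e/4) \<partial>M)"
  proof (rule integral_mono_AE'[OF _ b])
    show "integrable M (\<lambda>u. 2 * (indicator {..<\<xi>} u - h k u)\<^sup>2 + 2 * (e/4))" using i1 by simp
    show "AE u in M. 0 \<le> 2 * (indicator {..<\<xi>} u - h k u)\<^sup>2 + 2 * (e/4)"
      using e by (intro AE_I2 add_nonneg_nonneg) auto
  qed
  also have "... = 2 * (\<integral>u. (indicator {..<\<xi>} u - h k u)\<^sup>2 \<partial>M) + 2 * (e/4)"
    using i1 by (simp add: prob_space)
  also have "... < 2 * (e/4) + 2 * (e/4)" using k by linarith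
  also have "... = e" by simp
  finally show ?thesis by (rule that)
qed

context zonal_space
begin

text \<open>Jacobi coefficient of a ball, not yet divided by the squared norm. The parameter
  \<open>\<xi>\<close> stands for \<open>1 - cos r\<close>, which makes balls sublevel sets of
  \<open>X\<close>.\<close>

definition \<beta> :: "real \<Rightarrow> nat \<Rightarrow> real" where
  "\<beta> \<xi> l = (\<integral>u. indicator {..<\<xi>} u * poly (P l) u \<partial>\<tau>)"

definition jacobi_norm :: "nat \<Rightarrow> real" where
  "jacobi_norm l = (\<integral>u. (poly (P l) u)\<^sup>2 \<partial>\<tau>)"

lemma poly_borel [measurable]: "poly (q :: real poly) \<in> borel_measurable borel"
  by (intro borel_measurable_continuous_onI continuous_intros)

lemma poly_tau_bound: "\<exists>B. AE u in \<tau>. \<bar>poly q u\<bar> \<le> B"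
proof -
  obtain B where "\<And>x. 0 \<le> x \<Longrightarrow> x \<le> 2 \<Longrightarrow> \<bar>poly q x\<bar> \<le> B" using poly_bounded_on_interval[of q] by blast
  thus ?thesis by (intro exI[of _ B] eventually_mono[OF AE_tau]) blast
qed

lemma tau_integrable_poly [simp]: "integrable \<tau> (poly q)"
  using poly_tau_bound[of q] by (auto intro!: tau.integrable_const_bound)

lemma tau_integrable_indicator_poly [simp]: "integrable \<tau> (\<lambda>u. indicator {..<\<xi>} u * poly q u)"
proof -
  obtain B where "AE u in \<tau>. \<bar>poly q u\<bar> \<le> B" using poly_tau_bound by blast
  hence "AE u in \<tau>. norm (indicator {..<\<xi>} u * poly q u) \<le> B" by eventually_elim (auto simp: indicator_def)
  thus ?thesis by (rule tau.integrable_const_bound) measurable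
qed

text \<open>A zero integral would force the continuous integrand to vanish on
  \<open>[0, pi]\<close>. The weight is positive inside, so every point of \<open>(0, 2)\<close>
  would be a root of \<open>P l\<close>.\<close>

lemma jacobi_norm_pos: "jacobi_norm l > 0"
proof -
  have e: "jacobi_norm l = integral {0..pi} (\<lambda>s. weight d d\<^sub>0 s * (poly (P l) (1 - cos s))\<^sup>2) / weight_mass d d\<^sub>0"
    unfolding jacobi_norm_def by (subst integral_tau) (auto intro!: radial_measure_integral(2)[where b = 0] continuous_intros)
  have i: "(\<lambda>s. weight d d\<^sub>0 s * (poly (P l) (1 - cos s))\<^sup>2) integrable_on {0..pi}"
    by (intro integrable_continuous_interval continuous_intros)
  have "0 \<le> integral {0..pi} (\<lambda>s. weight d d\<^sub>0 s * (poly (P l) (1 - cos s))\<^sup>2)"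
    by (intro integral_nonneg i) (auto intro!: mult_nonneg_nonneg weight_nonneg)
  moreover have "integral {0..pi} (\<lambda>s. weight d d\<^sub>0 s * (poly (P l) (1 - cos s))\<^sup>2) \<noteq> 0"
  proof
    assume "integral {0..pi} (\<lambda>s. weight d d\<^sub>0 s * (poly (P l) (1 - cos s))\<^sup>2) = 0"
    hence 0: "((\<lambda>s. weight d d\<^sub>0 s * (poly (P l) (1 - cos s))\<^sup>2) has_integral 0) (cbox 0 pi)"
      using integrable_integral[OF i] by simp
    have ne: "box 0 pi \<noteq> ({} :: real set)" using pi_gt_zero by (auto simp: box_ne_empty simp del: box_real)
    have "weight d d\<^sub>0 s * (poly (P l) (1 - cos s))\<^sup>2 = 0" if "0 \<le> s" "s \<le> pi" for s
      by (rule has_integral_0_cbox_imp_0[OF _ _ 0 ne]) (use that in \<open>auto intro!: continuous_intros mult_nonneg_nonneg weight_nonneg\<close>)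
    hence z: "poly (P l) (1 - cos s) = 0" if "0 < s" "s < pi" for s using weight_pos[OF that, of d d\<^sub>0] that \<open>\<And>s. 0 \<le> s \<Longrightarrow> s \<le> pi \<Longrightarrow> _ s = 0\<close>[of s] by simp
    have "{0<..<2} \<subseteq> {x. poly (P l) x = 0}"
    proof
      fix x :: real assume "x \<in> {0<..<2}"
      hence x: "-1 < 1 - x" "1 - x < 1" by auto
      hence "0 < arccos (1 - x)" "arccos (1 - x) < pi" using arccos_lt_bounded[of "1 - x"] by auto
      thus "x \<in> {x. poly (P l) x = 0}" using z[of "arccos (1 - x)"] x by (simp add: cos_arccos)
    qed
    moreover have "infinite {0<..<2::real}" by (simp add: infinite_Ioo)
    moreover have "P l \<noteq> 0" using coeff_jacobi_poly[of d d\<^sub>0 l 0] by auto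
    ultimately show False using poly_roots_finite finite_subset by blast
  qed
  ultimately show ?thesis unfolding e using weight_mass_pos[of d d\<^sub>0] by (intro divide_pos_pos) auto
qed

definition jacobi_sum :: "nat \<Rightarrow> real \<Rightarrow> real poly" where
  "jacobi_sum n \<xi> = (\<Sum>l\<le>n. smult (\<beta> \<xi> l / jacobi_norm l) (P l))"

definition err :: "nat \<Rightarrow> real \<Rightarrow> real" where
  "err n \<xi> = (\<integral>u. (indicator {..<\<xi>} u - poly (jacobi_sum n \<xi>) u)\<^sup>2 \<partial>\<tau>)"

lemma space_nonempty: "\<exists>x. x \<in> space \<mu>"
  using not_empty by blast

lemma tau_orthogonal: "l \<noteq> k \<Longrightarrow> (\<integral>u. poly (P l) u * poly (P k) u \<partial>\<tau>) = 0"
proof -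
  assume "l \<noteq> k"
  obtain x where x: "x \<in> space \<mu>" using space_nonempty by blast
  show ?thesis using integral_X[OF x, of "\<lambda>u. poly (P l) u * poly (P k) u"] jacobi_orthogonal[OF x x \<open>l \<noteq> k\<close>] by simp
qed

lemma distance_expansion:
  "(\<integral>u. (indicator {..<\<xi>} u - poly (\<Sum>l\<le>n. smult (c l) (P l)) u)\<^sup>2 \<partial>\<tau>)
     = (\<integral>u. indicator {..<\<xi>} u \<partial>\<tau>) + (\<Sum>l\<le>n. (c l)\<^sup>2 * jacobi_norm l - 2 * c l * \<beta> \<xi> l)"
proof -
  have "(indicator {..<\<xi>} u - poly (\<Sum>l\<le>n. smult (c l) (P l)) u)\<^sup>2 =
     indicator {..<\<xi>} u + (\<Sum>l\<le>n. \<Sum>k\<le>n. c l * c k * poly (P l * P k) u) - 2 * (\<Sum>l\<le>n. c l * (indicator {..<\<xi>} u * poly (P l) u))" for u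
    by (cases "u < \<xi>") (simp_all add: poly_sum power2_eq_square algebra_simps sum_product sum_distrib_left sum_distrib_right)
  hence "(\<integral>u. (indicator {..<\<xi>} u - poly (\<Sum>l\<le>n. smult (c l) (P l)) u)\<^sup>2 \<partial>\<tau>) =
     (\<integral>u. indicator {..<\<xi>} u + (\<Sum>l\<le>n. \<Sum>k\<le>n. c l * c k * poly (P l * P k) u) - 2 * (\<Sum>l\<le>n. c l * (indicator {..<\<xi>} u * poly (P l) u)) \<partial>\<tau>)"
    by simp
  also have "... = (\<integral>u. indicator {..<\<xi>} u \<partial>\<tau>) + (\<Sum>l\<le>n. \<Sum>k\<le>n. c l * c k * (\<integral>u. poly (P l * P k) u \<partial>\<tau>)) - 2 * (\<Sum>l\<le>n. c l * \<beta> \<xi> l)"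
    unfolding \<beta>_def using tau_integrable_indicator_poly[of \<xi> 1] by (simp del: poly_mult)
  also have "(\<Sum>l\<le>n. \<Sum>k\<le>n. c l * c k * (\<integral>u. poly (P l * P k) u \<partial>\<tau>)) = (\<Sum>l\<le>n. (c l)\<^sup>2 * jacobi_norm l)"
  proof (intro sum.cong refl)
    fix l assume l: "l \<in> {..n}"
    have "(\<Sum>k\<le>n. c l * c k * (\<integral>u. poly (P l * P k) u \<partial>\<tau>)) = (\<Sum>k\<le>n. if k = l then (c l)\<^sup>2 * jacobi_norm l else 0)"
      by (intro sum.cong refl) (auto simp: tau_orthogonal jacobi_norm_def power2_eq_square)
    thus "(\<Sum>k\<le>n. c l * c k * (\<integral>u. poly (P l * P k) u \<partial>\<tau>)) = (c l)\<^sup>2 * jacobi_norm l" using l by simp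
  qed
  finally show ?thesis by (simp add: sum_subtractf sum_distrib_left mult.assoc)
qed

text \<open>By \<open>distance_expansion\<close> the squared distance is a sum of quadratic
  functions of one coefficient each; completing the square shows that
  \<open>\<beta> \<xi> l / jacobi_norm l\<close> minimises each of them.\<close>

lemma err_le:
  assumes "degree q \<le> n"
  shows "err n \<xi> \<le> (\<integral>u. (indicator {..<\<xi>} u - poly q u)\<^sup>2 \<partial>\<tau>)"
proof -
  obtain c where q: "q = (\<Sum>l\<le>n. smult (c l) (P l))" using poly_eq_sum_jacobi_poly[OF d_pos d0_pos assms] by blast
  show ?thesis unfolding err_def jacobi_sum_def q distance_expansion
  proof (intro add_left_mono sum_mono)
    fix l
    have "0 \<le> (c l * jacobi_norm l - \<beta> \<xi> l)\<^sup>2 / jacobi_norm l" using jacobi_norm_pos[of l] by simp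
    thus "(\<beta> \<xi> l / jacobi_norm l)\<^sup>2 * jacobi_norm l - 2 * (\<beta> \<xi> l / jacobi_norm l) * \<beta> \<xi> l \<le> (c l)\<^sup>2 * jacobi_norm l - 2 * c l * \<beta> \<xi> l"
      using jacobi_norm_pos[of l] by (simp add: field_simps power2_eq_square)
  qed
qed

lemma err_nonneg: "0 \<le> err n \<xi>" unfolding err_def by simp

lemma err_tendsto_0: "(\<lambda>n. err n \<xi>) \<longlonglongrightarrow> 0"
proof (rule tendstoI)
  fix e :: real assume e: "0 < e"
  obtain q where q: "(\<integral>u. (indicator {..<\<xi>} u - poly q u)\<^sup>2 \<partial>\<tau>) < e"
    using indicator_poly_approx[OF tau.prob_space_axioms sets_tau AE_tau e] by blast
  have "dist (err n \<xi>) 0 < e" if "n \<ge> degree q" for n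
    using err_le[OF that, of \<xi>] err_nonneg[of n \<xi>] q by simp
  thus "eventually (\<lambda>n. dist (err n \<xi>) 0 < e) sequentially" by (auto simp: eventually_sequentially)
qed

end

section \<open>The Dirichlet kernel as a polynomial in \<open>1 - cos s\<close>\<close>

text \<open>Chebyshev polynomials of the first kind in shifted form, built by their three-term
  recurrence.\<close>

lemma cos_multiple_poly: "\<exists>q. degree q \<le> n \<and> (\<forall>s. poly q (1 - cos s) = cos (real n * s))"
proof (induction n rule: induct_nat_012)
  case 0 show ?case by (intro exI[of _ 1]) simp
next
  case 1 show ?case by (intro exI[of _ "[:1, -1:]"]) simp
next
  case (ge2 n)
  then obtain q q' where q: "degree q \<le> n" "\<And>s. poly q (1 - cos s) = cos (real n * s)"
    and q': "degree q' \<le> Suc n" "\<And>s. poly q' (1 - cos s) = cos (real (Suc n) * s)" by blast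
  let ?r = "[:2, -2:] * q' - q"
  have "degree ?r \<le> Suc (Suc n)"
    using q(1) q'(1) degree_mult_le[of "[:2, -2:]" q'] by (intro degree_diff_le) auto
  moreover have "poly ?r (1 - cos s) = cos (real (Suc (Suc n)) * s)" for s
  proof -
    have "cos (real (Suc (Suc n)) * s) + cos (real n * s) = 2 * cos s * cos (real (Suc n) * s)"
    proof -
      have 1: "real (Suc (Suc n)) * s = real (Suc n) * s + s" "real n * s = real (Suc n) * s - s" by (simp_all add: algebra_simps)
      show ?thesis unfolding 1 cos_add cos_diff by simp
    qed
    thus ?thesis by (simp add: q q' algebra_simps)
  qed
  ultimately show ?case by blast
qed

lemma dirichlet_kernel_poly:
  "\<exists>q. degree q \<le> m \<and> (\<forall>s. poly q (1 - cos s) = 1 + 2 * (\<Sum>j=1..m. cos (real j * s)))"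
proof -
  obtain c where c: "\<And>n. degree (c n) \<le> n" "\<And>n s. poly (c n) (1 - cos s) = cos (real n * s)"
    using cos_multiple_poly by metis
  let ?q = "1 + smult 2 (\<Sum>j=1..m. c j)"
  have "degree ?q \<le> m" using c(1)
    by (intro degree_add_le order_trans[OF degree_smult_le] degree_sum_le) (auto intro: order_trans)
  moreover have "poly ?q (1 - cos s) = 1 + 2 * (\<Sum>j=1..m. cos (real j * s))" for s
    by (simp add: poly_sum c)
  ultimately show ?thesis by blast
qed

lemma dirichlet_kernel_sin:
  "(1 + 2 * (\<Sum>j=1..m. cos (real j * s))) * sin (s/2) = sin ((real m + 1/2) * s)"
proof (induction m)
  case (Suc m)
  have "2 * cos (real (Suc m) * s) * sin (s/2) = sin ((real (Suc m) + 1/2) * s) - sin ((real m + 1/2) * s)"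
  proof -
    have 1: "(real (Suc m) + 1/2) * s = real (Suc m) * s + s/2" "(real m + 1/2) * s = real (Suc m) * s - s/2"
      by (simp_all add: field_simps)
    show ?thesis unfolding 1 sin_add sin_diff by simp
  qed
  thus ?case using Suc by (simp add: algebra_simps)
qed simp

lemma cos_multiple_has_integral:
  assumes "n \<noteq> 0" shows "((\<lambda>s. cos (real_of_int n * s)) has_integral 0) {0..pi}"
proof -
  have "((\<lambda>s. cos (real_of_int n * s)) has_integral (sin (real_of_int n * pi) / real_of_int n - sin (real_of_int n * 0) / real_of_int n)) {0..pi}"
    using assms by (intro fundamental_theorem_of_calculus) (auto simp flip: has_real_derivative_iff_has_vector_derivative intro!: derivative_eq_intros)
  thus ?thesis by (simp add: mult.commute[of "real_of_int n" pi])
qed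

lemma cos_cos_has_integral:
  assumes "1 \<le> m" "j \<le> m"
  shows "((\<lambda>s. cos (real m * s) * cos (real j * s)) has_integral (if j = m then pi/2 else 0)) {0..pi}"
proof -
  have e: "cos (real m * s) * cos (real j * s) = (cos (real_of_int (int m + int j) * s) + cos (real_of_int (int m - int j) * s)) * (1/2)" for s
    by (simp add: cos_add cos_diff distrib_right left_diff_distrib)
  have "((\<lambda>s. cos (real_of_int (int m - int j) * s)) has_integral (if j = m then pi else 0)) {0..pi}"
    using cos_multiple_has_integral[of "int m - int j"] has_integral_const_real[of "1::real" 0 pi] by auto
  from has_integral_mult_left[OF has_integral_add[OF cos_multiple_has_integral[of "int m + int j"] this], of "1/2"] assms
  show ?thesis unfolding e by (auto split: if_splits)
qed

text \<open>Raising \<open>m\<close> by one adds to the square a term \<open>4 cos^2\<close>, which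
  contributes \<open>2 pi\<close>, and products of different frequencies, which integrate to
  0.\<close>

lemma dirichlet_kernel_square_integral:
  "((\<lambda>s. (1 + 2 * (\<Sum>j=1..m. cos (real j * s)))\<^sup>2) has_integral pi * (2 * real m + 1)) {0..pi}"
proof (induction m)
  case 0 show ?case using has_integral_const_real[of "1::real" 0 pi] by simp
next
  case (Suc m)
  let ?n = "Suc m"
  have e: "(1 + 2 * (\<Sum>j=1..?n. cos (real j * s)))\<^sup>2 = (1 + 2 * (\<Sum>j=1..m. cos (real j * s)))\<^sup>2
     + (4 * (cos (real ?n * s) * cos (real 0 * s)) + 8 * (\<Sum>j=1..m. cos (real ?n * s) * cos (real j * s)) + 4 * (cos (real ?n * s) * cos (real ?n * s)))" for s
    by (simp add: power2_eq_square algebra_simps sum_distrib_left)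
  have 0: "((\<lambda>s. cos (real ?n * s) * cos (real 0 * s)) has_integral 0) {0..pi}"
    using cos_cos_has_integral[of ?n 0] by (simp del: of_nat_Suc)
  have 1: "((\<lambda>s. \<Sum>j=1..m. cos (real ?n * s) * cos (real j * s)) has_integral (\<Sum>j=1..m. 0)) {0..pi}"
  proof (rule has_integral_sum)
    fix j assume "j \<in> {1..m}"
    thus "((\<lambda>s. cos (real ?n * s) * cos (real j * s)) has_integral 0) {0..pi}"
      using cos_cos_has_integral[of ?n j] by (simp del: of_nat_Suc)
  qed simp
  have 2: "((\<lambda>s. cos (real ?n * s) * cos (real ?n * s)) has_integral (pi/2)) {0..pi}"
    using cos_cos_has_integral[of ?n ?n] by (simp del: of_nat_Suc)
  have "((\<lambda>s. (1 + 2 * (\<Sum>j=1..?n. cos (real j * s)))\<^sup>2) has_integral (pi * (2 * real m + 1) + (4 * 0 + 8 * (\<Sum>j=1..m. 0) + 4 * (pi/2)))) {0..pi}"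
    unfolding e by (intro has_integral_add has_integral_mult_right Suc 0 1 2)
  thus ?case by (simp add: algebra_simps)
qed

lemma integral_le_has_integral:
  fixes f g :: "real \<Rightarrow> real"
  assumes "f integrable_on S" "(g has_integral y) S" "\<And>x. x \<in> S \<Longrightarrow> f x \<le> g x"
  shows "integral S f \<le> y"
  using has_integral_le[OF integrable_integral[OF assms(1)] assms(2,3)] .

section \<open>Discrepancy of a point set in terms of Jacobi coefficients\<close>

context zonal_space
begin

text \<open>On \<open>[0, pi]\<close> the conditions \<open>1 - cos s < 1 - cos r\<close> and
  \<open>s < r\<close> agree, so the coefficient is an integral of weight times polynomial up to
  \<open>r\<close>, which the flux evaluates.\<close>

lemma beta_eq:
  assumes l: "1 \<le> l" and r: "0 \<le> r" "r \<le> pi"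
  shows "\<beta> (1 - cos r) l = - jacobi_flux d d\<^sub>0 (P l) r / (\<Lambda> l * weight_mass d d\<^sub>0)"
proof -
  have "\<beta> (1 - cos r) l = (\<integral>s. indicator {..<1 - cos r} (1 - cos s) * poly (P l) (1 - cos s) \<partial>radial_measure d d\<^sub>0)"
    unfolding \<beta>_def by (subst integral_tau) auto
  also have "... = (\<integral>s. indicator {..<r} s * poly (P l) (1 - cos s) \<partial>radial_measure d d\<^sub>0)"
  proof (rule integral_cong_AE)
    show "AE s in radial_measure d d\<^sub>0. indicator {..<1 - cos r} (1 - cos s) * poly (P l) (1 - cos s) = indicator {..<r} s * poly (P l) (1 - cos s)"
      using AE_radial_measure
    proof eventually_elim
      case (elim s)
      hence "cos r < cos s \<longleftrightarrow> s < r" using r cos_mono_less_eq by blast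
      thus ?case by (simp add: indicator_def)
    qed
  qed (simp_all add: radial_measure_def)
  also have "... = integral {0..r} (\<lambda>s. weight d d\<^sub>0 s * poly (P l) (1 - cos s)) / weight_mass d d\<^sub>0"
    using r by (intro radial_measure_integral(1) continuous_intros)
  finally show ?thesis using jacobi_poly_weight_integral[OF d_pos d0_pos l r(1)] by simp
qed

lemma beta_0: "\<beta> \<xi> 0 = (\<integral>u. indicator {..<\<xi>} u \<partial>\<tau>)"
  by (simp add: \<beta>_def jacobi_poly_0)

lemma jacobi_norm_0: "jacobi_norm 0 = 1"
  using tau.prob_space by (simp add: jacobi_norm_def jacobi_poly_0)

text \<open>Points are indexed by \<open>i < N\<close>, so multiplicities are respected and sums
  over pairs of points become double sums over indices.\<close>

definition count :: "nat \<Rightarrow> (nat \<Rightarrow> 'a) \<Rightarrow> real \<Rightarrow> 'a \<Rightarrow> real" where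
  "count N p \<xi> y = (\<Sum>i<N. indicator {..<\<xi>} (X (p i) y))"

definition var :: "nat \<Rightarrow> (nat \<Rightarrow> 'a) \<Rightarrow> real \<Rightarrow> real" where
  "var N p \<xi> = (\<integral>y. (count N p \<xi> y - real N * \<beta> \<xi> 0)\<^sup>2 \<partial>\<mu>)"

text \<open>This depends on the points but not on the radius, whereas \<open>\<beta> \<xi> l\<close>
  depends on the radius alone. The separation allows one radius to be compared with others frequency
  by frequency.\<close>

definition jacobi_energy :: "nat \<Rightarrow> (nat \<Rightarrow> 'a) \<Rightarrow> nat \<Rightarrow> real" where
  "jacobi_energy N p l = (\<integral>y. (\<Sum>i<N. poly (P l) (X (p i) y))\<^sup>2 \<partial>\<mu>)"

text \<open>Truncated expansion of \<open>var\<close>. The sum starts at 1 because subtracting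
  \<open>real N * \<beta> \<xi> 0\<close> removes the constant component.\<close>

definition energy :: "nat \<Rightarrow> (nat \<Rightarrow> 'a) \<Rightarrow> nat \<Rightarrow> real \<Rightarrow> real" where
  "energy N p n \<xi> = (\<Sum>l=1..n. (\<beta> \<xi> l / jacobi_norm l)\<^sup>2 * jacobi_energy N p l)"

lemma jacobi_energy_nonneg: "0 \<le> jacobi_energy N p l" unfolding jacobi_energy_def by simp

lemma bounded_measurable_indicator_X [bm_intros]:
  "x \<in> space \<mu> \<Longrightarrow> bounded_measurable \<mu> (\<lambda>y. indicator {..<\<xi>} (X x y))"
  unfolding bounded_measurable_def using X_measurable[of x] by (auto intro!: exI[of _ 1] simp: indicator_def)

text \<open>Products of components of different degrees integrate to 0 for every pair of points, by
  orthogonality about two centres; the components of one degree are kept together in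
  \<open>jacobi_energy\<close>.\<close>

lemma energy_eq:
  assumes p: "\<forall>i<N. p i \<in> space \<mu>"
  shows "energy N p n \<xi> = (\<integral>y. (\<Sum>i<N. poly (jacobi_sum n \<xi>) (X (p i) y) - \<beta> \<xi> 0)\<^sup>2 \<partial>\<mu>)"
proof -
  define \<Phi> where "\<Phi> l y = (\<Sum>i<N. poly (P l) (X (p i) y))" for l y
  define c where "c l = \<beta> \<xi> l / jacobi_norm l" for l
  have expand: "poly (jacobi_sum n \<xi>) u - \<beta> \<xi> 0 = (\<Sum>l=1..n. c l * poly (P l) u)" for u
  proof -
    have "{..n} = insert 0 {1..n}" by auto
    thus ?thesis by (simp add: jacobi_sum_def poly_sum c_def jacobi_poly_0 jacobi_norm_0)
  qed
  have G: "(\<Sum>i<N. poly (jacobi_sum n \<xi>) (X (p i) y) - \<beta> \<xi> 0) = (\<Sum>l=1..n. c l * \<Phi> l y)" for y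
    unfolding expand \<Phi>_def sum_distrib_left by (rule sum.swap)
  have bm: "bounded_measurable \<mu> (\<lambda>y. \<Phi> l y * \<Phi> k y)" for l k
    unfolding \<Phi>_def using p by (intro bm_intros) auto
  have orth: "(\<integral>y. \<Phi> l y * \<Phi> k y \<partial>\<mu>) = 0" if "l \<noteq> k" for l k
  proof -
    have "(\<integral>y. \<Phi> l y * \<Phi> k y \<partial>\<mu>) = (\<integral>y. (\<Sum>i<N. \<Sum>j<N. poly (P l) (X (p i) y) * poly (P k) (X (p j) y)) \<partial>\<mu>)"
      unfolding \<Phi>_def sum_product ..
    also have "... = (\<Sum>i<N. \<Sum>j<N. \<integral>y. poly (P l) (X (p i) y) * poly (P k) (X (p j) y) \<partial>\<mu>)"
      using p by (subst Bochner_Integration.integral_sum, (intro bounded_measurable_integrable bm_intros; simp))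
         (intro sum.cong refl Bochner_Integration.integral_sum bounded_measurable_integrable bm_intros; simp)
    also have "... = 0" using p that by (intro sum.neutral ballI) (auto intro!: sum.neutral jacobi_orthogonal)
    finally show ?thesis .
  qed
  have "(\<integral>y. (\<Sum>i<N. poly (jacobi_sum n \<xi>) (X (p i) y) - \<beta> \<xi> 0)\<^sup>2 \<partial>\<mu>) = (\<integral>y. (\<Sum>l=1..n. \<Sum>k=1..n. (c l * c k) * (\<Phi> l y * \<Phi> k y)) \<partial>\<mu>)"
    unfolding G power2_eq_square sum_product by (simp add: mult_ac)
  also have "... = (\<Sum>l=1..n. \<Sum>k=1..n. (c l * c k) * (\<integral>y. \<Phi> l y * \<Phi> k y \<partial>\<mu>))"
    using bounded_measurable_integrable[OF bm] by simp
  also have "... = (\<Sum>l=1..n. (c l)\<^sup>2 * jacobi_energy N p l)"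
  proof (intro sum.cong refl)
    fix l assume l: "l \<in> {1..n}"
    have "(\<Sum>k=1..n. (c l * c k) * (\<integral>y. \<Phi> l y * \<Phi> k y \<partial>\<mu>)) = (\<Sum>k=1..n. if k = l then (c l)\<^sup>2 * jacobi_energy N p l else 0)"
      by (intro sum.cong refl) (auto simp: orth jacobi_energy_def power2_eq_square simp flip: \<Phi>_def)
    thus "(\<Sum>k=1..n. (c l * c k) * (\<integral>y. \<Phi> l y * \<Phi> k y \<partial>\<mu>)) = (c l)\<^sup>2 * jacobi_energy N p l" using l by simp
  qed
  finally show ?thesis unfolding energy_def c_def by simp
qed

text \<open>Cauchy-Schwarz over the \<open>N\<close> summands. Each squared deviation then
  integrates to \<open>err n \<xi>\<close>, whatever its centre, because all distances have the same
  law.\<close>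

lemma approx_error:
  assumes p: "\<forall>i<N. p i \<in> space \<mu>"
  shows "(\<integral>y. (\<Sum>i<N. indicator {..<\<xi>} (X (p i) y) - poly (jacobi_sum n \<xi>) (X (p i) y))\<^sup>2 \<partial>\<mu>) \<le> (real N)\<^sup>2 * err n \<xi>"
proof -
  have bm: "bounded_measurable \<mu> (\<lambda>y. indicator {..<\<xi>} (X (p i) y) - poly (jacobi_sum n \<xi>) (X (p i) y))" if "i < N" for i
    using p that by (intro bm_intros) auto
  have "(\<integral>y. (\<Sum>i<N. indicator {..<\<xi>} (X (p i) y) - poly (jacobi_sum n \<xi>) (X (p i) y))\<^sup>2 \<partial>\<mu>)
     \<le> (\<integral>y. real N * (\<Sum>i<N. (indicator {..<\<xi>} (X (p i) y) - poly (jacobi_sum n \<xi>) (X (p i) y))\<^sup>2) \<partial>\<mu>)"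
  proof (rule integral_mono)
    show "integrable \<mu> (\<lambda>y. (\<Sum>i<N. indicator {..<\<xi>} (X (p i) y) - poly (jacobi_sum n \<xi>) (X (p i) y))\<^sup>2)"
      by (intro bounded_measurable_integrable bounded_measurable_power bounded_measurable_sum bm) auto
    show "integrable \<mu> (\<lambda>y. real N * (\<Sum>i<N. (indicator {..<\<xi>} (X (p i) y) - poly (jacobi_sum n \<xi>) (X (p i) y))\<^sup>2))"
      by (intro bounded_measurable_integrable bounded_measurable_mult bounded_measurable_const bounded_measurable_power bounded_measurable_sum bm) auto
    fix y
    show "(\<Sum>i<N. indicator {..<\<xi>} (X (p i) y) - poly (jacobi_sum n \<xi>) (X (p i) y))\<^sup>2 \<le> real N * (\<Sum>i<N. (indicator {..<\<xi>} (X (p i) y) - poly (jacobi_sum n \<xi>) (X (p i) y))\<^sup>2)"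
      using sum_squared_le_sum_of_squares[of "\<lambda>i. indicator {..<\<xi>} (X (p i) y) - poly (jacobi_sum n \<xi>) (X (p i) y)" "{..<N}"] by (simp add: mult.commute)
  qed
  also have "... = real N * (\<Sum>i<N. \<integral>y. (indicator {..<\<xi>} (X (p i) y) - poly (jacobi_sum n \<xi>) (X (p i) y))\<^sup>2 \<partial>\<mu>)"
    by (subst integral_mult_right_zero, subst Bochner_Integration.integral_sum)
       (intro bounded_measurable_integrable bounded_measurable_power bm | simp)+
  also have "... = real N * (\<Sum>i<N. err n \<xi>)"
    unfolding err_def using p by (intro arg_cong[where f = "\<lambda>x. real N * x"] sum.cong refl integral_X[where F = "\<lambda>u. (indicator {..<\<xi>} u - poly (jacobi_sum n \<xi>) u)\<^sup>2"]) auto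
  finally show ?thesis by (simp add: power2_eq_square)
qed

lemma square_add_le: "(a + b)\<^sup>2 \<le> 2 * a\<^sup>2 + 2 * (b::real)\<^sup>2"
  using zero_le_power2[of "a - b"] by (simp add: power2_eq_square algebra_simps)

text \<open>The deviation is \<open>a = b + c\<close> with \<open>b\<close> the truncated expansion
  and \<open>c\<close> the tail, and \<open>(b + c)^2 \<le> 2 b^2 + 2 c^2\<close>. The factor 2
  takes the place of an exact Parseval identity and only enlarges the final constant.\<close>

lemma var_energy:
  assumes p: "\<forall>i<N. p i \<in> space \<mu>"
  shows "var N p \<xi> \<le> 2 * energy N p n \<xi> + 2 * ((real N)\<^sup>2 * err n \<xi>)"
    and "energy N p n \<xi> \<le> 2 * var N p \<xi> + 2 * ((real N)\<^sup>2 * err n \<xi>)"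
proof -
  define a where "a y = count N p \<xi> y - real N * \<beta> \<xi> 0" for y
  define b where "b y = (\<Sum>i<N. poly (jacobi_sum n \<xi>) (X (p i) y) - \<beta> \<xi> 0)" for y
  define c where "c y = (\<Sum>i<N. indicator {..<\<xi>} (X (p i) y) - poly (jacobi_sum n \<xi>) (X (p i) y))" for y
  have abc: "a y = b y + c y" for y unfolding a_def b_def c_def count_def by (simp add: sum_subtractf)
  have bm: "bounded_measurable \<mu> a" "bounded_measurable \<mu> b" "bounded_measurable \<mu> c"
    unfolding a_def[abs_def] b_def[abs_def] c_def[abs_def] count_def using p by (intro bm_intros; simp)+
  have i: "integrable \<mu> (\<lambda>y. (a y)\<^sup>2)" "integrable \<mu> (\<lambda>y. (b y)\<^sup>2)" "integrable \<mu> (\<lambda>y. (c y)\<^sup>2)"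
    by (intro bounded_measurable_integrable bounded_measurable_power bm)+
  have v: "var N p \<xi> = (\<integral>y. (a y)\<^sup>2 \<partial>\<mu>)" by (simp add: var_def a_def)
  have e: "energy N p n \<xi> = (\<integral>y. (b y)\<^sup>2 \<partial>\<mu>)" using energy_eq[of N p n \<xi>, OF p] by (simp add: b_def)
  have c: "(\<integral>y. (c y)\<^sup>2 \<partial>\<mu>) \<le> (real N)\<^sup>2 * err n \<xi>" unfolding c_def by (rule approx_error[of N p \<xi> n, OF p])
  have "(\<integral>y. (a y)\<^sup>2 \<partial>\<mu>) \<le> (\<integral>y. 2 * (b y)\<^sup>2 + 2 * (c y)\<^sup>2 \<partial>\<mu>)"
    using i square_add_le by (intro integral_mono) (auto simp: abc)
  also have "... = 2 * (\<integral>y. (b y)\<^sup>2 \<partial>\<mu>) + 2 * (\<integral>y. (c y)\<^sup>2 \<partial>\<mu>)" using i by simp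
  finally show "var N p \<xi> \<le> 2 * energy N p n \<xi> + 2 * ((real N)\<^sup>2 * err n \<xi>)" using c v e by simp
  have "(\<integral>y. (b y)\<^sup>2 \<partial>\<mu>) \<le> (\<integral>y. 2 * (a y)\<^sup>2 + 2 * (c y)\<^sup>2 \<partial>\<mu>)"
  proof (rule integral_mono)
    fix y show "(b y)\<^sup>2 \<le> 2 * (a y)\<^sup>2 + 2 * (c y)\<^sup>2" using square_add_le[of "a y" "- c y"] by (simp add: abc)
  qed (use i in auto)
  also have "... = 2 * (\<integral>y. (a y)\<^sup>2 \<partial>\<mu>) + 2 * (\<integral>y. (c y)\<^sup>2 \<partial>\<mu>)" using i by simp
  finally show "energy N p n \<xi> \<le> 2 * var N p \<xi> + 2 * ((real N)\<^sup>2 * err n \<xi>)" using c v e by simp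
qed

text \<open>The energy increases with the order of truncation while the error term tends to 0, so
  \<open>var_energy\<close> at order \<open>m\<close> gives the claim in the limit.\<close>

lemma energy_le_var:
  assumes p: "\<forall>i<N. p i \<in> space \<mu>"
  shows "energy N p n \<xi> \<le> 2 * var N p \<xi>"
proof -
  have "(\<lambda>m. 2 * var N p \<xi> + 2 * ((real N)\<^sup>2 * err m \<xi>)) \<longlonglongrightarrow> 2 * var N p \<xi> + 2 * ((real N)\<^sup>2 * 0)"
    by (intro tendsto_intros err_tendsto_0)
  moreover have "energy N p n \<xi> \<le> 2 * var N p \<xi> + 2 * ((real N)\<^sup>2 * err m \<xi>)" if "m \<ge> n" for m
  proof -
    have "energy N p n \<xi> \<le> energy N p m \<xi>" unfolding energy_def using that jacobi_energy_nonneg by (intro sum_mono2) auto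
    thus ?thesis using var_energy(2)[of N p m \<xi>, OF p] by simp
  qed
  ultimately have "energy N p n \<xi> \<le> 2 * var N p \<xi> + 2 * ((real N)\<^sup>2 * 0)"
    by (intro tendsto_lowerbound[of _ _ sequentially]) (auto simp: eventually_sequentially)
  thus ?thesis by simp
qed

lemma var_le_if_energy_le:
  assumes p: "\<forall>i<N. p i \<in> space \<mu>" and e: "\<And>n. energy N p n \<xi> \<le> B"
  shows "var N p \<xi> \<le> 2 * B"
proof -
  have "(\<lambda>m. 2 * B + 2 * ((real N)\<^sup>2 * err m \<xi>)) \<longlonglongrightarrow> 2 * B + 2 * ((real N)\<^sup>2 * 0)"
    by (intro tendsto_intros err_tendsto_0)
  moreover have "var N p \<xi> \<le> 2 * B + 2 * ((real N)\<^sup>2 * err m \<xi>)" for m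
    using var_energy(1)[of N p \<xi> m, OF p] e[of m] by simp
  ultimately have "var N p \<xi> \<le> 2 * B + 2 * ((real N)\<^sup>2 * 0)"
    by (intro tendsto_lowerbound[of _ _ sequentially]) auto
  thus ?thesis by simp
qed

text \<open>\<open>real N * \<beta> \<xi> 0\<close> is the mean of \<open>count\<close>, so
  \<open>var\<close> is a variance and at most the second moment.\<close>

lemma var_le_count:
  assumes p: "\<forall>i<N. p i \<in> space \<mu>" and c: "\<And>y. y \<in> space \<mu> \<Longrightarrow> count N p \<xi> y \<le> \<nu>"
  shows "var N p \<xi> \<le> \<nu>\<^sup>2"
proof -
  have bm: "bounded_measurable \<mu> (count N p \<xi>)" unfolding count_def[abs_def] using p by (intro bm_intros) auto
  have i: "integrable \<mu> (count N p \<xi>)" "integrable \<mu> (\<lambda>y. (count N p \<xi> y)\<^sup>2)"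
    by (intro bounded_measurable_integrable bounded_measurable_power bm)+
  have c0: "0 \<le> count N p \<xi> y" for y unfolding count_def by (intro sum_nonneg) auto
  have m: "(\<integral>y. count N p \<xi> y \<partial>\<mu>) = real N * \<beta> \<xi> 0"
  proof -
    have "(\<integral>y. count N p \<xi> y \<partial>\<mu>) = (\<Sum>i<N. \<integral>y. indicator {..<\<xi>} (X (p i) y) \<partial>\<mu>)"
      unfolding count_def using p by (intro Bochner_Integration.integral_sum bounded_measurable_integrable bm_intros) auto
    also have "... = (\<Sum>i<N. \<beta> \<xi> 0)" unfolding beta_0 using p by (intro sum.cong refl integral_X) auto
    finally show ?thesis by simp
  qed
  have "var N p \<xi> = (\<integral>y. (count N p \<xi> y)\<^sup>2 - 2 * (real N * \<beta> \<xi> 0) * count N p \<xi> y + (real N * \<beta> \<xi> 0)\<^sup>2 \<partial>\<mu>)"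
    unfolding var_def by (intro Bochner_Integration.integral_cong refl) (simp add: power2_diff algebra_simps)
  also have "... = (\<integral>y. (count N p \<xi> y)\<^sup>2 \<partial>\<mu>) - (real N * \<beta> \<xi> 0)\<^sup>2"
    using i by (simp add: m prob_space power2_eq_square)
  also have "... \<le> (\<integral>y. (count N p \<xi> y)\<^sup>2 \<partial>\<mu>)" by simp
  also have "... \<le> (\<integral>y. \<nu>\<^sup>2 \<partial>\<mu>)" using i c c0 by (intro integral_mono) (auto intro: power_mono)
  finally show ?thesis by (simp add: prob_space)
qed

text \<open>The balls of radius at most \<open>L/t\<close> serve as localized test functions: on the frequencies above
  \<open>t\<close> their mean energy dominates that of a ball of radius \<open>r\<close> up to the stated factor.\<close>

lemma var_bound:
  assumes LC: "1 \<le> L" "0 < C" "flux_bound d d\<^sub>0 L C"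
  assumes p: "\<forall>i<N. p i \<in> space \<mu>"
    and des: "\<And>q y. degree q \<le> t \<Longrightarrow> y \<in> space \<mu> \<Longrightarrow> (\<Sum>i<N. poly q (X (p i) y)) = real N * (\<integral>x. poly q (X y x) \<partial>\<mu>)"
    and t: "2 * L / pi \<le> real t" and r: "0 \<le> r" "r \<le> pi"
    and nu: "\<And>y. y \<in> space \<mu> \<Longrightarrow> count N p (1 - cos (L / t)) y \<le> \<nu>"
  shows "var N p (1 - cos r) \<le> 2 * C * L * weight d d\<^sub>0 r * real t ^ (d - 1) * \<nu>\<^sup>2"
proof -
  have t0: "0 < real t" using t LC(1) divide_pos_pos[of "2 * L" pi] pi_gt_zero by linarith
  have t1: "1 \<le> t" using t0 by simp
  have Lt: "L / t \<le> pi/2" using t t0 by (simp add: field_simps)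
  let ?a = "L / (2 * real t)" and ?b = "L / real t"
  have ab: "0 < ?a" "?a \<le> ?b" "?b - ?a = L / (2 * real t)" using t0 LC by (auto simp: field_simps)
  \<comment> \<open>A design does not see degrees from 1 to \<open>t\<close>: the sum over its
    points equals \<open>N\<close> times an integral that vanishes.\<close>
  have A0: "jacobi_energy N p l = 0" if "1 \<le> l" "l \<le> t" for l
  proof -
    have "jacobi_energy N p l = (\<integral>y. 0 \<partial>\<mu>)" unfolding jacobi_energy_def
      by (intro Bochner_Integration.integral_cong refl) (use that in \<open>simp add: des degree_jacobi_poly[OF d_pos d0_pos] jacobi_integral_zero\<close>)
    thus ?thesis by simp
  qed
  have cf: "continuous_on S (jacobi_flux d d\<^sub>0 (P l))" for S l unfolding jacobi_flux_def[abs_def] by (intro continuous_intros)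
  \<comment> \<open>Counts increase with the radius, so \<open>\<nu>\<close> bounds them for all
    radii of the averaging interval; the factor 2 comes from \<open>energy_le_var\<close>.\<close>
  have small: "energy N p n (1 - cos s) \<le> 2 * \<nu>\<^sup>2" if s: "s \<in> {?a..?b}" for s n
  proof -
    have "?b \<le> pi" using Lt pi_gt_zero by linarith
    hence "cos ?b \<le> cos s" using s ab by (intro cos_monotone_0_pi_le) auto
    hence "count N p (1 - cos s) y \<le> count N p (1 - cos ?b) y" for y
      unfolding count_def by (intro sum_mono) (simp add: indicator_def)
    hence c: "count N p (1 - cos s) y \<le> \<nu>" if "y \<in> space \<mu>" for y
      using nu[OF that] order_trans by blast
    show ?thesis using energy_le_var[of N p n "1 - cos s", OF p] var_le_count[of N p "1 - cos s" \<nu>, OF p c] by linarith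
  qed
  \<comment> \<open>The part of the degree \<open>l\<close> term that is free of the radius,
    including the constants of \<open>beta_eq\<close>.\<close>
  define k where "k l = jacobi_energy N p l / (\<Lambda> l * weight_mass d d\<^sub>0 * jacobi_norm l)\<^sup>2" for l
  have k0: "0 \<le> k l" for l unfolding k_def using jacobi_energy_nonneg by simp
  have en: "energy N p n (1 - cos s) = (\<Sum>l=1..n. k l * (jacobi_flux d d\<^sub>0 (P l) s)\<^sup>2)" if "0 \<le> s" "s \<le> pi" for s n
    unfolding energy_def k_def using that by (intro sum.cong refl) (simp add: beta_eq power_divide power_mult_distrib)
  have "energy N p n (1 - cos r) \<le> C * L * weight d d\<^sub>0 r * real t ^ (d - 1) * \<nu>\<^sup>2" for n
  proof -
    have "energy N p n (1 - cos r) = (\<Sum>l=1..n. k l * (jacobi_flux d d\<^sub>0 (P l) r)\<^sup>2)" by (rule en[OF r])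
    also have "... \<le> (\<Sum>l=1..n. k l * (C * weight d d\<^sub>0 r * real t ^ d * integral {?a..?b} (\<lambda>x. (jacobi_flux d d\<^sub>0 (P l) x)\<^sup>2)))"
    proof (rule sum_mono)
      fix l assume l: "l \<in> {1..n}"
      show "k l * (jacobi_flux d d\<^sub>0 (P l) r)\<^sup>2 \<le> k l * (C * weight d d\<^sub>0 r * real t ^ d * integral {?a..?b} (\<lambda>x. (jacobi_flux d d\<^sub>0 (P l) x)\<^sup>2))"
      proof (cases "l \<le> t")
        case True
        thus ?thesis using A0[of l] l by (simp add: k_def)
      next
        case False
        have g: "(real l)\<^sup>2 \<le> \<Lambda> l" by (rule jacobi_eigenvalue_ge[OF d_pos d0_pos])
        have "1 \<le> real l" using l by simp
        hence "1 \<le> (real l)\<^sup>2" by (rule one_le_power)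
        hence 1: "1 \<le> \<Lambda> l" using g by linarith
        have "real t \<le> real l" using False by simp
        also have "real l \<le> sqrt (\<Lambda> l)" using g by (rule real_le_rsqrt)
        finally show ?thesis using k0[of l]
          by (intro mult_left_mono LC(3)[unfolded flux_bound_def, rule_format, OF jacobi_op_jacobi_poly[OF d_pos] 1 t0 _ Lt r])
      qed
    qed
    also have "... = C * weight d d\<^sub>0 r * real t ^ d * (\<Sum>l=1..n. k l * integral {?a..?b} (\<lambda>x. (jacobi_flux d d\<^sub>0 (P l) x)\<^sup>2))"
      by (simp add: sum_distrib_left mult_ac)
    \<comment> \<open>The sum is put back under the integral before anything else is estimated: at
      each radius of the interval it is the energy of one small ball, which \<open>small\<close>
      bounds.\<close>
    also have "(\<Sum>l=1..n. k l * integral {?a..?b} (\<lambda>x. (jacobi_flux d d\<^sub>0 (P l) x)\<^sup>2)) = integral {?a..?b} (\<lambda>x. \<Sum>l=1..n. k l * (jacobi_flux d d\<^sub>0 (P l) x)\<^sup>2)"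
      by (subst integral_sum) (auto intro!: integrable_continuous_interval continuous_intros cf)
    also have "C * weight d d\<^sub>0 r * real t ^ d * integral {?a..?b} (\<lambda>x. \<Sum>l=1..n. k l * (jacobi_flux d d\<^sub>0 (P l) x)\<^sup>2)
       \<le> C * weight d d\<^sub>0 r * real t ^ d * (2 * \<nu>\<^sup>2 * (?b - ?a))"
    proof (rule mult_left_mono)
      have "integral {?a..?b} (\<lambda>x. \<Sum>l=1..n. k l * (jacobi_flux d d\<^sub>0 (P l) x)\<^sup>2) \<le> integral {?a..?b} (\<lambda>x. 2 * \<nu>\<^sup>2)"
      proof (rule integral_le)
        fix x assume x: "x \<in> {?a..?b}"
        have "?b \<le> pi" using Lt pi_gt_zero by linarith
        hence "0 \<le> x" "x \<le> pi" using x ab by auto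
        thus "(\<Sum>l=1..n. k l * (jacobi_flux d d\<^sub>0 (P l) x)\<^sup>2) \<le> 2 * \<nu>\<^sup>2" using small[OF x, of n] en[of x n] by simp
      qed (auto intro!: integrable_continuous_interval continuous_intros cf)
      thus "integral {?a..?b} (\<lambda>x. \<Sum>l=1..n. k l * (jacobi_flux d d\<^sub>0 (P l) x)\<^sup>2) \<le> 2 * \<nu>\<^sup>2 * (?b - ?a)" using ab by (simp add: mult.commute)
    qed (use LC t0 weight_nonneg[OF r] in auto)
    also have "... = C * L * weight d d\<^sub>0 r * real t ^ (d - 1) * \<nu>\<^sup>2"
      unfolding ab(3) using t0 power_eq_if[of "real t" d] d_pos by simp
    finally show ?thesis .
  qed
  from var_le_if_energy_le[of N p, OF p this] show ?thesis by (simp add: mult_ac)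
qed

text \<open>The test function is \<open>q ^ (2 * d)\<close>, with \<open>q\<close> the Dirichlet
  kernel of order \<open>m\<close> in the distance to \<open>p 0\<close>. It is nonnegative, so the
  point \<open>p 0\<close> alone makes the sum at least \<open>M ^ (2 * d)\<close>. In the integral,
  \<open>d - 1\<close> factors are spent on the weight through \<open>|D| sin (s/2) \<le> 1\<close>,
  another \<open>d - 1\<close> are bounded by \<open>M\<close>, and the last two integrate to
  \<open>pi M\<close>. The integral is thus of order \<open>M ^ d\<close>, which leaves
  \<open>M ^ d\<close> for the number of points.\<close>

lemma design_size_ge:
  assumes p: "\<forall>i<N. p i \<in> space \<mu>" and N: "0 < N"
    and des: "\<And>q y. degree q \<le> t \<Longrightarrow> y \<in> space \<mu> \<Longrightarrow> (\<Sum>i<N. poly q (X (p i) y)) = real N * (\<integral>x. poly q (X y x) \<partial>\<mu>)"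
  shows "weight_mass d d\<^sub>0 / pi * (real t / (2 * real d)) ^ d \<le> real N"
proof -
  \<comment> \<open>With this order the power \<open>q ^ (2 * d)\<close> stays within degree
    \<open>t\<close>.\<close>
  define m where "m = t div (2 * d)"
  define M where "M = 2 * real m + 1"
  define D where "D s = 1 + 2 * (\<Sum>j=1..m. cos (real j * s))" for s
  obtain q where q: "degree q \<le> m" "\<And>s. poly q (1 - cos s) = D s"
    using dirichlet_kernel_poly[of m] unfolding D_def by blast
  have M1: "1 \<le> M" by (simp add: M_def)
  have D0: "D 0 = M" by (simp add: D_def M_def)
  have DM: "\<bar>D s\<bar> \<le> M" for s
  proof -
    have "\<bar>\<Sum>j=1..m. cos (real j * s)\<bar> \<le> (\<Sum>j=1..m. 1)" by (rule order_trans[OF sum_abs sum_mono]) simp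
    thus ?thesis unfolding D_def M_def by (simp add: abs_le_iff)
  qed
  have Dsin: "\<bar>D s\<bar> * \<bar>sin (s/2)\<bar> \<le> 1" for s
    using dirichlet_kernel_sin[of s m] abs_sin_le_one[of "(real m + 1/2) * s"] unfolding D_def by (simp flip: abs_mult)
  let ?q = "q ^ (2 * d)"
  have deg: "degree ?q \<le> t"
  proof -
    have "degree ?q \<le> degree q * (2 * d)" by (rule degree_power_le)
    also have "... \<le> m * (2 * d)" using q(1) by simp
    also have "... \<le> t" unfolding m_def by (rule div_times_less_eq_dividend)
    finally show ?thesis .
  qed
  have q0: "poly ?q 0 = M ^ (2 * d)" using q(2)[of 0] D0 by simp
  have pos: "0 \<le> poly ?q u" for u by (simp add: power_mult)
  have p0: "p 0 \<in> space \<mu>" using p N by auto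
  have "poly ?q (X (p 0) (p 0)) \<le> (\<Sum>i<N. poly ?q (X (p i) (p 0)))"
    using N pos by (intro member_le_sum[of 0 _ "\<lambda>i. poly ?q (X (p i) (p 0))"]) auto
  hence "M ^ (2 * d) \<le> (\<Sum>i<N. poly ?q (X (p i) (p 0)))" unfolding X_refl[OF p0] q0 .
  also have "... = real N * (\<integral>x. poly ?q (X (p 0) x) \<partial>\<mu>)" by (rule des[OF deg p0])
  also have "(\<integral>x. poly ?q (X (p 0) x) \<partial>\<mu>) = (\<integral>s. poly ?q (1 - cos s) \<partial>radial_measure d d\<^sub>0)" by (rule moments_eq[OF p0])
  also have "... = integral {0..pi} (\<lambda>s. weight d d\<^sub>0 s * poly ?q (1 - cos s)) / weight_mass d d\<^sub>0"
    by (rule radial_measure_integral(2)[where b = 0]) (auto intro!: continuous_intros)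
  also have "real N * ... \<le> real N * (M ^ (d - 1) * (pi * M) / weight_mass d d\<^sub>0)"
  proof (intro mult_left_mono divide_right_mono)
    have int: "((\<lambda>s. (D s)\<^sup>2) has_integral pi * M) {0..pi}"
      unfolding D_def M_def by (rule dirichlet_kernel_square_integral)
    have "integral {0..pi} (\<lambda>s. weight d d\<^sub>0 s * poly ?q (1 - cos s)) \<le> M ^ (d - 1) * (pi * M)"
    proof (rule integral_le_has_integral[OF _ has_integral_mult_right[OF int]])
      show "(\<lambda>s. weight d d\<^sub>0 s * poly ?q (1 - cos s)) integrable_on {0..pi}"
        by (intro integrable_continuous_interval continuous_intros)
      fix s assume s: "s \<in> {0..pi}"
      have sc: "0 \<le> sin (s/2)" "0 \<le> cos (s/2)" using s by (auto intro!: sin_ge_zero cos_ge_zero)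
      have d1: "2 * d = (d - 1) + (d - 1) + 2" using d_pos by simp
      have "weight d d\<^sub>0 s * poly ?q (1 - cos s) \<le> sin (s/2) ^ (d - 1) * poly ?q (1 - cos s)"
        unfolding weight_def using sc pos by (intro mult_right_mono mult_right_le_one_le power_le_one) auto
      also have pe: "poly ?q (1 - cos s) = \<bar>D s\<bar> ^ (2 * d)" using q(2)[of s] by (simp add: power_even_abs)
      also have "sin (s/2) ^ (d - 1) * \<bar>D s\<bar> ^ (2 * d) = (\<bar>D s\<bar> * \<bar>sin (s/2)\<bar>) ^ (d - 1) * (\<bar>D s\<bar> ^ (d - 1) * (D s)\<^sup>2)"
        unfolding d1 power_add using sc by (simp add: power_mult_distrib mult_ac)
      also have "... \<le> 1 * (M ^ (d - 1) * (D s)\<^sup>2)"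
        using DM[of s] Dsin[of s] by (intro mult_mono power_le_one mult_right_mono power_mono) auto
      finally show "weight d d\<^sub>0 s * poly ?q (1 - cos s) \<le> M ^ (d - 1) * (D s)\<^sup>2" unfolding pe by simp
    qed
    thus "integral {0..pi} (\<lambda>s. weight d d\<^sub>0 s * poly ?q (1 - cos s)) \<le> M ^ (d - 1) * (pi * M)" .
  qed (use weight_mass_pos[of d d\<^sub>0] in auto)
  also have "... = real N * (M ^ d * (pi / weight_mass d d\<^sub>0))" using d_pos power_eq_if[of M d] by simp
  finally have "M ^ d * M ^ d \<le> M ^ d * (real N * (pi / weight_mass d d\<^sub>0))"
    unfolding mult_2 power_add by (simp add: mult_ac)
  hence "M ^ d \<le> real N * (pi / weight_mass d d\<^sub>0)" using M1 by (subst (asm) mult_le_cancel_left_pos) auto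
  moreover have "(real t / (2 * real d)) ^ d \<le> M ^ d"
  proof (rule power_mono)
    \<comment> \<open>Division with remainder loses less than one step, and
      \<open>m + 1 \<le> 2 m + 1 = M\<close>.\<close>
    have "t < (m + 1) * (2 * d)" unfolding m_def using d_pos by (metis dividend_less_div_times mult_pos_pos zero_less_numeral One_nat_def Suc_le_lessD add.commute add_mult_distrib mult_1)
    hence "real t < (real m + 1) * (2 * real d)"
      by (simp only: of_nat_less_iff[symmetric, where ?'a = real] of_nat_mult of_nat_add of_nat_1 of_nat_numeral)
    hence "real t / (2 * real d) < real m + 1" using d_pos by (simp add: field_simps)
    thus "real t / (2 * real d) \<le> M" unfolding M_def by simp
  qed simp
  ultimately have "(real t / (2 * real d)) ^ d \<le> real N * (pi / weight_mass d d\<^sub>0)" by linarith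
  hence "weight_mass d d\<^sub>0 / pi * (real t / (2 * real d)) ^ d \<le> weight_mass d d\<^sub>0 / pi * (real N * (pi / weight_mass d d\<^sub>0))"
    using weight_mass_pos[of d d\<^sub>0] by (intro mult_left_mono) auto
  also have "... = real N" using weight_mass_pos[of d d\<^sub>0] by simp
  finally show ?thesis .
qed

end

section \<open>Invariant measures, Green's formula and the spheres\<close>

text \<open>Invariance enters through orthogonal maps of the ambient space that preserve
  \<open>Q\<close>; they are isometries for the distances of both families. \<open>\<kappa>\<close>
  is the scale in \<open>1 - cos \<theta> = \<kappa> (1 - x \<bullet> y)\<close>: 1 for spheres, and
  2 for projective spaces, where \<open>sin^2 (\<theta>/2) = 1 - x \<bullet> y\<close>.\<close>

locale invariant_space = prob_space \<mu> for \<mu> :: "'a::euclidean_space measure" +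
  fixes Q :: "'a set" and \<kappa> :: real and d d\<^sub>0 :: nat
  assumes compact_Q: "compact Q" and sets_mu: "sets \<mu> = sets (restrict_space borel Q)"
    and invariant: "orthogonal_transformation g \<Longrightarrow> g ` Q = Q \<Longrightarrow> distr \<mu> \<mu> g = \<mu>"
begin

lemma space_mu: "space \<mu> = Q"
  using sets_eq_imp_space_eq[OF sets_mu] by (simp add: space_restrict_space)

lemma measurable_mu: "f \<in> borel_measurable borel \<Longrightarrow> f \<in> borel_measurable \<mu>"
  using measurable_restrict_space1[of f borel borel Q] measurable_cong_sets[OF sets_mu refl, of borel] by blast

lemma continuous_measurable_mu: "continuous_on UNIV f \<Longrightarrow> f \<in> borel_measurable \<mu>"
  by (intro measurable_mu borel_measurable_continuous_onI)

lemma continuous_bounded: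
  assumes "continuous_on UNIV (f :: 'a \<Rightarrow> real)"
  obtains B where "\<And>y. y \<in> Q \<Longrightarrow> \<bar>f y\<bar> \<le> B"
proof -
  have "bounded (f ` Q)" using compact_Q assms
    by (intro compact_imp_bounded compact_continuous_image) (auto intro: continuous_on_subset)
  then obtain B where "\<forall>y\<in>f ` Q. norm y \<le> B" unfolding bounded_iff by blast
  thus ?thesis by (intro that[of B]) auto
qed

lemma continuous_integrable:
  assumes "continuous_on UNIV (f :: 'a \<Rightarrow> real)" shows "integrable \<mu> f"
proof -
  obtain B where "\<And>y. y \<in> Q \<Longrightarrow> \<bar>f y\<bar> \<le> B" using continuous_bounded[OF assms] by blast
  thus ?thesis using continuous_measurable_mu[OF assms]
    by (intro integrable_const_bound[of _ B] AE_I2) (auto simp: space_mu)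
qed

lemma orthogonal_measurable:
  assumes "orthogonal_transformation g" "g ` Q = Q"
  shows "g \<in> measurable \<mu> \<mu>"
proof -
  have "g \<in> borel_measurable borel"
    using assms(1) by (intro borel_measurable_continuous_onI linear_continuous_on orthogonal_transformation_linear linear_conv_bounded_linear[THEN iffD1])
  hence "g \<in> measurable \<mu> borel" by (rule measurable_mu)
  hence "g \<in> measurable \<mu> (restrict_space borel Q)"
    using assms(2) by (intro measurable_restrict_space2) (auto simp: space_mu)
  thus ?thesis using measurable_cong_sets[OF refl sets_mu, of \<mu>] by blast
qed

lemma integral_orthogonal:
  assumes "orthogonal_transformation g" "g ` Q = Q" "continuous_on UNIV (f :: 'a \<Rightarrow> real)"
  shows "(\<integral>y. f (g y) \<partial>\<mu>) = (\<integral>y. f y \<partial>\<mu>)"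
  using integral_distr[OF orthogonal_measurable[OF assms(1,2)] continuous_measurable_mu[OF assms(3)]] invariant[OF assms(1,2)]
  by simp

definition zon :: "'a \<Rightarrow> 'a \<Rightarrow> real" where
  "zon x y = \<kappa> * (1 - x \<bullet> y)"

lemma continuous_zon [continuous_intros]: "continuous_on S (\<lambda>y. poly q (zon x y))"
  unfolding zon_def by (intro continuous_intros)

text \<open>The linear map \<open>A\<close> generates the family \<open>R\<close>. Derivatives are
  taken after pairing with a fixed vector, which keeps them real valued, and at every time, as the
  mean value theorem will require.\<close>

definition flow :: "(real \<Rightarrow> 'a \<Rightarrow> 'a) \<Rightarrow> ('a \<Rightarrow> 'a) \<Rightarrow> bool" where
  "flow R A \<longleftrightarrow> linear A \<and> (\<forall>s. orthogonal_transformation (R s) \<and> R s ` Q = Q) \<and> (\<forall>y\<in>Q. R 0 y = y) \<and>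
     (\<forall>y\<in>Q. \<forall>z s. ((\<lambda>s. z \<bullet> R s y) has_real_derivative z \<bullet> A (R s y)) (at s))"

text \<open>The integrand is the derivative along the flow of \<open>(e \<bullet> y)\<close> times
  the two zonal functions. The integral of this product composed with \<open>R s\<close> does not
  depend on \<open>s\<close>, and the difference quotients at 0 pass to the limit by dominated
  convergence: the mean value theorem bounds them by a bound of the derivative on \<open>Q\<close>,
  as \<open>R s\<close> maps \<open>Q\<close> to itself.\<close>

lemma flow_integral:
  assumes fl: "flow R A"
  shows "(\<integral>y. (e \<bullet> A y) * poly f (zon x y) * poly g (zon z y) - \<kappa> * (e \<bullet> y) *
     (poly (pderiv f) (zon x y) * poly g (zon z y) * (x \<bullet> A y) + poly f (zon x y) * poly (pderiv g) (zon z y) * (z \<bullet> A y)) \<partial>\<mu>) = 0"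
proof -
  define G where "G y = (e \<bullet> y) * poly f (zon x y) * poly g (zon z y)" for y
  define \<psi> where "\<psi> y = (e \<bullet> A y) * poly f (zon x y) * poly g (zon z y) - \<kappa> * (e \<bullet> y) *
     (poly (pderiv f) (zon x y) * poly g (zon z y) * (x \<bullet> A y) + poly f (zon x y) * poly (pderiv g) (zon z y) * (z \<bullet> A y))" for y
  have A: "linear A" and R: "\<And>s. orthogonal_transformation (R s)" "\<And>s. R s ` Q = Q" "\<And>y. y \<in> Q \<Longrightarrow> R 0 y = y"
    and der: "\<And>y z s. y \<in> Q \<Longrightarrow> ((\<lambda>s. z \<bullet> R s y) has_real_derivative z \<bullet> A (R s y)) (at s)"
    using fl unfolding flow_def by auto
  have cA: "continuous_on S A" for S using A by (intro linear_continuous_on linear_conv_bounded_linear[THEN iffD1])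
  have cG: "continuous_on UNIV G" unfolding G_def[abs_def] by (intro continuous_intros)
  have cpsi: "continuous_on UNIV \<psi>" unfolding \<psi>_def[abs_def] by (intro continuous_intros cA)
  have dG: "((\<lambda>s. G (R s y)) has_real_derivative \<psi> (R s y)) (at s)" if y: "y \<in> Q" for y s
  proof -
    have dz: "((\<lambda>s. zon w (R s y)) has_real_derivative - \<kappa> * (w \<bullet> A (R s y))) (at s)" for w
      unfolding zon_def using DERIV_cmult[OF DERIV_diff[OF DERIV_const[of 1] der[OF y, of w s]], of \<kappa>] by simp
    have dp: "((\<lambda>s. poly q (zon w (R s y))) has_real_derivative - \<kappa> * (w \<bullet> A (R s y)) * poly (pderiv q) (zon w (R s y))) (at s)" for q w
      using DERIV_chain'[OF dz poly_DERIV[of q]] by (simp add: mult_ac)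
    show ?thesis unfolding G_def
      by (rule DERIV_cong[OF DERIV_mult[OF DERIV_mult[OF der[OF y] dp] dp]]) (simp add: \<psi>_def algebra_simps)
  qed
  obtain B where B: "\<And>y. y \<in> Q \<Longrightarrow> \<bar>\<psi> y\<bar> \<le> B" using continuous_bounded[OF cpsi] by blast
  define q where "q k y = real (Suc k) * (G (R (1 / real (Suc k)) y) - G y)" for k :: nat and y
  have cR: "continuous_on UNIV (R s)" for s
    using R(1) by (intro linear_continuous_on linear_conv_bounded_linear[THEN iffD1] orthogonal_transformation_linear)
  have cq: "continuous_on UNIV (q k)" for k
    unfolding q_def[abs_def] by (intro continuous_intros cG continuous_on_compose2[OF cG cR]) auto
  have "(\<integral>y. q k y \<partial>\<mu>) = 0" for k
  proof -
    have i: "integrable \<mu> G" "integrable \<mu> (\<lambda>y. G (R s y))" for s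
      by (intro continuous_integrable cG continuous_on_compose2[OF cG cR]; simp)+
    show ?thesis unfolding q_def using i integral_orthogonal[OF R(1,2) cG] by simp
  qed
  moreover have "(\<lambda>k. \<integral>y. q k y \<partial>\<mu>) \<longlonglongrightarrow> (\<integral>y. \<psi> y \<partial>\<mu>)"
  proof (rule integral_dominated_convergence[where w = "\<lambda>_. B"])
    show "AE y in \<mu>. (\<lambda>k. q k y) \<longlonglongrightarrow> \<psi> y"
    proof (rule AE_I2)
      fix y assume "y \<in> space \<mu>"
      hence y: "y \<in> Q" by (simp add: space_mu)
      have "((\<lambda>h. (G (R (0 + h) y) - G (R 0 y)) / h) \<longlongrightarrow> \<psi> (R 0 y)) (at 0)"
        using dG[OF y, of 0] unfolding DERIV_def .
      hence "((\<lambda>h. (G (R h y) - G y) / h) \<longlongrightarrow> \<psi> y) (at 0)" using R(3)[OF y] by simp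
      moreover have "filterlim (\<lambda>k. 1 / real (Suc k)) (at 0) sequentially"
        using LIMSEQ_inverse_real_of_nat by (intro filterlim_atI) (simp_all add: inverse_eq_divide del: of_nat_Suc)
      ultimately have "(\<lambda>k. (G (R (1 / real (Suc k)) y) - G y) / (1 / real (Suc k))) \<longlonglongrightarrow> \<psi> y"
        by (rule filterlim_compose)
      thus "(\<lambda>k. q k y) \<longlonglongrightarrow> \<psi> y" by (simp add: q_def mult.commute)
    qed
    show "AE y in \<mu>. norm (q k y) \<le> B" for k
    proof (rule AE_I2)
      fix y assume "y \<in> space \<mu>"
      hence y: "y \<in> Q" by (simp add: space_mu)
      have "\<exists>s>0. s < 1 / real (Suc k) \<and> G (R (1 / real (Suc k)) y) - G (R 0 y) = (1 / real (Suc k) - 0) * \<psi> (R s y)"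
        using dG[OF y] by (intro MVT2) auto
      then obtain s where "G (R (1 / real (Suc k)) y) - G (R 0 y) = (1 / real (Suc k) - 0) * \<psi> (R s y)" by blast
      hence "q k y = \<psi> (R s y)" unfolding q_def R(3)[OF y] by simp
      moreover have "R s y \<in> Q" using R(2)[of s] y by blast
      ultimately show "norm (q k y) \<le> B" using B by simp
    qed
  qed (use cpsi cq continuous_measurable_mu in auto)
  ultimately have "(\<integral>y. \<psi> y \<partial>\<mu>) = 0" by (simp add: LIMSEQ_const_iff)
  thus ?thesis unfolding \<psi>_def .
qed

text \<open>\<open>\<Gamma> w y\<close> is the inner product at \<open>y\<close> of the gradients on \<open>Q\<close> of \<open>\<lambda>y. x \<bullet> y\<close> and \<open>\<lambda>y. w \<bullet> y\<close>.\<close>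

lemma green_formula:
  assumes fin: "finite I" and fl: "\<And>i. i \<in> I \<Longrightarrow> flow (R i) (A i)"
    and div: "\<And>y. y \<in> Q \<Longrightarrow> (\<Sum>i\<in>I. e i \<bullet> A i y) = - (real d - (real d + real d\<^sub>0) / 2 * zon x y)"
    and V: "\<And>y w. y \<in> Q \<Longrightarrow> (\<Sum>i\<in>I. (e i \<bullet> y) * (w \<bullet> A i y)) = \<Gamma> w y"
    and gx: "\<And>y. y \<in> Q \<Longrightarrow> \<kappa> * \<Gamma> x y = zon x y * (2 - zon x y)"
  shows "(\<integral>y. poly (jacobi_op d d\<^sub>0 f) (zon x y) * poly g (zon z y) \<partial>\<mu>) =
    - (\<integral>y. \<kappa> * (poly (pderiv f) (zon x y) * poly (pderiv g) (zon z y) * \<Gamma> z y) \<partial>\<mu>)"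
proof -
  \<comment> \<open>The combined vector field is the derivative of \<open>f\<close> at
    \<open>X\<close>, times the gradient of \<open>x \<bullet> y\<close> assembled from the
    \<open>A i\<close>. So \<open>flow_integral\<close> is applied to the derivative of
    \<open>f\<close>, and the second derivative that it produces completes the Jacobi
    operator.\<close>
  let ?f = "pderiv f"
  define T where "T i y = (e i \<bullet> A i y) * poly ?f (zon x y) * poly g (zon z y) - \<kappa> * (e i \<bullet> y) *
     (poly (pderiv ?f) (zon x y) * poly g (zon z y) * (x \<bullet> A i y) + poly ?f (zon x y) * poly (pderiv g) (zon z y) * (z \<bullet> A i y))" for i y
  have iT: "integrable \<mu> (T i)" if "i \<in> I" for i
  proof -
    have "continuous_on UNIV (A i)" using fl[OF that] unfolding flow_def
      by (intro linear_continuous_on linear_conv_bounded_linear[THEN iffD1]) auto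
    thus ?thesis unfolding T_def[abs_def] by (intro continuous_integrable continuous_intros)
  qed
  have 0: "(\<integral>y. (\<Sum>i\<in>I. T i y) \<partial>\<mu>) = 0"
    using flow_integral[OF fl] iT by (subst Bochner_Integration.integral_sum) (auto simp: T_def[abs_def])
  have S: "(\<Sum>i\<in>I. T i y) = - poly (jacobi_op d d\<^sub>0 f) (zon x y) * poly g (zon z y) - \<kappa> * (poly ?f (zon x y) * poly (pderiv g) (zon z y) * \<Gamma> z y)"
    if y: "y \<in> Q" for y
  proof -
    define c where "c = (real d + real d\<^sub>0) / 2"
    have J: "poly (jacobi_op d d\<^sub>0 f) (zon x y) = zon x y * (2 - zon x y) * poly (pderiv ?f) (zon x y) + (real d - c * zon x y) * poly ?f (zon x y)"
      by (simp add: jacobi_op_def c_def field_simps)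
    have "(\<Sum>i\<in>I. T i y) = (\<Sum>i\<in>I. e i \<bullet> A i y) * (poly ?f (zon x y) * poly g (zon z y))
       - \<kappa> * (\<Sum>i\<in>I. (e i \<bullet> y) * (x \<bullet> A i y)) * (poly (pderiv ?f) (zon x y) * poly g (zon z y))
       - \<kappa> * (\<Sum>i\<in>I. (e i \<bullet> y) * (z \<bullet> A i y)) * (poly ?f (zon x y) * poly (pderiv g) (zon z y))"
      unfolding T_def by (simp add: sum_subtractf sum.distrib sum_distrib_left sum_distrib_right algebra_simps)
    thus ?thesis unfolding div[OF y] V[OF y] gx[OF y] J c_def[symmetric] by (simp add: algebra_simps)
  qed
  have 1: "(\<integral>y. (\<Sum>i\<in>I. T i y) \<partial>\<mu>) = (\<integral>y. - poly (jacobi_op d d\<^sub>0 f) (zon x y) * poly g (zon z y) - \<kappa> * (poly ?f (zon x y) * poly (pderiv g) (zon z y) * \<Gamma> z y) \<partial>\<mu>)"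
    using S by (intro Bochner_Integration.integral_cong refl) (simp add: space_mu)
  have i1: "integrable \<mu> (\<lambda>y. poly (jacobi_op d d\<^sub>0 f) (zon x y) * poly g (zon z y))"
    by (intro continuous_integrable continuous_intros)
  \<comment> \<open>\<open>\<Gamma>\<close> is given only through its values on \<open>Q\<close>;
    integrability of its term is read off from the identity \<open>S\<close>.\<close>
  have "integrable \<mu> (\<lambda>y. - (poly (jacobi_op d d\<^sub>0 f) (zon x y) * poly g (zon z y)) - (\<Sum>i\<in>I. T i y))"
    using iT i1 by auto
  hence "integrable \<mu> (\<lambda>y. \<kappa> * (poly ?f (zon x y) * poly (pderiv g) (zon z y) * \<Gamma> z y))"
    by (rule Bochner_Integration.integrable_cong[OF refl, THEN iffD1, rotated]) (simp add: S space_mu)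
  thus ?thesis using 0 i1 unfolding 1 by simp
qed

end

section \<open>Rotations in a plane and the spheres\<close>

definition plane_rotation :: "'a::euclidean_space \<Rightarrow> 'a \<Rightarrow> real \<Rightarrow> 'a \<Rightarrow> 'a" where
  "plane_rotation x e s y = y + (cos s - 1) *\<^sub>R ((x \<bullet> y) *\<^sub>R x + (e \<bullet> y) *\<^sub>R e) + sin s *\<^sub>R ((e \<bullet> y) *\<^sub>R x - (x \<bullet> y) *\<^sub>R e)"

lemma orthogonal_plane_rotation:
  assumes "x \<bullet> x = 1" "e \<bullet> e = 1" "x \<bullet> e = 0"
  shows "orthogonal_transformation (plane_rotation x e s)"
  unfolding orthogonal_transformation_def
proof (intro conjI allI)
  show "linear (plane_rotation x e s)"
    unfolding plane_rotation_def by (intro linearI) (simp_all add: inner_simps algebra_simps scaleR_add_left scaleR_add_right)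
  fix v w
  have ex: "e \<bullet> x = 0" using assms(3) by (simp add: inner_commute)
  define C \<sigma> where "C = cos s" and "\<sigma> = sin s"
  have s: "\<sigma> * \<sigma> = 1 - C * C" using sin_cos_squared_add[of s] by (simp add: power2_eq_square C_def \<sigma>_def)
  have "plane_rotation x e s v \<bullet> plane_rotation x e s w = v \<bullet> w
    + ((C - 1) * (C - 1) + 2 * (C - 1) + \<sigma> * \<sigma>) * ((x \<bullet> v) * (x \<bullet> w) + (e \<bullet> v) * (e \<bullet> w))"
    unfolding plane_rotation_def C_def[symmetric] \<sigma>_def[symmetric]
    by (simp add: inner_simps assms ex inner_commute[of v] inner_commute[of w x] inner_commute[of w e] algebra_simps)
  also have "(C - 1) * (C - 1) + 2 * (C - 1) + \<sigma> * \<sigma> = 0" unfolding s by (simp add: algebra_simps)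
  finally show "plane_rotation x e s v \<bullet> plane_rotation x e s w = v \<bullet> w" by simp
qed

lemma orthogonal_image_sphere:
  assumes "orthogonal_transformation (g :: 'a::euclidean_space \<Rightarrow> 'a)" shows "g ` sphere 0 1 = sphere 0 1"
proof -
  have n: "norm (g v) = norm v" for v using assms by (simp add: orthogonal_transformation)
  show ?thesis
  proof (intro equalityI subsetI)
    fix y :: 'a assume y: "y \<in> sphere 0 1"
    obtain v where "y = g v" using orthogonal_transformation_surj[OF assms] by (meson surjE)
    thus "y \<in> g ` sphere 0 1" using y n by auto
  qed (use n in auto)
qed

locale invariant_sphere = invariant_space \<mu> "sphere 0 1" 1 d d for \<mu> :: "'a::euclidean_space measure" and d :: nat +
  assumes dim: "DIM('a) = d + 1"
begin

lemma sphere_jacobi_op: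
  assumes x: "x \<in> sphere 0 1"
  shows "(\<integral>y. poly (jacobi_op d d f) (zon x y) * poly g (zon z y) \<partial>\<mu>) =
    - (\<integral>y. 1 * (poly (pderiv f) (zon x y) * poly (pderiv g) (zon z y) * (x \<bullet> z - (x \<bullet> y) * (z \<bullet> y))) \<partial>\<mu>)"
proof -
  have xx: "x \<bullet> x = 1" using x by (simp add: norm_eq_1)
  \<comment> \<open>\<open>u b\<close> is the component of the basis vector \<open>b\<close>
    orthogonal to \<open>x\<close>. Rotating towards it with speed \<open>norm (u b)\<close> and
    summing over the whole ambient basis avoids a choice of orthonormal basis of the complement; a
    \<open>b\<close> parallel to \<open>x\<close> gives the constant flow.\<close>
  define u where "u b = b - (b \<bullet> x) *\<^sub>R x" for b
  define A where "A b y = (u b \<bullet> y) *\<^sub>R x - (x \<bullet> y) *\<^sub>R u b" for b y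
  define R where "R b s = (if u b = 0 then (\<lambda>y. y) else plane_rotation x (u b /\<^sub>R norm (u b)) (norm (u b) * s))" for b s
  have xu: "x \<bullet> u b = 0" for b unfolding u_def by (simp add: inner_simps xx inner_commute)
  have fl: "flow (R b) (A b)" for b
  proof (cases "u b = 0")
    case True thus ?thesis unfolding flow_def R_def A_def by (auto intro!: derivative_eq_intros simp: linear_iff)
  next
    case False
    define \<rho> where "\<rho> = norm (u b)"
    define e where "e = u b /\<^sub>R \<rho>"
    have r: "\<rho> > 0" using False by (simp add: \<rho>_def)
    have ub: "u b = \<rho> *\<^sub>R e" using r by (simp add: e_def)
    have ee: "e \<bullet> e = 1" using r unfolding e_def \<rho>_def by (simp add: dot_square_norm power2_eq_square)
    have xe: "x \<bullet> e = 0" "e \<bullet> x = 0" using xu[of b] by (auto simp: e_def inner_commute)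
    have R: "R b s = plane_rotation x e (\<rho> * s)" for s using False by (simp add: R_def e_def \<rho>_def)
    have A: "A b y = \<rho> *\<^sub>R ((e \<bullet> y) *\<^sub>R x - (x \<bullet> y) *\<^sub>R e)" for y by (simp add: A_def ub algebra_simps)
    note orth = orthogonal_plane_rotation[OF xx ee xe(1)]
    have "linear (A b)" unfolding A by (intro linearI) (simp_all add: inner_simps algebra_simps)
    moreover have "((\<lambda>s. z \<bullet> R b s y) has_real_derivative z \<bullet> A b (R b s y)) (at s)" for y z s
    proof -
      have xR: "x \<bullet> R b s y = cos (\<rho> * s) * (x \<bullet> y) + sin (\<rho> * s) * (e \<bullet> y)"
        unfolding R plane_rotation_def by (simp add: inner_simps xx ee xe algebra_simps)
      have eR: "e \<bullet> R b s y = cos (\<rho> * s) * (e \<bullet> y) - sin (\<rho> * s) * (x \<bullet> y)"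
        unfolding R plane_rotation_def by (simp add: inner_simps xx ee xe algebra_simps)
      show ?thesis unfolding A xR eR unfolding R plane_rotation_def
        by (auto intro!: derivative_eq_intros simp: inner_simps algebra_simps)
    qed
    ultimately show ?thesis unfolding flow_def
      using orth orthogonal_image_sphere[OF orth] by (auto simp: R plane_rotation_def)
  qed
  have ex: "(\<Sum>b\<in>Basis. (b \<bullet> v) * (b \<bullet> w)) = v \<bullet> w" for v w :: 'a
    by (subst (3) euclidean_inner) (simp add: inner_commute)
  show ?thesis
  proof (rule green_formula[OF finite_Basis fl])
    fix y w :: 'a assume "y \<in> sphere 0 1"
    hence yy: "y \<bullet> y = 1" by (simp add: norm_eq_1)
    have "(\<Sum>b\<in>Basis. b \<bullet> A b y) = (\<Sum>b\<in>Basis. (b \<bullet> y) * (b \<bullet> x) - (x \<bullet> y) * (b \<bullet> b))"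
      unfolding A_def u_def by (intro sum.cong refl) (simp add: inner_simps inner_commute algebra_simps)
    also have "... = - (real d) * (x \<bullet> y)"
      by (simp add: sum_subtractf ex dim inner_commute algebra_simps flip: sum_distrib_left)
    finally show "(\<Sum>b\<in>Basis. b \<bullet> A b y) = - (real d - (real d + real d) / 2 * zon x y)" by (simp add: zon_def algebra_simps)
    have "(\<Sum>b\<in>Basis. (b \<bullet> y) * (w \<bullet> A b y)) = (\<Sum>b\<in>Basis. (w \<bullet> x) * ((b \<bullet> y) * (b \<bullet> y)) - (x \<bullet> y) * ((b \<bullet> y) * (b \<bullet> w)))"
      unfolding A_def u_def by (intro sum.cong refl) (simp add: inner_simps inner_commute algebra_simps)
    also have "... = x \<bullet> w - (x \<bullet> y) * (w \<bullet> y)"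
      by (simp add: sum_subtractf ex yy inner_commute flip: sum_distrib_left)
    finally show "(\<Sum>b\<in>Basis. (b \<bullet> y) * (w \<bullet> A b y)) = x \<bullet> w - (x \<bullet> y) * (w \<bullet> y)" .
    show "1 * (x \<bullet> x - (x \<bullet> y) * (x \<bullet> y)) = zon x y * (2 - zon x y)" by (simp add: zon_def xx algebra_simps)
  qed
qed

text \<open>The inner product of the two gradients in \<open>sphere_jacobi_op\<close> is symmetric
  in \<open>x\<close> and \<open>z\<close>.\<close>

lemma sphere_jacobi_op_symmetric:
  assumes "x \<in> sphere 0 1" "z \<in> sphere 0 1"
  shows "(\<integral>y. poly (jacobi_op d d f) (zon x y) * poly g (zon z y) \<partial>\<mu>) = (\<integral>y. poly f (zon x y) * poly (jacobi_op d d g) (zon z y) \<partial>\<mu>)"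
proof -
  have "(\<integral>y. poly (jacobi_op d d f) (zon x y) * poly g (zon z y) \<partial>\<mu>) = (\<integral>y. poly (jacobi_op d d g) (zon z y) * poly f (zon x y) \<partial>\<mu>)"
    unfolding sphere_jacobi_op[OF assms(1)] sphere_jacobi_op[OF assms(2)] by (simp add: mult_ac inner_commute)
  thus ?thesis by (simp add: mult.commute)
qed

end

section \<open>Octonions and rotations of Hermitian matrices\<close>

lemmas oct_defs = oct_mult_def oct_conj_def quat_mult_def quat_conj_def oct_one_def

lemma inner_left_eqI: "(\<And>z. inner z x = inner z y) \<Longrightarrow> x = (y::'a::real_inner)"
  by (metis inner_commute vector_eq_rdot)

lemma oct_eq_iff: "(x::oct) = y \<longleftrightarrow>
   Re (fst (fst x)) = Re (fst (fst y)) \<and> Im (fst (fst x)) = Im (fst (fst y)) \<and>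
   Re (snd (fst x)) = Re (snd (fst y)) \<and> Im (snd (fst x)) = Im (snd (fst y)) \<and>
   Re (fst (snd x)) = Re (fst (snd y)) \<and> Im (fst (snd x)) = Im (fst (snd y)) \<and>
   Re (snd (snd x)) = Re (snd (snd y)) \<and> Im (snd (snd x)) = Im (snd (snd y))"
  by (auto simp: prod_eq_iff complex_eq_iff)

lemma inner_oct: "inner (x::oct) y =
   Re (fst (fst x)) * Re (fst (fst y)) + Im (fst (fst x)) * Im (fst (fst y)) +
   Re (snd (fst x)) * Re (snd (fst y)) + Im (snd (fst x)) * Im (snd (fst y)) +
   Re (fst (snd x)) * Re (fst (snd y)) + Im (fst (snd x)) * Im (fst (snd y)) +
   Re (snd (snd x)) * Re (snd (snd y)) + Im (snd (snd x)) * Im (snd (snd y))"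
  by (simp add: inner_prod_def inner_complex_def)

interpretation oct_mult: bounded_bilinear oct_mult
proof
  fix a a' b b' :: oct and r :: real
  show "oct_mult (a + a') b = oct_mult a b + oct_mult a' b"
    by (simp add: oct_eq_iff oct_defs algebra_simps)
  show "oct_mult a (b + b') = oct_mult a b + oct_mult a b'"
    by (simp add: oct_eq_iff oct_defs algebra_simps)
  show "oct_mult (r *\<^sub>R a) b = r *\<^sub>R oct_mult a b"
    by (simp add: oct_eq_iff oct_defs algebra_simps)
  show "oct_mult a (r *\<^sub>R b) = r *\<^sub>R oct_mult a b"
    by (simp add: oct_eq_iff oct_defs algebra_simps)
  show "\<exists>K. \<forall>a b. norm (oct_mult a b) \<le> norm a * norm b * K"
    by (intro exI[of _ 1]) (simp add: norm_oct_mult)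
qed

lemma oct_conj_add [simp]: "oct_conj (x + y) = oct_conj x + oct_conj y"
  and oct_conj_diff [simp]: "oct_conj (x - y) = oct_conj x - oct_conj y"
  and oct_conj_minus [simp]: "oct_conj (- x) = - oct_conj x"
  and oct_conj_scaleR [simp]: "oct_conj (r *\<^sub>R x) = r *\<^sub>R oct_conj x"
  and oct_conj_zero [simp]: "oct_conj 0 = 0"
  and oct_conj_one [simp]: "oct_conj oct_one = oct_one"
  and oct_conj_conj [simp]: "oct_conj (oct_conj x) = x"
  and oct_conj_mult [simp]: "oct_conj (oct_mult x y) = oct_mult (oct_conj y) (oct_conj x)"
  by (simp_all add: oct_eq_iff oct_defs algebra_simps)

lemma oct_conj_sum [simp]: "oct_conj (sum f S) = (\<Sum>i\<in>S. oct_conj (f i))"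
  by (induction S rule: infinite_finite_induct) auto

lemma oct_mult_one [simp]: "oct_mult oct_one x = x" "oct_mult x oct_one = x"
  by (simp_all add: oct_eq_iff oct_defs)

lemma inner_oct_conj [simp]: "inner (oct_conj x) (oct_conj y) = inner x y"
  by (simp add: inner_oct oct_defs)

lemma norm_oct_conj [simp]: "norm (oct_conj x) = norm x"
  by (simp add: norm_eq_sqrt_inner)

lemma oct_conj_eq_self: "oct_conj x = x \<longleftrightarrow> x = inner oct_one x *\<^sub>R oct_one"
  by (auto simp: oct_eq_iff oct_defs inner_oct)

lemma inner_oct_mult_left: "inner (oct_mult x y) z = inner y (oct_mult (oct_conj x) z)"
  by (simp add: inner_oct oct_defs algebra_simps)

lemma inner_oct_mult_right: "inner (oct_mult x y) z = inner x (oct_mult z (oct_conj y))"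
  by (simp add: inner_oct oct_defs algebra_simps)

lemma inner_one_one [simp]: "inner oct_one oct_one = 1"
  by (simp add: inner_oct oct_defs)

lemma norm_oct_one [simp]: "norm oct_one = 1"
  by (simp add: norm_eq_sqrt_inner)

text \<open>The composition law \<open>|a b| = |a| |b|\<close>, polarised in both factors and read
  through the adjoint of left multiplication. For \<open>u = v\<close> it lets \<open>u\<close>
  cancel against its conjugate without associativity.\<close>

lemma oct_alternative: "oct_mult u (oct_mult (oct_conj v) x) + oct_mult v (oct_mult (oct_conj u) x) = (2 * inner u v) *\<^sub>R x"
proof (rule inner_left_eqI)
  fix z
  have sq: "(norm (oct_mult (oct_conj a) b))\<^sup>2 = (norm a)\<^sup>2 * (norm b)\<^sup>2" for a b by (simp add: norm_oct_mult power_mult_distrib)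
  have 1: "inner (oct_mult (oct_conj a) b) (oct_mult (oct_conj a) c) = inner a a * inner b c" for a b c
  proof -
    have "2 * inner (oct_mult (oct_conj a) b) (oct_mult (oct_conj a) c)
      = (norm (oct_mult (oct_conj a) (b + c)))\<^sup>2 - (norm (oct_mult (oct_conj a) b))\<^sup>2 - (norm (oct_mult (oct_conj a) c))\<^sup>2"
      unfolding oct_mult.add_right by (simp add: power2_norm_eq_inner inner_simps inner_commute)
    also have "... = 2 * (inner a a * inner b c)" unfolding sq by (simp add: power2_norm_eq_inner inner_simps inner_commute algebra_simps)
    finally show ?thesis by simp
  qed
  have "inner (oct_mult (oct_conj (u + v)) z) (oct_mult (oct_conj (u + v)) x)
     = inner (oct_mult (oct_conj u) z) (oct_mult (oct_conj u) x) + inner (oct_mult (oct_conj v) z) (oct_mult (oct_conj v) x)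
     + (inner (oct_mult (oct_conj u) z) (oct_mult (oct_conj v) x) + inner (oct_mult (oct_conj v) z) (oct_mult (oct_conj u) x))"
    by (simp add: oct_mult.add_left inner_simps)
  hence "inner (oct_mult (oct_conj u) z) (oct_mult (oct_conj v) x) + inner (oct_mult (oct_conj v) z) (oct_mult (oct_conj u) x) = 2 * inner u v * inner z x"
    unfolding 1 by (simp add: inner_simps inner_commute algebra_simps)
  thus "inner z (oct_mult u (oct_mult (oct_conj v) x) + oct_mult v (oct_mult (oct_conj u) x)) = inner z ((2 * inner u v) *\<^sub>R x)"
    by (simp add: inner_simps inner_oct_mult_left)
qed

lemma oct_alternative': "oct_mult (oct_mult x (oct_conj v)) u + oct_mult (oct_mult x (oct_conj u)) v = (2 * inner u v) *\<^sub>R x"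
  using arg_cong[OF oct_alternative[of "oct_conj u" "oct_conj v" "oct_conj x"], of oct_conj] by simp

lemma oct_mult_conj_cancel:
  "oct_mult u (oct_mult (oct_conj u) x) = inner u u *\<^sub>R x" "oct_mult (oct_conj u) (oct_mult u x) = inner u u *\<^sub>R x"
  "oct_mult (oct_mult x (oct_conj u)) u = inner u u *\<^sub>R x" "oct_mult (oct_mult x u) (oct_conj u) = inner u u *\<^sub>R x"
proof -
  have h: "a + a = (2 * r) *\<^sub>R y \<Longrightarrow> a = r *\<^sub>R y" for a y :: oct and r
  proof -
    assume "a + a = (2 * r) *\<^sub>R y"
    hence "2 *\<^sub>R a = 2 *\<^sub>R (r *\<^sub>R y)" by (simp only: scaleR_2[symmetric] scaleR_scaleR)
    thus ?thesis by (simp only: scaleR_cancel_left) simp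
  qed
  show "oct_mult u (oct_mult (oct_conj u) x) = inner u u *\<^sub>R x" "oct_mult (oct_mult x (oct_conj u)) u = inner u u *\<^sub>R x" for u
    using oct_alternative[of u u x] oct_alternative'[of x u u] by (auto intro: h)
  from this[of "oct_conj u"] show "oct_mult (oct_conj u) (oct_mult u x) = inner u u *\<^sub>R x" "oct_mult (oct_mult x u) (oct_conj u) = inner u u *\<^sub>R x"
    by simp_all
qed

lemma oct_mult_self_conj: "oct_mult x (oct_conj x) = inner x x *\<^sub>R oct_one" "oct_mult (oct_conj x) x = inner x x *\<^sub>R oct_one"
  using oct_mult_conj_cancel(1,2)[of x oct_one] by simp_all

lemma oct_mult_conj_polar: "oct_mult u (oct_conj v) + oct_mult v (oct_conj u) = (2 * inner u v) *\<^sub>R oct_one"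
  using oct_alternative[of u v oct_one] by simp

text \<open>The middle Moufang identity \<open>(u x) (v u) = u (x v) u\<close> for \<open>v\<close>
  the conjugate of \<open>y\<close>, with the right side expanded so that no bracketing remains.
  Pairing with \<open>z\<close> reduces it to \<open>oct_alternative\<close>.\<close>

lemma oct_moufang:
  "oct_mult (oct_mult u x) (oct_mult (oct_conj y) u) = (2 * inner u (oct_mult y (oct_conj x))) *\<^sub>R u - inner u u *\<^sub>R oct_mult y (oct_conj x)"
proof (rule inner_left_eqI)
  fix z
  have mm: "inner (oct_mult u a) (oct_mult u b) = inner u u * inner a b" for a b
    by (simp add: inner_oct_mult_left oct_mult_conj_cancel)
  have "inner z (oct_mult (oct_mult u x) (oct_mult (oct_conj y) u)) = inner (oct_mult u x) (oct_mult z (oct_mult (oct_conj u) y))"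
    by (simp add: inner_commute[of z] inner_oct_mult_right)
  also have "oct_mult z (oct_mult (oct_conj u) y) = (2 * inner u z) *\<^sub>R y - oct_mult u (oct_mult (oct_conj z) y)"
    using oct_alternative[of z u y] by (simp add: algebra_simps inner_commute)
  also have "inner (oct_mult u x) ((2 * inner u z) *\<^sub>R y - oct_mult u (oct_mult (oct_conj z) y))
     = 2 * inner u z * inner u (oct_mult y (oct_conj x)) - inner u u * inner x (oct_mult (oct_conj z) y)"
    unfolding inner_diff_right inner_scaleR_right mm by (simp add: inner_oct_mult_right[of u x y])
  also have "inner x (oct_mult (oct_conj z) y) = inner z (oct_mult y (oct_conj x))"
    by (metis inner_oct_mult_left inner_oct_mult_right)
  finally show "inner z (oct_mult (oct_mult u x) (oct_mult (oct_conj y) u)) =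
    inner z ((2 * inner u (oct_mult y (oct_conj x))) *\<^sub>R u - inner u u *\<^sub>R oct_mult y (oct_conj x))"
    by (simp add: inner_diff_right inner_commute)
qed

text \<open>Moufang's identity with one inner factor equal to 1 gives the same value for both
  bracketings. The versions with a conjugate follow because the conjugate of \<open>u\<close> is a
  real combination of 1 and \<open>u\<close>.\<close>

lemma oct_flexible:
  "oct_mult (oct_mult u x) u = oct_mult u (oct_mult x u)"
  "oct_mult (oct_mult u x) (oct_conj u) = oct_mult u (oct_mult x (oct_conj u))"
  "oct_mult (oct_mult (oct_conj u) x) u = oct_mult (oct_conj u) (oct_mult x u)"
proof -
  have 1: "oct_mult (oct_mult u x) u = (2 * inner u (oct_conj x)) *\<^sub>R u - inner u u *\<^sub>R oct_conj x" for u
    using oct_moufang[of u x oct_one] by simp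
  have 2: "oct_mult u (oct_mult x u) = (2 * inner u (oct_conj x)) *\<^sub>R u - inner u u *\<^sub>R oct_conj x" for u
    using oct_moufang[of u oct_one "oct_conj x"] by simp
  show f: "oct_mult (oct_mult u x) u = oct_mult u (oct_mult x u)" for u unfolding 1 2 ..
  have c: "oct_conj u = (2 * inner oct_one u) *\<^sub>R oct_one - u" for u
    by (simp add: oct_eq_iff oct_defs inner_oct)
  show "oct_mult (oct_mult u x) (oct_conj u) = oct_mult u (oct_mult x (oct_conj u))"
    unfolding c by (simp add: oct_mult.diff_right oct_mult.scaleR_right f)
  show "oct_mult (oct_mult (oct_conj u) x) u = oct_mult (oct_conj u) (oct_mult x u)"
    unfolding c by (simp add: oct_mult.diff_left oct_mult.scaleR_left f)
qed

section \<open>The scalar subalgebras and their units\<close>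

lemma scalars_iff:
  "x \<in> scalars d\<^sub>0 \<longleftrightarrow> (d\<^sub>0 = 1 \<longrightarrow> Im (fst (fst x)) = 0) \<and> (d\<^sub>0 \<in> {1, 2} \<longrightarrow> snd (fst x) = 0) \<and> (d\<^sub>0 \<in> {1, 2, 4} \<longrightarrow> snd x = 0)"
proof -
  have "x \<in> range (\<lambda>a::real. ((complex_of_real a, 0), (0, 0))) \<longleftrightarrow> Im (fst (fst x)) = 0 \<and> snd (fst x) = 0 \<and> snd x = 0"
    by (auto simp: prod_eq_iff complex_eq_iff intro!: image_eqI[of x _ "Re (fst (fst x))"])
  moreover have "x \<in> range (\<lambda>z::complex. ((z, 0), (0, 0))) \<longleftrightarrow> snd (fst x) = 0 \<and> snd x = 0"
    by (auto simp: prod_eq_iff intro!: image_eqI[of x _ "fst (fst x)"])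
  moreover have "x \<in> range (\<lambda>q::quat. (q, (0, 0))) \<longleftrightarrow> snd x = 0"
    by (auto simp: prod_eq_iff intro!: image_eqI[of x _ "fst x"])
  ultimately show ?thesis unfolding scalars_def by auto
qed

lemma scalars_closed [simp]:
  "0 \<in> scalars d\<^sub>0" "oct_one \<in> scalars d\<^sub>0"
  "x \<in> scalars d\<^sub>0 \<Longrightarrow> y \<in> scalars d\<^sub>0 \<Longrightarrow> x + y \<in> scalars d\<^sub>0"
  "x \<in> scalars d\<^sub>0 \<Longrightarrow> y \<in> scalars d\<^sub>0 \<Longrightarrow> x - y \<in> scalars d\<^sub>0"
  "x \<in> scalars d\<^sub>0 \<Longrightarrow> - x \<in> scalars d\<^sub>0"
  "x \<in> scalars d\<^sub>0 \<Longrightarrow> r *\<^sub>R x \<in> scalars d\<^sub>0"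
  "x \<in> scalars d\<^sub>0 \<Longrightarrow> oct_conj x \<in> scalars d\<^sub>0"
  "x \<in> scalars d\<^sub>0 \<Longrightarrow> y \<in> scalars d\<^sub>0 \<Longrightarrow> oct_mult x y \<in> scalars d\<^sub>0"
  by (simp_all add: scalars_iff oct_defs flip: zero_prod_def)

lemma scalars_sum [simp]: "(\<And>i. i \<in> S \<Longrightarrow> f i \<in> scalars d\<^sub>0) \<Longrightarrow> sum f S \<in> scalars d\<^sub>0"
  by (induction S rule: infinite_finite_induct) auto

lemma scalars_assoc:
  assumes "d\<^sub>0 \<in> {1, 2, 4}" "x \<in> scalars d\<^sub>0" "y \<in> scalars d\<^sub>0" "z \<in> scalars d\<^sub>0"
  shows "oct_mult (oct_mult x y) z = oct_mult x (oct_mult y z)"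
proof -
  have "snd x = 0" "snd y = 0" "snd z = 0" using assms by (auto simp: scalars_iff)
  thus ?thesis by (simp add: oct_eq_iff oct_defs algebra_simps)
qed

definition units :: "nat \<Rightarrow> oct set" where "units d\<^sub>0 = Basis \<inter> scalars d\<^sub>0"

lemma finite_units [simp]: "finite (units d\<^sub>0)" by (simp add: units_def)

lemma Basis_oct: "(Basis :: oct set) = {((1, 0), 0), ((\<i>, 0), 0), ((0, 1), 0), ((0, \<i>), 0),
   (0, (1, 0)), (0, (\<i>, 0)), (0, (0, 1)), (0, (0, \<i>))}"
  by (simp add: Basis_prod_def Basis_complex_def insert_commute image_Un)

lemma card_units:
  assumes "d\<^sub>0 \<in> {1, 2, 4, 8}" shows "card (units d\<^sub>0) = d\<^sub>0"
proof -
  have "d\<^sub>0 = 1 \<or> d\<^sub>0 = 2 \<or> d\<^sub>0 = 4 \<or> d\<^sub>0 = 8" using assms by auto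
  thus ?thesis
    by (elim disjE) (simp_all add: units_def Basis_oct Int_insert_left scalars_iff prod_eq_iff zero_prod_def[symmetric])
qed

lemma units_expansion:
  assumes "w \<in> scalars d\<^sub>0"
  shows "(\<Sum>u\<in>units d\<^sub>0. inner u w *\<^sub>R u) = w"
proof -
  have "(\<Sum>u\<in>units d\<^sub>0. inner u w *\<^sub>R u) = (\<Sum>u\<in>Basis. inner u w *\<^sub>R u)"
  proof (rule sum.mono_neutral_left)
    show "\<forall>u\<in>Basis - units d\<^sub>0. inner u w *\<^sub>R u = 0"
    proof
      fix u assume "u \<in> Basis - units d\<^sub>0"
      hence u: "u \<in> Basis" "u \<notin> scalars d\<^sub>0" by (auto simp: units_def)
      have "inner u w = 0"
      proof (cases "snd w = 0")
        case True
        show ?thesis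
        proof (cases "snd (fst w) = 0")
          case True
          show ?thesis using u assms True \<open>snd w = 0\<close> unfolding Basis_oct
            by (elim insertE) (simp_all add: scalars_iff inner_oct)
        next
          case False
          hence "d\<^sub>0 \<noteq> 1" "d\<^sub>0 \<noteq> 2" using assms by (auto simp: scalars_iff)
          thus ?thesis using u \<open>snd w = 0\<close> unfolding Basis_oct
            by (elim insertE) (simp_all add: scalars_iff inner_oct)
        qed
      next
        case False
        hence "d\<^sub>0 \<noteq> 1" "d\<^sub>0 \<noteq> 2" "d\<^sub>0 \<noteq> 4" using assms by (auto simp: scalars_iff)
        thus ?thesis using u by (simp add: scalars_iff)
      qed
      thus "inner u w *\<^sub>R u = 0" by simp
    qed
  qed (auto simp: units_def)
  thus ?thesis by (simp add: inner_commute[of _ w] euclidean_representation)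
qed

section \<open>Two-row rotations of Hermitian matrices\<close>

abbreviation oct_times (infixl "\<odot>" 70) where "x \<odot> y \<equiv> oct_mult x y"

type_synonym oct_matrix = "nat \<Rightarrow> nat \<Rightarrow> oct"

text \<open>Left multiplication by the matrix with rows \<open>(c, s u)\<close> and
  \<open>(- s conj u, c)\<close> in the coordinates 0 and \<open>j\<close> and the identity
  elsewhere. Coordinate 0 is singled out because the base point \<open>e0\<close> will be the matrix
  unit there.\<close>

definition row_rotation :: "nat \<Rightarrow> oct \<Rightarrow> real \<Rightarrow> real \<Rightarrow> oct_matrix \<Rightarrow> oct_matrix" where
  "row_rotation j u c s A = (\<lambda>i k. if i = 0 then c *\<^sub>R A 0 k + s *\<^sub>R (u \<odot> A j k)
     else if i = j then c *\<^sub>R A j k - s *\<^sub>R (oct_conj u \<odot> A 0 k) else A i k)"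

definition col_rotation :: "nat \<Rightarrow> oct \<Rightarrow> real \<Rightarrow> real \<Rightarrow> oct_matrix \<Rightarrow> oct_matrix" where
  "col_rotation j u c s A = (\<lambda>i k. if k = 0 then c *\<^sub>R A i 0 + s *\<^sub>R (A i j \<odot> oct_conj u)
     else if k = j then c *\<^sub>R A i j - s *\<^sub>R (A i 0 \<odot> u) else A i k)"

text \<open>Conjugation by that matrix. Over the octonions a bracketing has to be fixed, and rows
  come before columns.\<close>

definition rotation :: "nat \<Rightarrow> oct \<Rightarrow> real \<Rightarrow> real \<Rightarrow> oct_matrix \<Rightarrow> oct_matrix" where
  "rotation j u c s A = col_rotation j u c s (row_rotation j u c s A)"

text \<open>The derivative of \<open>rotation\<close> at angle 0: the commutator with the
  skew-Hermitian matrix that has \<open>u\<close> at position \<open>(0, j)\<close> and minus its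
  conjugate at \<open>(j, 0)\<close>.\<close>

definition commutator :: "nat \<Rightarrow> oct \<Rightarrow> oct_matrix \<Rightarrow> oct_matrix" where
  "commutator j u A = (\<lambda>i k. (if i = 0 then u \<odot> A j k else 0) - (if i = j then oct_conj u \<odot> A 0 k else 0)
     - (if k = j then A i 0 \<odot> u else 0) + (if k = 0 then A i j \<odot> oct_conj u else 0))"

text \<open>The infinitesimal form of the group law: at every angle the derivative is the commutator
  with the rotated matrix. Flexibility and cancellation of \<open>u\<close> suffice in each of the
  nine index cases.\<close>

lemma rotation_deriv:
  assumes j: "j \<noteq> 0" and u: "inner u u = 1"
  shows "((\<lambda>t. inner w (rotation j u (cos t) (sin t) A i k)) has_real_derivative
     inner w (commutator j u (rotation j u (cos t) (sin t) A) i k)) (at t)"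
proof -
  note f = oct_flexible oct_mult_conj_cancel u
  consider "i = 0" | "i = j" | "i \<noteq> 0 \<and> i \<noteq> j" by blast
  thus ?thesis
  proof cases
    case 1
    consider "k = 0" | "k = j" | "k \<noteq> 0 \<and> k \<noteq> j" by blast
    thus ?thesis using 1 j
      by cases (auto simp: rotation_def row_rotation_def col_rotation_def commutator_def oct_mult.add_left oct_mult.add_right oct_mult.diff_left oct_mult.diff_right
        oct_mult.scaleR_left oct_mult.scaleR_right f inner_simps algebra_simps intro!: derivative_eq_intros)
  next
    case 2
    consider "k = 0" | "k = j" | "k \<noteq> 0 \<and> k \<noteq> j" by blast
    thus ?thesis using 2 j
      by cases (auto simp: rotation_def row_rotation_def col_rotation_def commutator_def oct_mult.add_left oct_mult.add_right oct_mult.diff_left oct_mult.diff_right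
        oct_mult.scaleR_left oct_mult.scaleR_right f inner_simps algebra_simps intro!: derivative_eq_intros)
  next
    case 3
    consider "k = 0" | "k = j" | "k \<noteq> 0 \<and> k \<noteq> j" by blast
    thus ?thesis using 3 j
      by cases (auto simp: rotation_def row_rotation_def col_rotation_def commutator_def oct_mult.add_left oct_mult.add_right oct_mult.diff_left oct_mult.diff_right
        oct_mult.scaleR_left oct_mult.scaleR_right f inner_simps algebra_simps intro!: derivative_eq_intros)
  qed
qed

definition oct_hermitian :: "oct_matrix \<Rightarrow> bool" where
  "oct_hermitian A \<longleftrightarrow> (\<forall>i k. A k i = oct_conj (A i k))"

definition diag :: "oct_matrix \<Rightarrow> nat \<Rightarrow> real" where
  "diag A i = inner oct_one (A i i)"

lemma hermitian_diag: "oct_hermitian A \<Longrightarrow> A i i = diag A i *\<^sub>R oct_one"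
  unfolding oct_hermitian_def diag_def using oct_conj_eq_self by metis

lemma hermitian_conj: "oct_hermitian A \<Longrightarrow> A k i = oct_conj (A i k)"
  unfolding oct_hermitian_def by blast

lemma rotation_0:  "j \<noteq> 0 \<Longrightarrow> rotation j u 1 0 A = A"
  by (auto simp: rotation_def row_rotation_def col_rotation_def fun_eq_iff)

locale octonion_rotation =
  fixes j :: nat and u :: oct and c s :: real
  assumes j: "j \<noteq> 0" and u: "inner u u = 1" and cs: "c * c + s * s = 1"
begin

lemma ss: "s * s = 1 - c * c" using cs by simp

text \<open>Inside the block \<open>{0, j}\<close> the triple products are \<open>u\<close>, the
  conjugate of \<open>w\<close>, \<open>u\<close>, or the conjugate of this pattern, and Moufang's
  identity evaluates them. The new entries therefore involve \<open>w\<close> only linearly and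
  through the real number \<open>h\<close>.\<close>

lemma rotation_entries:
  assumes A: "oct_hermitian A"
  defines "a \<equiv> diag A 0" and "b \<equiv> diag A j" and "w \<equiv> A 0 j"
  defines "h \<equiv> inner u w"
  shows "rotation j u c s A 0 0 = (c * c * a + s * s * b + 2 * c * s * h) *\<^sub>R oct_one" (is ?g1)
    and "rotation j u c s A j j = (s * s * a + c * c * b - 2 * c * s * h) *\<^sub>R oct_one" (is ?g2)
    and "rotation j u c s A 0 j = w + (c * s * (b - a) - 2 * s * s * h) *\<^sub>R u" (is ?g3)
    and "rotation j u c s A j 0 = oct_conj w + (c * s * (b - a) - 2 * s * s * h) *\<^sub>R oct_conj u" (is ?g4)
    and "k \<noteq> 0 \<Longrightarrow> k \<noteq> j \<Longrightarrow> rotation j u c s A 0 k = c *\<^sub>R A 0 k + s *\<^sub>R (u \<odot> A j k)"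
    and "k \<noteq> 0 \<Longrightarrow> k \<noteq> j \<Longrightarrow> rotation j u c s A j k = c *\<^sub>R A j k - s *\<^sub>R (oct_conj u \<odot> A 0 k)"
    and "k \<noteq> 0 \<Longrightarrow> k \<noteq> j \<Longrightarrow> rotation j u c s A k 0 = oct_conj (c *\<^sub>R A 0 k + s *\<^sub>R (u \<odot> A j k))"
    and "k \<noteq> 0 \<Longrightarrow> k \<noteq> j \<Longrightarrow> rotation j u c s A k j = oct_conj (c *\<^sub>R A j k - s *\<^sub>R (oct_conj u \<odot> A 0 k))"
    and "k \<noteq> 0 \<Longrightarrow> k \<noteq> j \<Longrightarrow> l \<noteq> 0 \<Longrightarrow> l \<noteq> j \<Longrightarrow> rotation j u c s A k l = A k l"
proof -
  have A00: "A 0 0 = a *\<^sub>R oct_one" "A j j = b *\<^sub>R oct_one" "A j 0 = oct_conj w" "A 0 j = w"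
    using hermitian_diag[OF A, of 0] hermitian_diag[OF A, of j] hermitian_conj[OF A, of j 0] unfolding a_def b_def w_def by auto
  have p: "u \<odot> oct_conj w = (2 * h) *\<^sub>R oct_one - w \<odot> oct_conj u"
    using oct_mult_conj_polar[of u w] by (simp add: h_def algebra_simps)
  have q: "oct_conj u \<odot> w = (2 * h) *\<^sub>R oct_one - oct_conj w \<odot> u"
    using oct_mult_conj_polar[of "oct_conj u" "oct_conj w"] by (simp add: h_def algebra_simps)
  have m: "u \<odot> (oct_conj w \<odot> u) = (2 * h) *\<^sub>R u - w"
    using oct_moufang[of u oct_one w] u by (simp add: h_def)
  have m': "oct_conj u \<odot> (w \<odot> oct_conj u) = (2 * h) *\<^sub>R oct_conj u - oct_conj w"
    using oct_moufang[of "oct_conj u" oct_one "oct_conj w"] u by (simp add: h_def)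
  note d = rotation_def row_rotation_def col_rotation_def
  note bil = oct_mult.add_left oct_mult.add_right oct_mult.diff_left oct_mult.diff_right oct_mult.scaleR_left oct_mult.scaleR_right
  note f = oct_flexible oct_mult_conj_cancel oct_mult_self_conj
  note al = scaleR_add_left scaleR_add_right scaleR_diff_left scaleR_diff_right
  show ?g1 using j by (simp add: d A00 bil f u p al algebra_simps)
  show ?g2 using j by (simp add: d A00 bil f u q al algebra_simps)
  show ?g3 using j by (simp add: d A00 bil f u m al algebra_simps)
      (simp add: ss algebra_simps flip: mult.assoc scaleR_add_left)
  show ?g4 using j by (simp add: d A00 bil f u m' al algebra_simps)
      (simp add: ss algebra_simps flip: mult.assoc scaleR_add_left)
  assume k: "k \<noteq> 0" "k \<noteq> j"
  show "rotation j u c s A 0 k = c *\<^sub>R A 0 k + s *\<^sub>R (u \<odot> A j k)"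
    "rotation j u c s A j k = c *\<^sub>R A j k - s *\<^sub>R (oct_conj u \<odot> A 0 k)"
    using k j by (auto simp: d)
  show "rotation j u c s A k 0 = oct_conj (c *\<^sub>R A 0 k + s *\<^sub>R (u \<odot> A j k))"
    "rotation j u c s A k j = oct_conj (c *\<^sub>R A j k - s *\<^sub>R (oct_conj u \<odot> A 0 k))"
    using k j by (simp_all add: d hermitian_conj[OF A, of k 0] hermitian_conj[OF A, of k j])
  show "l \<noteq> 0 \<Longrightarrow> l \<noteq> j \<Longrightarrow> rotation j u c s A k l = A k l" using k by (auto simp: d)
qed

end

abbreviation mat_square :: "nat \<Rightarrow> oct_matrix \<Rightarrow> oct_matrix" where
  "mat_square n A \<equiv> mat_mult n A A"

lemma oct_hermitian_square: "oct_hermitian A \<Longrightarrow> oct_hermitian (mat_square n A)"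
  unfolding oct_hermitian_def mat_mult_def by (metis (no_types, lifting) oct_conj_mult oct_conj_sum sum.cong)

lemma diag_square:
  assumes "oct_hermitian A" shows "diag (mat_square n A) i = (\<Sum>m\<le>n. inner (A i m) (A i m))"
proof -
  have "A i m \<odot> A m i = inner (A i m) (A i m) *\<^sub>R oct_one" for m
    unfolding hermitian_conj[OF assms, of m i] by (rule oct_mult_self_conj)
  thus ?thesis by (simp add: diag_def mat_mult_def inner_sum_right)
qed

context octonion_rotation
begin

lemma rotation_hermitian:
  assumes A: "oct_hermitian A" shows "oct_hermitian (rotation j u c s A)"
  unfolding oct_hermitian_def
proof (intro allI)
  fix i k
  note E = rotation_entries[OF A]
  consider "i = 0" | "i = j" | "i \<noteq> 0 \<and> i \<noteq> j" by blast
  thus "rotation j u c s A k i = oct_conj (rotation j u c s A i k)"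
  proof cases
    case 1
    consider "k = 0" | "k = j" | "k \<noteq> 0 \<and> k \<noteq> j" by blast
    thus ?thesis using 1 by cases (simp_all add: E)
  next
    case 2
    consider "k = 0" | "k = j" | "k \<noteq> 0 \<and> k \<noteq> j" by blast
    thus ?thesis using 2 by cases (simp_all add: E)
  next
    case 3
    consider "k = 0" | "k = j" | "k \<noteq> 0 \<and> k \<noteq> j" by blast
    thus ?thesis using 3 by cases (simp_all add: E hermitian_conj[OF A, of k i])
  qed
qed

text \<open>The composition law and Moufang's identity settle the entries of the block.
  Associativity is called for only where an entry with both indices outside the block takes part or
  is computed. In the octonionic case \<open>n = 2\<close>, so only one such index exists within the
  matrix, and the entries in question are real or zero; this is how the restriction to the
  octonionic plane enters.\<close>

lemma rotation_square:
  assumes A: "A \<in> hermitian n d\<^sub>0" and jn: "j \<le> n" and uK: "u \<in> scalars d\<^sub>0" and K: "n = 2 \<or> d\<^sub>0 \<in> {1, 2, 4}"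
  shows "mat_square n (rotation j u c s A) = rotation j u c s (mat_square n A)"
proof -
  have Ah: "oct_hermitian A" and AK: "\<And>i k. A i k \<in> scalars d\<^sub>0" and A0: "\<And>i k. n < i \<or> n < k \<Longrightarrow> A i k = 0"
    using A unfolding hermitian_def oct_hermitian_def by blast+
  let ?B = "rotation j u c s A"
  let ?S = "mat_square n A"
  define S where "S = {..n} - {0, j}"
  have split: "(\<Sum>m\<le>n. f m) = f 0 + f j + (\<Sum>m\<in>S. f m)" for f :: "nat \<Rightarrow> 'b::ab_group_add"
  proof -
    have "{..n} = insert 0 (insert j S)" using jn by (auto simp: S_def)
    moreover have "finite S" "0 \<notin> S" "j \<notin> S" by (auto simp: S_def)
    ultimately show ?thesis using j by (simp add: add.assoc)
  qed
  note Bh = rotation_hermitian[OF Ah]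
  note Sh = oct_hermitian_square[OF Ah, of n]
  note E = rotation_entries[OF Ah]
  note ES = rotation_entries[OF Sh]
  note bil = oct_mult.add_left oct_mult.add_right oct_mult.diff_left oct_mult.diff_right oct_mult.scaleR_left oct_mult.scaleR_right
  define a b w h where "a = diag A 0" and "b = diag A j" and "w = A 0 j" and "h = inner u w"
  note E = E[folded a_def b_def w_def, folded h_def]
  have e: "A 0 0 = a *\<^sub>R oct_one" "A j j = b *\<^sub>R oct_one" "A j 0 = oct_conj w" "A 0 j = w"
    using hermitian_diag[OF Ah, of 0] hermitian_diag[OF Ah, of j] hermitian_conj[OF Ah, of j 0] unfolding a_def b_def w_def by auto
  define p q where "p k = A 0 k" and "q k = A j k" for k
  have pq: "A k 0 = oct_conj (p k)" "A k j = oct_conj (q k)" "A 0 k = p k" "A j k = q k" for k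
    using hermitian_conj[OF Ah, of k 0] hermitian_conj[OF Ah, of k j] by (auto simp: p_def q_def)
  have pe: "p 0 = a *\<^sub>R oct_one" "p j = w" "q 0 = oct_conj w" "q j = b *\<^sub>R oct_one"
    by (simp_all add: p_def q_def e)
  have pqK: "p k \<in> scalars d\<^sub>0" "q k \<in> scalars d\<^sub>0" for k using AK by (auto simp: p_def q_def)
  have assoc1: "(x \<odot> y) \<odot> A m k = x \<odot> (y \<odot> A m k)" if "m \<in> S" "k \<noteq> 0" "k \<noteq> j" "x \<in> scalars d\<^sub>0" "y \<in> scalars d\<^sub>0" for m k x y
  proof (cases "d\<^sub>0 \<in> {1, 2, 4}")
    case True thus ?thesis using that AK by (intro scalars_assoc)
  next
    case False
    hence n: "n = 2" using K by simp
    show ?thesis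
    proof (cases "k > n")
      case True thus ?thesis using A0[of m k] by (simp add: oct_mult.zero_right)
    next
      case False
      hence "k = m" using that n jn j by (auto simp: S_def)
      thus ?thesis using hermitian_diag[OF Ah, of m] by (simp add: bil)
    qed
  qed
  have cs2: "c\<^sup>2 + s\<^sup>2 = 1" using cs by (simp add: power2_eq_square)
  have S00: "diag ?S 0 = a * a + inner w w + (\<Sum>m\<in>S. inner (p m) (p m))"
    unfolding diag_square[OF Ah] split by (simp add: e pq pe)
  have Sjj: "diag ?S j = inner w w + b * b + (\<Sum>m\<in>S. inner (q m) (q m))"
    unfolding diag_square[OF Ah] split by (simp add: e pq pe)
  have S0j: "?S 0 j = (a + b) *\<^sub>R w + (\<Sum>m\<in>S. p m \<odot> oct_conj (q m))"
    unfolding mat_mult_def split by (simp add: e pq pe bil algebra_simps)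
  have S0k: "?S 0 k = a *\<^sub>R p k + w \<odot> q k + (\<Sum>m\<in>S. p m \<odot> A m k)" if "k \<noteq> 0" "k \<noteq> j" for k
    unfolding mat_mult_def split by (simp add: e pq pe bil)
  have Sjk: "?S j k = oct_conj w \<odot> p k + b *\<^sub>R q k + (\<Sum>m\<in>S. q m \<odot> A m k)" if "k \<noteq> 0" "k \<noteq> j" for k
    unfolding mat_mult_def split by (simp add: e pq pe bil)
  have mS: "m \<noteq> 0 \<and> m \<noteq> j" if "m \<in> S" for m using that by (auto simp: S_def)
  define a' b' g where "a' = c * c * a + s * s * b + 2 * c * s * h" and "b' = s * s * a + c * c * b - 2 * c * s * h"
    and "g = c * s * (b - a) - 2 * s * s * h"
  define p' q' where "p' k = c *\<^sub>R p k + s *\<^sub>R (u \<odot> q k)" and "q' k = c *\<^sub>R q k - s *\<^sub>R (oct_conj u \<odot> p k)" for k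
  have B: "?B 0 0 = a' *\<^sub>R oct_one" "?B j j = b' *\<^sub>R oct_one" "?B 0 j = w + g *\<^sub>R u" "?B j 0 = oct_conj (w + g *\<^sub>R u)"
    using E(1-4) by (auto simp: a'_def b'_def g_def)
  have Bk: "?B 0 k = p' k" "?B j k = q' k" "?B k 0 = oct_conj (p' k)" "?B k j = oct_conj (q' k)" if "k \<noteq> 0" "k \<noteq> j" for k
    using E(5-8)[OF that] by (simp_all add: p'_def q'_def pq)
  have ui: "inner (u \<odot> x) (u \<odot> y) = inner x y" "inner (oct_conj u \<odot> x) (oct_conj u \<odot> y) = inner x y" for x y
    by (simp_all add: inner_oct_mult_left oct_mult_conj_cancel u)
  have uqp: "inner (u \<odot> x) y = inner x (oct_conj u \<odot> y)" for x y by (rule inner_oct_mult_left)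
  have np: "inner (p' m) (p' m) = c * c * inner (p m) (p m) + s * s * inner (q m) (q m) + 2 * c * s * inner u (p m \<odot> oct_conj (q m))" for m
  proof -
    have 1: "inner u (p m \<odot> oct_conj (q m)) = inner (u \<odot> q m) (p m)" by (simp add: inner_oct_mult_right)
    have "inner (p' m) (p' m) = c * c * inner (p m) (p m) + s * s * inner (u \<odot> q m) (u \<odot> q m) + 2 * c * s * inner (u \<odot> q m) (p m)"
      unfolding p'_def by (simp add: inner_add_left inner_add_right inner_commute[of "p m" "u \<odot> q m"] algebra_simps)
    thus ?thesis unfolding ui 1 .
  qed
  have nq: "inner (q' m) (q' m) = c * c * inner (q m) (q m) + s * s * inner (p m) (p m) - 2 * c * s * inner u (p m \<odot> oct_conj (q m))" for m
  proof -
    have 1: "inner u (p m \<odot> oct_conj (q m)) = inner (q m) (oct_conj u \<odot> p m)" by (simp add: inner_oct_mult_right uqp flip: uqp)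
    have "inner (q' m) (q' m) = c * c * inner (q m) (q m) + s * s * inner (oct_conj u \<odot> p m) (oct_conj u \<odot> p m) - 2 * c * s * inner (q m) (oct_conj u \<odot> p m)"
      unfolding q'_def by (simp add: inner_diff_left inner_diff_right inner_commute[of "oct_conj u \<odot> p m" "q m"] algebra_simps)
    thus ?thesis unfolding ui 1 .
  qed
  have ww: "inner (w + g *\<^sub>R u) (w + g *\<^sub>R u) = inner w w + 2 * g * h + g * g"
    by (simp add: inner_add_left inner_add_right u h_def inner_commute[of w u] algebra_simps)
  have hS: "inner u (?S 0 j) = (a + b) * h + (\<Sum>m\<in>S. inner u (p m \<odot> oct_conj (q m)))"
    unfolding S0j by (simp add: inner_add_right inner_sum_right h_def)
  have d1: "diag (mat_square n ?B) 0 = c * c * diag ?S 0 + s * s * diag ?S j + 2 * c * s * inner u (?S 0 j)"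
  proof -
    have "diag (mat_square n ?B) 0 = a' * a' + (inner w w + 2 * g * h + g * g) + (\<Sum>m\<in>S. inner (p' m) (p' m))"
      unfolding diag_square[OF Bh] split using mS by (simp add: B Bk ww)
    also have "(\<Sum>m\<in>S. inner (p' m) (p' m)) = c * c * (\<Sum>m\<in>S. inner (p m) (p m)) + s * s * (\<Sum>m\<in>S. inner (q m) (q m)) + 2 * c * s * (\<Sum>m\<in>S. inner u (p m \<odot> oct_conj (q m)))"
      unfolding np by (simp add: sum.distrib sum_distrib_left)
    also have "a' * a' + (inner w w + 2 * g * h + g * g) = c * c * (a * a + inner w w) + s * s * (inner w w + b * b) + 2 * c * s * ((a + b) * h)"
      unfolding a'_def g_def using cs by algebra
    finally show ?thesis unfolding S00 Sjj hS by (simp add: algebra_simps)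
  qed
  have d2: "diag (mat_square n ?B) j = s * s * diag ?S 0 + c * c * diag ?S j - 2 * c * s * inner u (?S 0 j)"
  proof -
    have "diag (mat_square n ?B) j = (inner w w + 2 * g * h + g * g) + b' * b' + (\<Sum>m\<in>S. inner (q' m) (q' m))"
      unfolding diag_square[OF Bh] split using mS by (simp add: B Bk ww del: oct_conj_add)
    also have "(\<Sum>m\<in>S. inner (q' m) (q' m)) = c * c * (\<Sum>m\<in>S. inner (q m) (q m)) + s * s * (\<Sum>m\<in>S. inner (p m) (p m)) - 2 * c * s * (\<Sum>m\<in>S. inner u (p m \<odot> oct_conj (q m)))"
      unfolding nq by (simp add: sum.distrib sum_subtractf sum_distrib_left)
    also have "(inner w w + 2 * g * h + g * g) + b' * b' = s * s * (a * a + inner w w) + c * c * (inner w w + b * b) - 2 * c * s * ((a + b) * h)"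
      unfolding b'_def g_def using cs by algebra
    finally show ?thesis unfolding S00 Sjj hS by (simp add: algebra_simps)
  qed
  have c1: "mat_square n ?B 0 0 = rotation j u c s ?S 0 0" "mat_square n ?B j j = rotation j u c s ?S j j"
    unfolding hermitian_diag[OF oct_hermitian_square[OF Bh]] ES(1,2) d1 d2 by simp_all
  have c2: "mat_square n ?B 0 j = rotation j u c s ?S 0 j"
  proof -
    \<comment> \<open>Moufang's identity puts each product of rotated rows into the shape that
      \<open>rotation_entries\<close> gives for position \<open>(0, j)\<close>, so the sum over
      \<open>m\<close> adds up to the rotated square.\<close>
    have pq': "p' m \<odot> oct_conj (q' m) = p m \<odot> oct_conj (q m) + (c * s * (inner (q m) (q m) - inner (p m) (p m)) - 2 * s * s * inner u (p m \<odot> oct_conj (q m))) *\<^sub>R u" for m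
    proof -
      have m: "(u \<odot> q m) \<odot> (oct_conj (p m) \<odot> u) = (2 * inner u (p m \<odot> oct_conj (q m))) *\<^sub>R u - p m \<odot> oct_conj (q m)"
        using oct_moufang[of u "q m" "p m"] u by simp
      have 1: "p m \<odot> (oct_conj (p m) \<odot> u) = inner (p m) (p m) *\<^sub>R u" "(u \<odot> q m) \<odot> oct_conj (q m) = inner (q m) (q m) *\<^sub>R u"
        by (simp_all add: oct_mult_conj_cancel)
      have "p' m \<odot> oct_conj (q' m) = (c * c + s * s) *\<^sub>R (p m \<odot> oct_conj (q m)) + (c * s * (inner (q m) (q m) - inner (p m) (p m)) - 2 * s * s * inner u (p m \<odot> oct_conj (q m))) *\<^sub>R u"
        unfolding p'_def q'_def by (simp add: bil m 1 algebra_simps)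
      thus ?thesis unfolding cs by simp
    qed
    have ab: "a' + b' = a + b" unfolding a'_def b'_def using cs by algebra
    have "mat_square n ?B 0 j = (a' + b') *\<^sub>R (w + g *\<^sub>R u) + (\<Sum>m\<in>S. p' m \<odot> oct_conj (q' m))"
      unfolding mat_mult_def split using mS by (simp add: B Bk bil algebra_simps)
    also have "... = ?S 0 j + (c * s * (diag ?S j - diag ?S 0) - 2 * s * s * inner u (?S 0 j)) *\<^sub>R u"
      unfolding ab pq' S0j hS[unfolded S0j] S00 Sjj g_def
      by (simp add: sum.distrib sum_subtractf algebra_simps flip: scaleR_sum_left sum_distrib_left)
    finally show ?thesis unfolding ES(3) .
  qed
  have c3: "mat_square n ?B 0 k = rotation j u c s ?S 0 k" "mat_square n ?B j k = rotation j u c s ?S j k" if k: "k \<noteq> 0" "k \<noteq> j" for k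
  proof -
    have Bmk: "?B m k = A m k" if "m \<in> S" for m using E(9) mS[OF that] k by blast
    have wp: "w \<odot> (oct_conj u \<odot> p k) = (2 * h) *\<^sub>R p k - u \<odot> (oct_conj w \<odot> p k)"
      using oct_alternative[of u w "p k"] by (simp add: h_def algebra_simps)
    have wq: "oct_conj w \<odot> (u \<odot> q k) = (2 * h) *\<^sub>R q k - oct_conj u \<odot> (w \<odot> q k)"
      using oct_alternative[of "oct_conj u" "oct_conj w" "q k"] by (simp add: h_def algebra_simps)
    have uu: "u \<odot> (oct_conj u \<odot> x) = x" "oct_conj u \<odot> (u \<odot> x) = x" for x by (simp_all add: oct_mult_conj_cancel u)
    have s1: "(\<Sum>m\<in>S. p' m \<odot> A m k) = c *\<^sub>R (\<Sum>m\<in>S. p m \<odot> A m k) + s *\<^sub>R (u \<odot> (\<Sum>m\<in>S. q m \<odot> A m k))"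
      unfolding p'_def scaleR_sum_right oct_mult.sum_right using assoc1[OF _ k uK pqK(2)] by (simp add: bil sum.distrib scaleR_sum_right)
    have s2: "(\<Sum>m\<in>S. q' m \<odot> A m k) = c *\<^sub>R (\<Sum>m\<in>S. q m \<odot> A m k) - s *\<^sub>R (oct_conj u \<odot> (\<Sum>m\<in>S. p m \<odot> A m k))"
      unfolding q'_def scaleR_sum_right oct_mult.sum_right using assoc1[OF _ k scalars_closed(7)[OF uK] pqK(1)] by (simp add: bil sum_subtractf scaleR_sum_right)
    have r1: "c * a' - s * g - 2 * h * s = c * a" "s * a' + c * g = s * b"
      unfolding a'_def g_def using cs by algebra+
    have r2: "c * g - s * b' = - (s * a)" "c * b' + s * g + 2 * h * s = c * b"
      unfolding b'_def g_def using cs by algebra+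
    have "mat_square n ?B 0 k = a' *\<^sub>R p' k + (w + g *\<^sub>R u) \<odot> q' k + (\<Sum>m\<in>S. p' m \<odot> A m k)"
      unfolding mat_mult_def split using Bmk mS by (simp add: B Bk[OF k] Bk(1) bil)
    also have "a' *\<^sub>R p' k + (w + g *\<^sub>R u) \<odot> q' k = (c * a' - s * g - 2 * h * s) *\<^sub>R p k + (s * a' + c * g) *\<^sub>R (u \<odot> q k) + c *\<^sub>R (w \<odot> q k) + s *\<^sub>R (u \<odot> (oct_conj w \<odot> p k))"
      unfolding p'_def q'_def by (simp add: bil wp uu algebra_simps)
    finally show "mat_square n ?B 0 k = rotation j u c s ?S 0 k"
      unfolding ES(5)[OF k] S0k[OF k] Sjk[OF k] s1 r1 by (simp add: bil algebra_simps)
    have "mat_square n ?B j k = (oct_conj w + g *\<^sub>R oct_conj u) \<odot> p' k + b' *\<^sub>R q' k + (\<Sum>m\<in>S. q' m \<odot> A m k)"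
      unfolding mat_mult_def split using Bmk mS by (simp add: B Bk[OF k] Bk(2) bil)
    also have "(oct_conj w + g *\<^sub>R oct_conj u) \<odot> p' k + b' *\<^sub>R q' k = (c * g - s * b') *\<^sub>R (oct_conj u \<odot> p k) + (c * b' + s * g + 2 * h * s) *\<^sub>R q k + c *\<^sub>R (oct_conj w \<odot> p k) - s *\<^sub>R (oct_conj u \<odot> (w \<odot> q k))"
      unfolding p'_def q'_def by (simp add: bil wq uu algebra_simps)
    finally show "mat_square n ?B j k = rotation j u c s ?S j k"
      unfolding ES(6)[OF k] S0k[OF k] Sjk[OF k] s2 r2 by (simp add: bil algebra_simps)
  qed
  have c4: "mat_square n ?B k l = rotation j u c s ?S k l" if k: "k \<noteq> 0" "k \<noteq> j" and l: "l \<noteq> 0" "l \<noteq> j" for k l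
  proof -
    have "oct_conj (p' k) \<odot> p' l + oct_conj (q' k) \<odot> q' l = oct_conj (p k) \<odot> p l + oct_conj (q k) \<odot> q l"
    proof (cases "k = l")
      case True
      have "inner (p' l) (p' l) + inner (q' l) (q' l) = (c * c + s * s) * (inner (p l) (p l) + inner (q l) (q l))"
        unfolding np nq by (simp add: algebra_simps)
      thus ?thesis unfolding True oct_mult_self_conj cs by (simp flip: scaleR_add_left)
    next
      case False
      show ?thesis
      proof (cases "n < k \<or> n < l")
        case True
        hence "(p k = 0 \<and> q k = 0) \<or> (p l = 0 \<and> q l = 0)" using A0 by (auto simp: p_def q_def)
        thus ?thesis by (auto simp: p'_def q'_def oct_mult.zero_left oct_mult.zero_right)
      next
        \<comment> \<open>Two different indices outside \<open>{0, j}\<close> force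
          \<open>n \<ge> 3\<close>, hence associative scalars.\<close>
        case nlt: False
        hence "n \<noteq> 2" using False k l j jn by auto
        hence d: "d\<^sub>0 \<in> {1, 2, 4}" using K by blast
        have as: "(x \<odot> y) \<odot> z = x \<odot> (y \<odot> z)" if "x \<in> scalars d\<^sub>0" "y \<in> scalars d\<^sub>0" "z \<in> scalars d\<^sub>0" for x y z
          using scalars_assoc[OF d that] .
        have uu: "u \<odot> (oct_conj u \<odot> x) = x" "oct_conj u \<odot> (u \<odot> x) = x" for x by (simp_all add: oct_mult_conj_cancel u)
        have "oct_conj (p' k) \<odot> p' l + oct_conj (q' k) \<odot> q' l = (c * c + s * s) *\<^sub>R (oct_conj (p k) \<odot> p l + oct_conj (q k) \<odot> q l)"
          unfolding p'_def q'_def using uK pqK by (simp add: bil as uu algebra_simps)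
        thus ?thesis unfolding cs by simp
      qed
    qed
    thus ?thesis unfolding ES(9)[OF k l] unfolding mat_mult_def split using mS k l by (simp add: B Bk E(9) pq)
  qed
  show ?thesis
  proof (intro ext)
    fix i k
    note H = hermitian_conj[OF oct_hermitian_square[OF Bh, of n]] hermitian_conj[OF rotation_hermitian[OF Sh]]
    consider "i = 0" | "i = j" | "i \<noteq> 0 \<and> i \<noteq> j" by blast
    thus "mat_square n ?B i k = rotation j u c s ?S i k"
    proof cases
      case 1
      consider "k = 0" | "k = j" | "k \<noteq> 0 \<and> k \<noteq> j" by blast
      thus ?thesis using 1 c1 c2 c3 by cases auto
    next
      case 2
      consider "k = 0" | "k = j" | "k \<noteq> 0 \<and> k \<noteq> j" by blast
      thus ?thesis using 2 c1 c2 c3 H(1)[of j 0] H(2)[of j 0] by cases auto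
    next
      case 3
      consider "k = 0" | "k = j" | "k \<noteq> 0 \<and> k \<noteq> j" by blast
      thus ?thesis using 3 c3[of i] c4[of i k] H(1)[of i k] H(2)[of i k] by cases auto
    qed
  qed
qed

end

section \<open>Projective spaces\<close>

lemma rotation_in_hermitian:
  assumes A: "A \<in> hermitian n d\<^sub>0" and jn: "1 \<le> j" "j \<le> n" and un: "inner u u = 1" "u \<in> scalars d\<^sub>0" and csn: "c * c + s * s = 1"
  shows "rotation j u c s A \<in> hermitian n d\<^sub>0"
proof -
  interpret octonion_rotation j u c s using jn un csn by unfold_locales auto
  have Ah: "oct_hermitian A" and AK: "\<And>i k. A i k \<in> scalars d\<^sub>0" and A0: "\<And>i k. n < i \<or> n < k \<Longrightarrow> A i k = 0"
    using A unfolding hermitian_def oct_hermitian_def by blast+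
  have "rotation j u c s A i k \<in> scalars d\<^sub>0" for i k
    using AK un(2) by (simp add: rotation_def col_rotation_def row_rotation_def)
  moreover have "rotation j u c s A i k = 0" if "n < i \<or> n < k" for i k
    using that A0 jn by (auto simp: rotation_def col_rotation_def row_rotation_def oct_mult.zero_left oct_mult.zero_right)
  ultimately show ?thesis using rotation_hermitian[OF Ah] unfolding hermitian_def oct_hermitian_def by blast
qed

lemma commutator_in_hermitian:
  assumes A: "A \<in> hermitian n d\<^sub>0" and j: "1 \<le> j" "j \<le> n" and u: "u \<in> scalars d\<^sub>0"
  shows "commutator j u A \<in> hermitian n d\<^sub>0"
proof -
  have Ah: "\<And>i k. A k i = oct_conj (A i k)" and AK: "\<And>i k. A i k \<in> scalars d\<^sub>0" and A0: "\<And>i k. n < i \<or> n < k \<Longrightarrow> A i k = 0"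
    using A unfolding hermitian_def oct_hermitian_def by blast+
  have "commutator j u A i k \<in> scalars d\<^sub>0" for i k
    using AK u by (auto simp: commutator_def)
  moreover have "commutator j u A i k = 0" if "n < i \<or> n < k" for i k
    using that A0 j by (auto simp: commutator_def oct_mult.zero_left oct_mult.zero_right)
  moreover have "commutator j u A k i = oct_conj (commutator j u A i k)" for i k
    by (auto simp: commutator_def Ah[symmetric] algebra_simps)
  ultimately show ?thesis unfolding hermitian_def by blast
qed

section \<open>The Jordan structure of the ambient space\<close>

locale hermitian_embedding =
  fixes n d\<^sub>0 :: nat and \<iota> :: "'a::euclidean_space \<Rightarrow> oct_matrix"
  assumes coords: "hermitian_coords n d\<^sub>0 \<iota>" and n2: "2 \<le> n" and K: "d\<^sub>0 \<in> {1, 2, 4} \<or> d\<^sub>0 = 8 \<and> n = 2"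
begin

lemma iota_linear: "linear (\<lambda>x. \<iota> x i k)"
  using coords by (simp add: hermitian_coords_def)

lemma iota_add [simp]: "\<iota> (x + y) i k = \<iota> x i k + \<iota> y i k"
  and iota_scaleR [simp]: "\<iota> (r *\<^sub>R x) i k = r *\<^sub>R \<iota> x i k"
  and iota_diff [simp]: "\<iota> (x - y) i k = \<iota> x i k - \<iota> y i k"
  and iota_zero [simp]: "\<iota> 0 i k = 0"
  and iota_sum [simp]: "\<iota> (sum f I) i k = (\<Sum>m\<in>I. \<iota> (f m) i k)"
  by (rule linear_add[OF iota_linear] linear_scale[OF iota_linear] linear_diff[OF iota_linear] linear_0[OF iota_linear] linear_sum[OF iota_linear])+

lemma iota_hermitian: "\<iota> x \<in> hermitian n d\<^sub>0"
  using coords by (auto simp: hermitian_coords_def bij_betw_def)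

lemma iota_oct_hermitian: "oct_hermitian (\<iota> x)"
  using iota_hermitian[of x] unfolding hermitian_def oct_hermitian_def by blast

lemma iota_conj: "\<iota> x k i = oct_conj (\<iota> x i k)"
  using iota_hermitian[of x] unfolding hermitian_def by blast

lemma iota_scalars: "\<iota> x i k \<in> scalars d\<^sub>0"
  using iota_hermitian[of x] unfolding hermitian_def by blast

lemma iota_outside: "n < i \<or> n < k \<Longrightarrow> \<iota> x i k = 0"
  using iota_hermitian[of x] unfolding hermitian_def by blast

definition lift :: "oct_matrix \<Rightarrow> 'a" where "lift A = inv_into UNIV \<iota> A"

lemma iota_lift: "A \<in> hermitian n d\<^sub>0 \<Longrightarrow> \<iota> (lift A) = A"
  using coords unfolding lift_def hermitian_coords_def bij_betw_def by (metis f_inv_into_f)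

lemma iota_inject: "\<iota> x = \<iota> y \<Longrightarrow> x = y"
  using coords by (auto simp: hermitian_coords_def bij_betw_def inj_def)

lemma iota_eqI: "(\<And>i k. \<iota> x i k = \<iota> y i k) \<Longrightarrow> x = y"
  by (intro iota_inject ext)

lemma inner_iota: "x \<bullet> y = (\<Sum>i\<le>n. \<Sum>k\<le>n. \<iota> x i k \<bullet> \<iota> y i k)"
proof -
  have sq: "(norm x)\<^sup>2 = (\<Sum>i\<le>n. \<Sum>k\<le>n. \<iota> x i k \<bullet> \<iota> x i k)" for x
    using coords by (simp add: hermitian_coords_def dot_square_norm)
  have "2 * (x \<bullet> y) = (norm (x + y))\<^sup>2 - (norm x)\<^sup>2 - (norm y)\<^sup>2"
    by (simp add: power2_norm_eq_inner inner_add_left inner_add_right inner_commute)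
  also have "... = 2 * (\<Sum>i\<le>n. \<Sum>k\<le>n. \<iota> x i k \<bullet> \<iota> y i k)"
    unfolding sq by (simp add: inner_add_left inner_add_right inner_commute sum.distrib sum_distrib_left)
  finally show ?thesis by simp
qed

text \<open>Twice the usual Jordan product, so idempotents satisfy
  \<open>jprod x x = 2 *\<^sub>R x\<close>.\<close>

definition jprod :: "'a \<Rightarrow> 'a \<Rightarrow> 'a" where
  "jprod x y = lift (\<lambda>i k. mat_mult n (\<iota> x) (\<iota> y) i k + mat_mult n (\<iota> y) (\<iota> x) i k)"

lemma iota_jprod: "\<iota> (jprod x y) i k = mat_mult n (\<iota> x) (\<iota> y) i k + mat_mult n (\<iota> y) (\<iota> x) i k"
proof -
  have "(\<lambda>i k. mat_mult n (\<iota> x) (\<iota> y) i k + mat_mult n (\<iota> y) (\<iota> x) i k) \<in> hermitian n d\<^sub>0"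
  proof -
    have m1: "mat_mult n (\<iota> x) (\<iota> y) k i = oct_conj (mat_mult n (\<iota> y) (\<iota> x) i k)" for x y i k
      unfolding mat_mult_def by (simp add: iota_conj[symmetric])
    have m2: "mat_mult n (\<iota> x) (\<iota> y) i k \<in> scalars d\<^sub>0" for x y i k
      unfolding mat_mult_def by (simp add: iota_scalars)
    have m3: "mat_mult n (\<iota> x) (\<iota> y) i k = 0" if "n < i \<or> n < k" for x y i k
      unfolding mat_mult_def using that by (auto intro!: sum.neutral simp: iota_outside oct_mult.zero_left oct_mult.zero_right)
    show ?thesis unfolding hermitian_def mem_Collect_eq
    proof (intro conjI allI impI)
      fix i k
      show "mat_mult n (\<iota> x) (\<iota> y) k i + mat_mult n (\<iota> y) (\<iota> x) k i = oct_conj (mat_mult n (\<iota> x) (\<iota> y) i k + mat_mult n (\<iota> y) (\<iota> x) i k)"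
        unfolding oct_conj_add m1[of x y k i] m1[of y x k i] by (rule add.commute)
    qed (simp_all add: m2 m3)
  qed
  thus ?thesis unfolding jprod_def by (simp add: iota_lift)
qed

lemma jprod_commute: "jprod x y = jprod y x"
  by (rule iota_eqI) (simp add: iota_jprod add.commute)

lemma jprod_add_left: "jprod (x + y) z = jprod x z + jprod y z"
  by (rule iota_eqI) (simp add: iota_jprod mat_mult_def oct_mult.add_left oct_mult.add_right sum.distrib)

lemma jprod_add_right: "jprod z (x + y) = jprod z x + jprod z y"
  using jprod_add_left[of x y z] by (simp add: jprod_commute)

text \<open>Invariance of the trace form. The adjoint rules move one factor at a time across the
  real inner product, so no triple product has to be rebracketed.\<close>

lemma inner_jprod: "z \<bullet> jprod x y = x \<bullet> jprod z y"
proof -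
  have 1: "(\<Sum>i\<le>n. \<Sum>k\<le>n. \<iota> z i k \<bullet> mat_mult n (\<iota> x) (\<iota> y) i k) = (\<Sum>i\<le>n. \<Sum>k\<le>n. \<iota> x i k \<bullet> mat_mult n (\<iota> z) (\<iota> y) i k)" for x z
  proof -
    have e: "\<iota> z i k \<bullet> (\<iota> x i m \<odot> \<iota> y m k) = \<iota> x i m \<bullet> (\<iota> z i k \<odot> \<iota> y k m)" for i k m
      unfolding iota_conj[of y k m] by (subst inner_commute) (rule inner_oct_mult_right)
    show ?thesis unfolding mat_mult_def inner_sum_right e by (rule sum.cong[OF refl sum.swap])
  qed
  have 2: "(\<Sum>i\<le>n. \<Sum>k\<le>n. \<iota> z i k \<bullet> mat_mult n (\<iota> y) (\<iota> x) i k) = (\<Sum>i\<le>n. \<Sum>k\<le>n. \<iota> x i k \<bullet> mat_mult n (\<iota> y) (\<iota> z) i k)" for x z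
  proof -
    have e: "\<iota> z i k \<bullet> (\<iota> y i m \<odot> \<iota> x m k) = \<iota> x m k \<bullet> (\<iota> y m i \<odot> \<iota> z i k)" for i k m
      unfolding iota_conj[of y m i] by (subst inner_commute) (rule inner_oct_mult_left)
    have "(\<Sum>i\<le>n. \<Sum>k\<le>n. \<iota> z i k \<bullet> mat_mult n (\<iota> y) (\<iota> x) i k) = (\<Sum>i\<le>n. \<Sum>k\<le>n. \<Sum>m\<le>n. \<iota> x m k \<bullet> (\<iota> y m i \<odot> \<iota> z i k))"
      unfolding mat_mult_def inner_sum_right e ..
    also have "... = (\<Sum>i\<le>n. \<Sum>m\<le>n. \<Sum>k\<le>n. \<iota> x m k \<bullet> (\<iota> y m i \<odot> \<iota> z i k))" by (rule sum.cong[OF refl sum.swap])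
    also have "... = (\<Sum>m\<le>n. \<Sum>i\<le>n. \<Sum>k\<le>n. \<iota> x m k \<bullet> (\<iota> y m i \<odot> \<iota> z i k))" by (rule sum.swap)
    also have "... = (\<Sum>m\<le>n. \<Sum>k\<le>n. \<Sum>i\<le>n. \<iota> x m k \<bullet> (\<iota> y m i \<odot> \<iota> z i k))" by (rule sum.cong[OF refl sum.swap])
    finally show ?thesis unfolding mat_mult_def inner_sum_right .
  qed
  show ?thesis unfolding inner_iota iota_jprod inner_add_right sum.distrib using 1[of z x] 2[of z x] by simp
qed

definition Q :: "'a set" where
  "Q = {x. mat_mult n (\<iota> x) (\<iota> x) = \<iota> x \<and> mat_trace n (\<iota> x) = oct_one}"

lemma inner_self_diag: "x \<bullet> x = (\<Sum>i\<le>n. diag (mat_square n (\<iota> x)) i)"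
  unfolding inner_iota diag_square[OF iota_oct_hermitian] ..

lemma trace_diag: "mat_trace n (\<iota> x) = (\<Sum>i\<le>n. diag (\<iota> x) i) *\<^sub>R oct_one"
  unfolding mat_trace_def scaleR_sum_left by (intro sum.cong refl hermitian_diag iota_oct_hermitian)

text \<open>For an idempotent Hermitian matrix the trace equals the squared norm. Thus
  \<open>Q\<close> is described by the inner product and the Jordan product alone, and automorphisms
  of this structure preserve it.\<close>

lemma Q_iff: "x \<in> Q \<longleftrightarrow> jprod x x = 2 *\<^sub>R x \<and> x \<bullet> x = 1"
proof -
  have 1: "jprod x x = 2 *\<^sub>R x \<longleftrightarrow> mat_square n (\<iota> x) = \<iota> x"
  proof
    assume "jprod x x = 2 *\<^sub>R x"
    hence "\<iota> (jprod x x) i k = 2 *\<^sub>R \<iota> x i k" for i k by simp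
    hence "2 *\<^sub>R mat_square n (\<iota> x) i k = 2 *\<^sub>R \<iota> x i k" for i k by (simp add: iota_jprod scaleR_2)
    thus "mat_square n (\<iota> x) = \<iota> x" by (intro ext) simp
  next
    assume "mat_square n (\<iota> x) = \<iota> x"
    thus "jprod x x = 2 *\<^sub>R x" by (intro iota_eqI) (simp add: iota_jprod scaleR_2)
  qed
  have o: "r *\<^sub>R oct_one = oct_one \<longleftrightarrow> r = 1" for r
    using inner_one_one by (metis inner_scaleR_left mult.right_neutral scaleR_one)
  show ?thesis unfolding Q_def mem_Collect_eq 1 inner_self_diag trace_diag o by auto
qed

lemma Q_facts:
  assumes "x \<in> Q"
  shows "(\<Sum>m\<le>n. \<iota> x i m \<odot> \<iota> x m k) = \<iota> x i k" and "(\<Sum>i\<le>n. diag (\<iota> x) i) = 1"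
    and "(\<Sum>m\<le>n. \<iota> x i m \<bullet> \<iota> x i m) = diag (\<iota> x) i" and "diag (\<iota> x) i \<ge> 0"
proof -
  have sq: "mat_square n (\<iota> x) = \<iota> x" using assms by (simp add: Q_def)
  show "(\<Sum>m\<le>n. \<iota> x i m \<odot> \<iota> x m k) = \<iota> x i k" using fun_cong[OF fun_cong[OF sq, of i], of k] by (simp add: mat_mult_def)
  show 3: "(\<Sum>m\<le>n. \<iota> x i m \<bullet> \<iota> x i m) = diag (\<iota> x) i" for i
    using diag_square[OF iota_oct_hermitian[of x], of n i] unfolding sq by simp
  show "(\<Sum>i\<le>n. diag (\<iota> x) i) = 1" using assms inner_self_diag[of x] unfolding Q_iff sq by simp
  show "diag (\<iota> x) i \<ge> 0" unfolding 3[symmetric] by (intro sum_nonneg) simp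
qed

text \<open>The squared norms of \<open>a\<^sub>i\<^sub>i a\<^sub>j\<^sub>k - a\<^sub>j\<^sub>i a\<^sub>i\<^sub>k\<close> sum to zero over \<open>j\<close> and \<open>k\<close>; this argument does not use
  associativity.\<close>

lemma rank_one:
  assumes x: "x \<in> Q" and i: "i \<le> n"
  shows "\<iota> x j i \<odot> \<iota> x i k = diag (\<iota> x) i *\<^sub>R \<iota> x j k"
proof (cases "j \<le> n \<and> k \<le> n")
  case False
  hence "\<iota> x j k = 0" "\<iota> x j i = 0 \<or> \<iota> x i k = 0" by (auto simp: iota_outside)
  thus ?thesis by (auto simp: oct_mult.zero_left oct_mult.zero_right)
next
  case True
  define A where "A = \<iota> x"
  define a where "a = diag A i"
  note F = Q_facts[OF x, folded A_def]
  define D where "D j k = a *\<^sub>R A j k - A j i \<odot> A i k" for j k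
  have conj: "A k j = oct_conj (A j k)" for j k unfolding A_def by (rule iota_conj)
  have n2: "(norm (A j i \<odot> A i k))\<^sup>2 = (A i j \<bullet> A i j) * (A i k \<bullet> A i k)" for j k
    unfolding norm_oct_mult power_mult_distrib conj[of j i] by (simp add: dot_square_norm)
  have nd: "(norm (a *\<^sub>R v - y))\<^sup>2 = a\<^sup>2 * (v \<bullet> v) - 2 * a * (v \<bullet> y) + (norm y)\<^sup>2" for v y :: oct
    unfolding power2_norm_eq_inner by (simp add: inner_diff_left inner_diff_right inner_commute[of y v] power2_eq_square[of a] algebra_simps)
  have "(\<Sum>j\<le>n. \<Sum>k\<le>n. (norm (D j k))\<^sup>2) = (\<Sum>j\<le>n. \<Sum>k\<le>n. a\<^sup>2 * (A j k \<bullet> A j k) - 2 * a * (A j k \<bullet> (A j i \<odot> A i k)) + (A i j \<bullet> A i j) * (A i k \<bullet> A i k))"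
    unfolding D_def nd n2 ..
  also have "... = a\<^sup>2 * (\<Sum>j\<le>n. \<Sum>k\<le>n. A j k \<bullet> A j k) - 2 * a * (\<Sum>j\<le>n. \<Sum>k\<le>n. A j k \<bullet> (A j i \<odot> A i k)) + (\<Sum>j\<le>n. A i j \<bullet> A i j) * (\<Sum>k\<le>n. A i k \<bullet> A i k)"
    unfolding sum_product by (simp add: sum.distrib sum_subtractf sum_distrib_left)
  also have "(\<Sum>j\<le>n. \<Sum>k\<le>n. A j k \<bullet> A j k) = 1" unfolding F(3) F(2) ..
  also have "(\<Sum>j\<le>n. \<Sum>k\<le>n. A j k \<bullet> (A j i \<odot> A i k)) = (\<Sum>j\<le>n. A j i \<bullet> A j i)"
  proof (intro sum.cong refl)
    fix j
    have "A j k \<bullet> (A j i \<odot> A i k) = A j i \<bullet> (A j k \<odot> A k i)" for k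
      unfolding conj[of k i] by (subst inner_commute) (rule inner_oct_mult_right)
    thus "(\<Sum>k\<le>n. A j k \<bullet> (A j i \<odot> A i k)) = A j i \<bullet> A j i" by (simp add: F(1) flip: inner_sum_right)
  qed
  also have "(\<Sum>j\<le>n. A j i \<bullet> A j i) = a" unfolding conj[of _ i] a_def F(3)[of i, symmetric] by simp
  also have "(\<Sum>j\<le>n. A i j \<bullet> A i j) = a" unfolding a_def by (rule F(3))
  \<comment> \<open>The three parts are \<open>a^2\<close>, \<open>- 2 a^2\<close> and
    \<open>a^2\<close>.\<close>
  finally have "(\<Sum>j\<le>n. \<Sum>k\<le>n. (norm (D j k))\<^sup>2) = 0" by (simp add: power2_eq_square)
  hence "\<forall>j\<in>{..n}. (\<Sum>k\<le>n. (norm (D j k))\<^sup>2) = 0" by (subst (asm) sum_nonneg_eq_0_iff) (auto intro: sum_nonneg)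
  hence "(\<Sum>k\<le>n. (norm (D j k))\<^sup>2) = 0" using True by auto
  hence "\<forall>k\<in>{..n}. (norm (D j k))\<^sup>2 = 0" by (subst (asm) sum_nonneg_eq_0_iff) auto
  hence "D j k = 0" using True by auto
  thus ?thesis unfolding D_def a_def A_def by simp
qed

lemma norm_entry:
  assumes x: "x \<in> Q" and "j \<le> n"
  shows "\<iota> x j k \<bullet> \<iota> x j k = diag (\<iota> x) j * diag (\<iota> x) k"
proof -
  have "(\<iota> x j k \<bullet> \<iota> x j k) *\<^sub>R oct_one = \<iota> x k j \<odot> \<iota> x j k"
    unfolding iota_conj[of x k j] by (rule oct_mult_self_conj(2)[symmetric])
  also have "... = (diag (\<iota> x) j * diag (\<iota> x) k) *\<^sub>R oct_one"
    unfolding rank_one[OF assms] hermitian_diag[OF iota_oct_hermitian, of x k] by simp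
  finally show ?thesis using inner_one_one by (metis inner_scaleR_left mult.right_neutral)
qed

section \<open>Jordan automorphisms and transitivity\<close>

text \<open>Compatibility with squares is the form that \<open>rotation_square\<close> provides;
  products follow by polarisation.\<close>

definition jordan_auto :: "('a \<Rightarrow> 'a) \<Rightarrow> bool" where
  "jordan_auto g \<longleftrightarrow> orthogonal_transformation g \<and> (\<forall>x. g (jprod x x) = jprod (g x) (g x))"

lemma jordan_auto_jprod:
  assumes "jordan_auto g" shows "g (jprod x y) = jprod (g x) (g y)"
proof -
  have g: "linear g" using assms by (auto simp: jordan_auto_def orthogonal_transformation_linear)
  have sq: "g (jprod x x) = jprod (g x) (g x)" for x using assms by (simp add: jordan_auto_def)
  have "g (jprod (x + y) (x + y)) = jprod (g x + g y) (g x + g y)" unfolding sq by (simp add: linear_add[OF g])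
  hence "2 *\<^sub>R g (jprod x y) = 2 *\<^sub>R jprod (g x) (g y)"
    by (simp add: jprod_add_left jprod_add_right linear_add[OF g] sq jprod_commute[of y x] jprod_commute[of "g y" "g x"] scaleR_2 algebra_simps)
  thus ?thesis by simp
qed

lemma jordan_auto_image:
  assumes "jordan_auto g" shows "g ` Q = Q"
proof -
  have o: "orthogonal_transformation g" and g: "linear g" using assms by (auto simp: jordan_auto_def orthogonal_transformation_linear)
  have i: "g x \<bullet> g y = x \<bullet> y" for x y using o by (simp add: orthogonal_transformation_def)
  have "g x \<in> Q \<longleftrightarrow> x \<in> Q" for x
  proof -
    have "jprod (g x) (g x) = 2 *\<^sub>R g x \<longleftrightarrow> g (jprod x x) = g (2 *\<^sub>R x)"
      by (simp add: jordan_auto_jprod[OF assms] linear_scale[OF g])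
    also have "... \<longleftrightarrow> jprod x x = 2 *\<^sub>R x" using orthogonal_transformation_inj[OF o] by (simp add: inj_eq)
    finally show ?thesis unfolding Q_iff i by simp
  qed
  thus ?thesis using orthogonal_transformation_surj[OF o] by (auto simp: image_iff) (metis surjD)
qed

lemma jordan_auto_compose: "jordan_auto f \<Longrightarrow> jordan_auto g \<Longrightarrow> jordan_auto (f \<circ> g)"
  unfolding jordan_auto_def by (auto intro: orthogonal_transformation_compose)

lemma jordan_auto_id: "jordan_auto id"
  unfolding jordan_auto_def by (simp add: id_def)

definition rot :: "nat \<Rightarrow> oct \<Rightarrow> real \<Rightarrow> real \<Rightarrow> 'a \<Rightarrow> 'a" where
  "rot j u c s x = lift (rotation j u c s (\<iota> x))"

lemma iota_rot:
  assumes j: "1 \<le> j" "j \<le> n" and u: "inner u u = 1" "u \<in> scalars d\<^sub>0" and cs: "c * c + s * s = 1"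
  shows "\<iota> (rot j u c s x) = rotation j u c s (\<iota> x)"
  unfolding rot_def by (intro iota_lift rotation_in_hermitian iota_hermitian assms)

lemma jordan_auto_rot:
  assumes jn: "1 \<le> j" "j \<le> n" and un: "inner u u = 1" "u \<in> scalars d\<^sub>0" and csn: "c * c + s * s = 1"
  shows "jordan_auto (rot j u c s)"
proof -
  interpret octonion_rotation j u c s using jn un csn by unfold_locales auto
  note R = iota_rot[OF assms]
  have lin: "linear (rot j u c s)"
  proof (rule linearI)
    fix x y r
    show "rot j u c s (x + y) = rot j u c s x + rot j u c s y"
      by (rule iota_eqI) (simp add: R rotation_def col_rotation_def row_rotation_def oct_mult.add_left oct_mult.add_right oct_mult.diff_left oct_mult.diff_right oct_mult.scaleR_left oct_mult.scaleR_right algebra_simps)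
    show "rot j u c s (r *\<^sub>R x) = r *\<^sub>R rot j u c s x"
      by (rule iota_eqI) (simp add: R rotation_def col_rotation_def row_rotation_def oct_mult.add_left oct_mult.add_right oct_mult.diff_left oct_mult.diff_right oct_mult.scaleR_left oct_mult.scaleR_right algebra_simps)
  qed
  have sq: "mat_square n (rotation j u c s (\<iota> x)) = rotation j u c s (mat_square n (\<iota> x))" for x
    by (rule rotation_square[OF iota_hermitian jn(2) un(2)]) (use K in auto)
  have tr: "(\<Sum>i\<le>n. diag (rotation j u c s A) i) = (\<Sum>i\<le>n. diag A i)" if A: "oct_hermitian A" for A
  proof -
    have e: "{..n} = insert 0 (insert j ({..n} - {0, j}))" using jn by auto
    have s: "(\<Sum>i\<le>n. f i) = f 0 + f j + (\<Sum>i\<in>{..n} - {0, j}. f i)" for f :: "nat \<Rightarrow> real"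
      using jn by (subst e) (simp add: add.assoc)
    note E = rotation_entries[OF A]
    have "diag (rotation j u c s A) 0 + diag (rotation j u c s A) j = (c * c + s * s) * (diag A 0 + diag A j)"
      by (simp add: diag_def[of "rotation j u c s A"] E algebra_simps)
    moreover have "diag (rotation j u c s A) i = diag A i" if "i \<in> {..n} - {0, j}" for i
      using that by (simp add: diag_def E)
    ultimately show ?thesis unfolding s cs by simp
  qed
  have "rot j u c s x \<bullet> rot j u c s x = x \<bullet> x" for x
    unfolding inner_self_diag R sq by (rule tr[OF oct_hermitian_square[OF iota_oct_hermitian]])
  hence "orthogonal_transformation (rot j u c s)" using lin by (simp add: orthogonal_transformation norm_eq_sqrt_inner)
  moreover have "rot j u c s (jprod x x) = jprod (rot j u c s x) (rot j u c s x)" for x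
  proof (rule iota_eqI)
    fix i k
    have "\<iota> (jprod x x) = (\<lambda>i k. 2 *\<^sub>R mat_square n (\<iota> x) i k)" by (intro ext) (simp add: iota_jprod scaleR_2)
    hence "\<iota> (rot j u c s (jprod x x)) i k = 2 *\<^sub>R rotation j u c s (mat_square n (\<iota> x)) i k"
      unfolding R by (simp add: rotation_def col_rotation_def row_rotation_def oct_mult.add_left oct_mult.add_right oct_mult.diff_left oct_mult.diff_right oct_mult.scaleR_left oct_mult.scaleR_right algebra_simps)
    thus "\<iota> (rot j u c s (jprod x x)) i k = \<iota> (jprod (rot j u c s x) (rot j u c s x)) i k"
      unfolding iota_jprod R sq by (simp add: scaleR_2)
  qed
  ultimately show ?thesis unfolding jordan_auto_def by blast
qed

definition E0 :: oct_matrix where "E0 = (\<lambda>i k. if i = 0 \<and> k = 0 then oct_one else 0)"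
definition e0 :: 'a where "e0 = lift E0"

lemma iota_e0: "\<iota> e0 = E0"
  unfolding e0_def by (rule iota_lift) (auto simp: hermitian_def E0_def)

lemma e0_in_Q: "e0 \<in> Q"
proof -
  have "mat_square n E0 = E0"
    by (intro ext) (auto simp: mat_mult_def E0_def oct_mult.zero_left oct_mult.zero_right if_distrib[of "\<lambda>x. x \<odot> _"] cong: if_cong intro!: sum.neutral)
  moreover have "mat_trace n E0 = oct_one" by (simp add: mat_trace_def E0_def)
  ultimately show ?thesis by (simp add: Q_def iota_e0)
qed

lemma inner_e0: "e0 \<bullet> x = diag (\<iota> x) 0"
proof -
  have "(\<Sum>k\<le>n. E0 i k \<bullet> \<iota> x i k) = (if i = 0 then diag (\<iota> x) 0 else 0)" for i
  proof -
    have "(\<Sum>k\<le>n. E0 i k \<bullet> \<iota> x i k) = (\<Sum>k\<le>n. if k = 0 then (if i = 0 then diag (\<iota> x) 0 else 0) else 0)"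
      by (intro sum.cong refl) (auto simp: E0_def diag_def)
    thus ?thesis by simp
  qed
  hence "e0 \<bullet> x = (\<Sum>i\<le>n. if i = 0 then diag (\<iota> x) 0 else 0)"
    unfolding inner_iota iota_e0 by simp
  thus ?thesis by simp
qed

text \<open>A rotation that moves the whole mass of the block to position 0. The rank one property
  gives \<open>|w|^2 = a b\<close>; with \<open>u\<close> in the direction of \<open>w\<close> and
  \<open>(c, s)\<close> proportional to \<open>(sqrt a, sqrt b)\<close>, the new entry at
  \<open>j\<close> is \<open>(2 a b - 2 a b) / (a + b)\<close>.\<close>

lemma kill_diagonal:
  assumes x: "x \<in> Q" and jn: "1 \<le> j" "j \<le> n"
  shows "\<exists>g. jordan_auto g \<and> diag (\<iota> (g x)) j = 0 \<and> (\<forall>k. k \<noteq> 0 \<longrightarrow> k \<noteq> j \<longrightarrow> diag (\<iota> (g x)) k = diag (\<iota> x) k)"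
proof (cases "diag (\<iota> x) j = 0")
  case True
  thus ?thesis by (intro exI[of _ id]) (simp add: jordan_auto_id)
next
  case False
  define a b w where "a = diag (\<iota> x) 0" and "b = diag (\<iota> x) j" and "w = \<iota> x 0 j"
  have ab: "a \<ge> 0" "b > 0" "a + b > 0" using Q_facts(4)[OF x, of 0] Q_facts(4)[OF x, of j] False by (auto simp: a_def b_def)
  have w: "w \<bullet> w = a * b" using norm_entry[OF x, of 0 j] by (simp add: a_def b_def w_def)
  \<comment> \<open>If \<open>w = 0\<close> then \<open>a b = 0\<close>, and the unit 1 still has
    inner product \<open>sqrt (a * b)\<close> with \<open>w\<close>.\<close>
  define u where "u = (if w = 0 then oct_one else w /\<^sub>R norm w)"
  have un: "u \<bullet> u = 1" "u \<in> scalars d\<^sub>0" "u \<bullet> w = sqrt (a * b)"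
  proof -
    have nw: "norm w = sqrt (a * b)" using w by (simp add: norm_eq_sqrt_inner)
    show "u \<bullet> u = 1" by (simp add: u_def dot_square_norm power2_eq_square)
    have "u \<bullet> w = norm w" by (simp add: u_def dot_square_norm power2_eq_square)
    thus "u \<bullet> w = sqrt (a * b)" unfolding nw .
    show "u \<in> scalars d\<^sub>0" using iota_scalars[of x 0 j] by (simp add: u_def w_def)
  qed
  define c s where "c = sqrt a / sqrt (a + b)" and "s = sqrt b / sqrt (a + b)"
  have csn: "c * c = a / (a + b)" "s * s = b / (a + b)" "c * s = sqrt (a * b) / (a + b)"
    using ab by (simp_all add: c_def s_def real_sqrt_mult)
  have cs1: "c * c + s * s = 1" unfolding csn using ab by (simp flip: add_divide_distrib)
  interpret octonion_rotation j u c s using jn un cs1 by unfold_locales auto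
  note E = rotation_entries[OF iota_oct_hermitian[of x]]
  let ?g = "rot j u c s"
  have R: "\<iota> (?g x) = rotation j u c s (\<iota> x)" by (rule iota_rot[OF jn un(1,2) cs1])
  have "diag (\<iota> (?g x)) j = s * s * a + c * c * b - 2 * (c * s) * (u \<bullet> w)"
    unfolding R diag_def[of "rotation _ _ _ _ _"] E(2) by (simp add: a_def b_def w_def)
  also have "... = (b * a + a * b - 2 * (sqrt (a * b) * sqrt (a * b))) / (a + b)"
    unfolding csn un(3) by (simp add: diff_divide_distrib add_divide_distrib)
  also have "... = 0" using ab by simp
  finally have "diag (\<iota> (?g x)) j = 0" .
  moreover have "diag (\<iota> (?g x)) k = diag (\<iota> x) k" if "k \<noteq> 0" "k \<noteq> j" for k
    unfolding R diag_def E(9)[OF that that] ..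
  ultimately show ?thesis using jordan_auto_rot[OF jn un(1,2) cs1] by blast
qed

text \<open>Once the diagonal entries at positions 1 to \<open>n\<close> are removed one by one, the
  trace makes the first entry 1, and \<open>norm_entry\<close> forces all off-diagonal entries to
  vanish.\<close>

lemma transitive:
  assumes x: "x \<in> Q" shows "\<exists>g. jordan_auto g \<and> g x = e0"
proof -
  have "\<exists>g. jordan_auto g \<and> (\<forall>k\<in>{1..m}. diag (\<iota> (g x)) k = 0)" if "m \<le> n" for m
    using that
  proof (induction m)
    case 0 show ?case using jordan_auto_id by auto
  next
    case (Suc m)
    then obtain g where g: "jordan_auto g" "\<forall>k\<in>{1..m}. diag (\<iota> (g x)) k = 0" by auto
    have "g x \<in> Q" using jordan_auto_image[OF g(1)] x by blast
    from kill_diagonal[OF this, of "Suc m"] Suc.prems obtain f where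
      f: "jordan_auto f" "diag (\<iota> (f (g x))) (Suc m) = 0" "\<forall>k. k \<noteq> 0 \<longrightarrow> k \<noteq> Suc m \<longrightarrow> diag (\<iota> (f (g x))) k = diag (\<iota> (g x)) k" by auto
    have "\<forall>k\<in>{1..Suc m}. diag (\<iota> ((f \<circ> g) x)) k = 0"
    proof
      fix k assume "k \<in> {1..Suc m}"
      thus "diag (\<iota> ((f \<circ> g) x)) k = 0" using f g by (cases "k = Suc m") auto
    qed
    thus ?case using jordan_auto_compose[OF f(1) g(1)] by blast
  qed
  from this[of n] obtain g where g: "jordan_auto g" "\<forall>k\<in>{1..n}. diag (\<iota> (g x)) k = 0" by auto
  have gQ: "g x \<in> Q" using jordan_auto_image[OF g(1)] x by blast
  let ?A = "\<iota> (g x)"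
  have "(\<Sum>i\<le>n. diag ?A i) = diag ?A 0"
    using g(2) by (simp add: sum.atMost_shift atLeast1_atMost_eq_remove0 sum.neutral lessThan_Suc_atMost)
  hence a1: "diag ?A 0 = 1" using Q_facts(2)[OF gQ] by simp
  have "?A i k = E0 i k" for i k
  proof (cases "i = 0 \<and> k = 0")
    case True thus ?thesis using hermitian_diag[OF iota_oct_hermitian[of "g x"], of 0] a1 by (simp add: E0_def)
  next
    case False
    have "?A i k = 0"
    proof (cases "i \<le> n \<and> k \<le> n")
      case True
      hence "?A i k \<bullet> ?A i k = 0" using norm_entry[OF gQ, of i k] g(2) False by auto
      thus ?thesis by simp
    qed (auto simp: iota_outside)
    thus ?thesis using False by (auto simp: E0_def)
  qed
  hence "g x = e0" by (intro iota_inject ext) (simp add: iota_e0)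
  thus ?thesis using g(1) by blast
qed

end

section \<open>Green's formula on the projective spaces\<close>

context hermitian_embedding
begin

definition gen :: "nat \<Rightarrow> oct \<Rightarrow> 'a \<Rightarrow> 'a" where
  "gen j u x = lift (commutator j u (\<iota> x))"

text \<open>The vector that represents the component of the entry \<open>(0, j)\<close> along
  \<open>u\<close>. The halves compensate for the conjugate entry at \<open>(j, 0)\<close>.\<close>

definition dir :: "nat \<Rightarrow> oct \<Rightarrow> 'a" where
  "dir j u = lift (\<lambda>i k. if i = 0 \<and> k = j then (1/2) *\<^sub>R u else if i = j \<and> k = 0 then (1/2) *\<^sub>R oct_conj u else 0)"

lemma iota_gen: "1 \<le> j \<Longrightarrow> j \<le> n \<Longrightarrow> u \<in> scalars d\<^sub>0 \<Longrightarrow> \<iota> (gen j u x) = commutator j u (\<iota> x)"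
  unfolding gen_def by (intro iota_lift commutator_in_hermitian iota_hermitian)

lemma inner_dir:
  assumes j: "1 \<le> j" "j \<le> n" and u: "u \<in> scalars d\<^sub>0"
  shows "dir j u \<bullet> x = u \<bullet> \<iota> x 0 j"
proof -
  let ?D = "\<lambda>i k. if i = 0 \<and> k = j then (1/2) *\<^sub>R u else if i = j \<and> k = 0 then (1/2) *\<^sub>R oct_conj u else 0"
  have D: "\<iota> (dir j u) = ?D"
    unfolding dir_def by (rule iota_lift) (use j u in \<open>auto simp: hermitian_def\<close>)
  have row: "(\<Sum>k\<le>n. ?D i k \<bullet> \<iota> x i k) = (if i = 0 then (u \<bullet> \<iota> x 0 j) / 2 else 0) + (if i = j then (u \<bullet> \<iota> x 0 j) / 2 else 0)" for i
  proof -
    have c: "oct_conj u \<bullet> \<iota> x j 0 = u \<bullet> \<iota> x 0 j" unfolding iota_conj[of x j 0] by simp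
    have "(\<Sum>k\<le>n. ?D i k \<bullet> \<iota> x i k) = (\<Sum>k\<le>n. (if k = j then (if i = 0 then (u \<bullet> \<iota> x 0 j) / 2 else 0) else 0) + (if k = 0 then (if i = j then (u \<bullet> \<iota> x 0 j) / 2 else 0) else 0))"
      using j c by (intro sum.cong refl) auto
    thus ?thesis using j by (simp add: sum.distrib)
  qed
  have "dir j u \<bullet> x = (\<Sum>i\<le>n. (if i = 0 then (u \<bullet> \<iota> x 0 j) / 2 else 0) + (if i = j then (u \<bullet> \<iota> x 0 j) / 2 else 0))"
    unfolding inner_iota D row ..
  thus ?thesis using j by (simp add: sum.distrib)
qed

lemma flow_rot:
  assumes S: "invariant_space \<mu> Q" and j: "1 \<le> j" "j \<le> n" and u: "inner u u = 1" "u \<in> scalars d\<^sub>0"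
  shows "invariant_space.flow Q (\<lambda>t. rot j u (cos t) (sin t)) (gen j u)"
proof -
  interpret invariant_space \<mu> Q by (rule S)
  have cs: "cos t * cos t + sin t * sin t = 1" for t :: real using sin_cos_squared_add[of t] by (simp add: power2_eq_square)
  note auto = jordan_auto_rot[OF j u cs]
  have "linear (gen j u)"
    by (rule linearI; rule iota_eqI)
       (simp_all add: iota_gen[OF j u(2)] commutator_def oct_mult.add_left oct_mult.add_right oct_mult.scaleR_left oct_mult.scaleR_right algebra_simps)
  moreover have "rot j u (cos 0) (sin 0) y = y" for y
    by (rule iota_inject) (use iota_rot[OF j u cs, of 0 y] rotation_0[of j u "\<iota> y"] j in simp)
  moreover have "((\<lambda>t. z \<bullet> rot j u (cos t) (sin t) y) has_real_derivative z \<bullet> gen j u (rot j u (cos t) (sin t) y)) (at t)" for y z t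
    unfolding inner_iota iota_gen[OF j u(2)] iota_rot[OF j u cs]
    by (intro DERIV_sum rotation_deriv) (use j u in auto)
  ultimately show ?thesis
    using auto jordan_auto_image[OF auto] unfolding flow_def jordan_auto_def by blast
qed

text \<open>Summation over the units reassembles the entries of \<open>y\<close> and leaves matrix
  products. Idempotence evaluates the sums over the middle index, and the rank one property replaces
  the product of the entries \<open>(i, 0)\<close> and \<open>(0, k)\<close> by the entry
  \<open>(0, 0)\<close> times the entry \<open>(i, k)\<close>. The outcome is the gradient on
  \<open>Q\<close> of the function \<open>e0 \<bullet> y\<close>, free of coordinates.\<close>

lemma gradient_e0:
  assumes y: "y \<in> Q"
  shows "(\<Sum>(j,u)\<in>{1..n} \<times> units d\<^sub>0. (dir j u \<bullet> y) *\<^sub>R gen j u y) = jprod e0 y - (2 * (e0 \<bullet> y)) *\<^sub>R y"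
proof (rule iota_eqI)
  fix i k
  define A where "A = \<iota> y"
  define a where "a = diag A 0"
  define C where "C j u = u \<bullet> A 0 j" for j u
  have uK: "u \<in> scalars d\<^sub>0" if "u \<in> units d\<^sub>0" for u using that by (simp add: units_def)
  have conj: "A k i = oct_conj (A i k)" for i k unfolding A_def by (rule iota_conj)
  have ex: "(\<Sum>u\<in>units d\<^sub>0. C j u *\<^sub>R u) = A 0 j" for j
    unfolding C_def by (rule units_expansion) (simp add: A_def iota_scalars)
  have exc: "(\<Sum>u\<in>units d\<^sub>0. C j u *\<^sub>R oct_conj u) = A j 0" for j
    unfolding conj[of 0 j, symmetric] using arg_cong[OF ex[of j], of oct_conj] by (simp add: conj[of j 0])
  have L1: "(\<Sum>u\<in>units d\<^sub>0. C j u *\<^sub>R (u \<odot> v)) = A 0 j \<odot> v" for j v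
    unfolding ex[of j, symmetric] oct_mult.sum_left by (simp add: oct_mult.scaleR_left)
  have L2: "(\<Sum>u\<in>units d\<^sub>0. C j u *\<^sub>R (oct_conj u \<odot> v)) = A j 0 \<odot> v" for j v
    unfolding exc[of j, symmetric] oct_mult.sum_left by (simp add: oct_mult.scaleR_left)
  have L3: "(\<Sum>u\<in>units d\<^sub>0. C j u *\<^sub>R (v \<odot> u)) = v \<odot> A 0 j" for j v
    unfolding ex[of j, symmetric] oct_mult.sum_right by (simp add: oct_mult.scaleR_right)
  have L4: "(\<Sum>u\<in>units d\<^sub>0. C j u *\<^sub>R (v \<odot> oct_conj u)) = v \<odot> A j 0" for j v
    unfolding exc[of j, symmetric] oct_mult.sum_right by (simp add: oct_mult.scaleR_right)
  have tail: "(\<Sum>j=1..n. A i j \<odot> A j k) = A i k - A i 0 \<odot> A 0 k" for i k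
  proof -
    have "(\<Sum>j\<le>n. A i j \<odot> A j k) = A i 0 \<odot> A 0 k + (\<Sum>j=1..n. A i j \<odot> A j k)"
      by (simp add: sum.atMost_shift sum.shift_bounds_cl_Suc_ivl lessThan_Suc_atMost sum.atLeast_Suc_atMost atMost_atLeast0 flip: One_nat_def)
    thus ?thesis using Q_facts(1)[OF y, of i k] unfolding A_def by (simp add: algebra_simps)
  qed
  have a00: "A 0 0 = a *\<^sub>R oct_one" unfolding a_def A_def by (rule hermitian_diag[OF iota_oct_hermitian])
  have "\<iota> (\<Sum>(j,u)\<in>{1..n} \<times> units d\<^sub>0. (dir j u \<bullet> y) *\<^sub>R gen j u y) i k
     = (\<Sum>j=1..n. \<Sum>u\<in>units d\<^sub>0. C j u *\<^sub>R commutator j u A i k)"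
    unfolding iota_sum sum.cartesian_product[symmetric] case_prod_unfold
    by (subst sum.cartesian_product) (auto intro!: sum.cong simp: inner_dir iota_gen uK C_def A_def)
  also have "... = (\<Sum>j=1..n. (if i = 0 then A 0 j \<odot> A j k else 0) - (if i = j then A j 0 \<odot> A 0 k else 0)
     - (if k = j then A i 0 \<odot> A 0 j else 0) + (if k = 0 then A i j \<odot> A j 0 else 0))"
  proof (intro sum.cong refl)
    fix j
    have "(\<Sum>u\<in>units d\<^sub>0. C j u *\<^sub>R commutator j u A i k) =
      (if i = 0 then \<Sum>u\<in>units d\<^sub>0. C j u *\<^sub>R (u \<odot> A j k) else 0) - (if i = j then \<Sum>u\<in>units d\<^sub>0. C j u *\<^sub>R (oct_conj u \<odot> A 0 k) else 0)
     - (if k = j then \<Sum>u\<in>units d\<^sub>0. C j u *\<^sub>R (A i 0 \<odot> u) else 0) + (if k = 0 then \<Sum>u\<in>units d\<^sub>0. C j u *\<^sub>R (A i j \<odot> oct_conj u) else 0)"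
      by (simp add: commutator_def scaleR_diff_right scaleR_add_right sum.distrib sum_subtractf)
    thus "(\<Sum>u\<in>units d\<^sub>0. C j u *\<^sub>R commutator j u A i k) = (if i = 0 then A 0 j \<odot> A j k else 0) - (if i = j then A j 0 \<odot> A 0 k else 0)
     - (if k = j then A i 0 \<odot> A 0 j else 0) + (if k = 0 then A i j \<odot> A j 0 else 0)" unfolding L1 L2 L3 L4 .
  qed
  also have "... = (if i = 0 then \<Sum>j=1..n. A 0 j \<odot> A j k else 0) - (if i \<in> {1..n} then A i 0 \<odot> A 0 k else 0)
     - (if k \<in> {1..n} then A i 0 \<odot> A 0 k else 0) + (if k = 0 then \<Sum>j=1..n. A i j \<odot> A j 0 else 0)"
    by (simp add: sum.distrib sum_subtractf)
  also have "... = (if i = 0 then A 0 k else 0) + (if k = 0 then A i 0 else 0) - 2 *\<^sub>R (A i 0 \<odot> A 0 k)"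
  proof -
    have "A i 0 = 0" if "i > n" using that by (simp add: A_def iota_outside)
    moreover have "A 0 k = 0" if "k > n" using that by (simp add: A_def iota_outside)
    ultimately show ?thesis unfolding tail
      by (cases "i = 0"; cases "k = 0") (auto simp: scaleR_2 oct_mult.zero_left oct_mult.zero_right not_le)
  qed
  also have "A i 0 \<odot> A 0 k = a *\<^sub>R A i k" unfolding a_def A_def by (rule rank_one[OF y]) simp
  also have "(if i = 0 then A 0 k else 0) = mat_mult n E0 A i k"
    unfolding mat_mult_def E0_def by (auto simp: if_distrib[of "\<lambda>x. x \<odot> _"] oct_mult.zero_left cong: if_cong)
  also have "(if k = 0 then A i 0 else 0) = mat_mult n A E0 i k"
    unfolding mat_mult_def E0_def by (auto simp: if_distrib[of "\<lambda>x. _ \<odot> x"] oct_mult.zero_right cong: if_cong)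
  finally show "\<iota> (\<Sum>(j,u)\<in>{1..n} \<times> units d\<^sub>0. (dir j u \<bullet> y) *\<^sub>R gen j u y) i k = \<iota> (jprod e0 y - (2 * (e0 \<bullet> y)) *\<^sub>R y) i k"
    by (simp add: iota_jprod iota_e0 inner_e0 flip: A_def a_def)
qed

lemma inner_e0_jprod: "y \<in> Q \<Longrightarrow> e0 \<bullet> jprod e0 y = 2 * (e0 \<bullet> y)"
proof -
  have "jprod e0 e0 = 2 *\<^sub>R e0" using e0_in_Q Q_iff by blast
  moreover have "e0 \<bullet> jprod e0 y = y \<bullet> jprod e0 e0" using inner_jprod[of e0 e0 y] inner_jprod[of e0 y e0] by (simp add: jprod_commute)
  ultimately show ?thesis by (simp add: inner_commute)
qed

text \<open>Inner product at \<open>y\<close> of the gradients on \<open>Q\<close> of the linear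
  functions given by \<open>x\<close> and \<open>z\<close>. Written with the Jordan product it is
  symmetric in \<open>x\<close> and \<open>z\<close> and invariant under automorphisms.\<close>

definition grad_inner :: "'a \<Rightarrow> 'a \<Rightarrow> 'a \<Rightarrow> real" where
  "grad_inner x z y = z \<bullet> jprod x y - 2 * (x \<bullet> y) * (z \<bullet> y)"

lemma grad_inner_commute: "grad_inner x z y = grad_inner z x y"
  unfolding grad_inner_def using inner_jprod[of z x y] by (simp add: mult.commute)

lemma grad_inner_auto: "jordan_auto g \<Longrightarrow> grad_inner (g x) (g z) (g y) = grad_inner x z y"
  unfolding grad_inner_def jordan_auto_jprod[symmetric] by (simp add: jordan_auto_def orthogonal_transformation_def)

lemma projective_jacobi_op_e0:
  assumes S: "invariant_space \<mu> Q"
  defines "X \<equiv> invariant_space.zon 2"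
  shows "(\<integral>y. poly (jacobi_op (n * d\<^sub>0) d\<^sub>0 f) (X e0 y) * poly g (X z y) \<partial>\<mu>) =
    - (\<integral>y. 2 * (poly (pderiv f) (X e0 y) * poly (pderiv g) (X z y) * grad_inner e0 z y) \<partial>\<mu>)"
proof -
  interpret invariant_space \<mu> Q 2 "n * d\<^sub>0" d\<^sub>0 by (rule S)
  let ?I = "{1..n} \<times> units d\<^sub>0"
  have u: "u \<bullet> u = 1" "u \<in> scalars d\<^sub>0" if "u \<in> units d\<^sub>0" for u using that by (auto simp: units_def)
  show ?thesis unfolding X_def
  proof (rule green_formula[where I = ?I and R = "\<lambda>(j,u) t. rot j u (cos t) (sin t)" and A = "\<lambda>(j,u). gen j u" and e = "\<lambda>(j,u). dir j u" and \<Gamma> = "\<lambda>z y. grad_inner e0 z y"])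
    show "finite ?I" by simp
    show "flow ((\<lambda>(j,u) t. rot j u (cos t) (sin t)) i) ((\<lambda>(j,u). gen j u) i)" if "i \<in> ?I" for i
      using that flow_rot[OF S] u by (cases i) auto
    fix y w assume y: "y \<in> Q"
    define a where "a = diag (\<iota> y) 0"
    have d: "dir j u \<bullet> gen j u y = diag (\<iota> y) j - a" if "j \<in> {1..n}" "u \<in> units d\<^sub>0" for j u
    proof -
      have "dir j u \<bullet> gen j u y = u \<bullet> (u \<odot> \<iota> y j j - \<iota> y 0 0 \<odot> u)"
        using that u[OF that(2)] by (simp add: inner_dir iota_gen commutator_def)
      also have "... = diag (\<iota> y) j - a"
        unfolding hermitian_diag[OF iota_oct_hermitian, of y j] hermitian_diag[OF iota_oct_hermitian, of y 0] a_def
        using u[OF that(2)] by (simp add: oct_mult.scaleR_left oct_mult.scaleR_right inner_diff_right)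
      finally show ?thesis .
    qed
    have c: "card (units d\<^sub>0) = d\<^sub>0" using K by (intro card_units) auto
    have tr: "(\<Sum>j=1..n. diag (\<iota> y) j) = 1 - a"
    proof -
      have "{..n} = insert 0 {1..n}" by auto
      thus ?thesis using Q_facts(2)[OF y] by (simp add: a_def)
    qed
    have "(\<Sum>i\<in>?I. (case i of (j,u) \<Rightarrow> dir j u) \<bullet> (case i of (j,u) \<Rightarrow> gen j u) y) = (\<Sum>(j,u)\<in>?I. diag (\<iota> y) j - a)"
      by (intro sum.cong refl) (auto simp: d)
    also have "... = (\<Sum>j=1..n. \<Sum>u\<in>units d\<^sub>0. diag (\<iota> y) j - a)" by (rule sum.cartesian_product[symmetric])
    also have "... = real d\<^sub>0 * ((\<Sum>j=1..n. diag (\<iota> y) j) - real n * a)"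
      by (simp add: c sum_subtractf sum_distrib_left right_diff_distrib)
    \<comment> \<open>The trace condition turns the sum into
      \<open>d\<^sub>0 * (1 - (n + 1) * a)\<close>, which is the first-order coefficient of the
      Jacobi operator for dimension \<open>n * d\<^sub>0\<close>.\<close>
    also have "... = - (real (n * d\<^sub>0) - (real (n * d\<^sub>0) + real d\<^sub>0) / 2 * zon e0 y)"
      unfolding tr zon_def inner_e0 a_def by (simp add: algebra_simps)
    finally show "(\<Sum>i\<in>?I. (case i of (j,u) \<Rightarrow> dir j u) \<bullet> (case i of (j,u) \<Rightarrow> gen j u) y) = - (real (n * d\<^sub>0) - (real (n * d\<^sub>0) + real d\<^sub>0) / 2 * zon e0 y)" .
    have "(\<Sum>i\<in>?I. ((case i of (j,u) \<Rightarrow> dir j u) \<bullet> y) * (w \<bullet> (case i of (j,u) \<Rightarrow> gen j u) y)) = w \<bullet> (\<Sum>(j,u)\<in>?I. (dir j u \<bullet> y) *\<^sub>R gen j u y)"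
      unfolding inner_sum_right by (intro sum.cong refl) auto
    also have "... = grad_inner e0 w y" unfolding gradient_e0[OF y] grad_inner_def by (simp add: inner_diff_right)
    finally show "(\<Sum>i\<in>?I. ((case i of (j,u) \<Rightarrow> dir j u) \<bullet> y) * (w \<bullet> (case i of (j,u) \<Rightarrow> gen j u) y)) = grad_inner e0 w y" .
    show "2 * grad_inner e0 e0 y = zon e0 y * (2 - zon e0 y)"
      unfolding grad_inner_def inner_e0_jprod[OF y] zon_def by (simp add: algebra_simps)
  qed
qed

text \<open>An automorphism that takes \<open>x\<close> to \<open>e0\<close> transports the formula,
  because \<open>zon\<close>, \<open>grad_inner\<close> and \<open>\<mu>\<close> are all invariant
  under it.\<close>

lemma projective_jacobi_op:
  assumes S: "invariant_space \<mu> Q" and x: "x \<in> Q"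
  defines "X \<equiv> invariant_space.zon 2"
  shows "(\<integral>y. poly (jacobi_op (n * d\<^sub>0) d\<^sub>0 f) (X x y) * poly g (X z y) \<partial>\<mu>) =
    - (\<integral>y. 2 * (poly (pderiv f) (X x y) * poly (pderiv g) (X z y) * grad_inner x z y) \<partial>\<mu>)"
proof -
  interpret invariant_space \<mu> Q 2 "n * d\<^sub>0" d\<^sub>0 by (rule S)
  obtain \<phi> where \<phi>: "jordan_auto \<phi>" "\<phi> x = e0" using transitive[OF x] by blast
  have o: "orthogonal_transformation \<phi>" using \<phi>(1) by (simp add: jordan_auto_def)
  have z: "zon v y = zon (\<phi> v) (\<phi> y)" for v y using o by (simp add: zon_def orthogonal_transformation_def)
  \<comment> \<open>Moving the Jordan product onto the fixed vectors makes continuity in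
    \<open>y\<close> evident.\<close>
  have cg: "continuous_on UNIV (\<lambda>y. grad_inner e0 (\<phi> z) y)"
  proof -
    have "grad_inner e0 (\<phi> z) y = y \<bullet> jprod (\<phi> z) e0 - 2 * (e0 \<bullet> y) * (\<phi> z \<bullet> y)" for y
      unfolding grad_inner_def using inner_jprod[of "\<phi> z" y e0] by (simp add: jprod_commute)
    thus ?thesis by (simp add: continuous_intros)
  qed
  have "(\<integral>y. poly (jacobi_op (n * d\<^sub>0) d\<^sub>0 f) (zon x y) * poly g (zon z y) \<partial>\<mu>) = (\<integral>y. poly (jacobi_op (n * d\<^sub>0) d\<^sub>0 f) (zon e0 (\<phi> y)) * poly g (zon (\<phi> z) (\<phi> y)) \<partial>\<mu>)"
    unfolding z[of x] z[of z] \<phi>(2) ..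
  also have "... = (\<integral>y. poly (jacobi_op (n * d\<^sub>0) d\<^sub>0 f) (zon e0 y) * poly g (zon (\<phi> z) y) \<partial>\<mu>)"
    by (rule integral_orthogonal[OF o jordan_auto_image[OF \<phi>(1)]]) (intro continuous_intros)
  also have "... = - (\<integral>y. 2 * (poly (pderiv f) (zon e0 y) * poly (pderiv g) (zon (\<phi> z) y) * grad_inner e0 (\<phi> z) y) \<partial>\<mu>)"
    by (rule projective_jacobi_op_e0[OF S])
  also have "(\<integral>y. 2 * (poly (pderiv f) (zon e0 y) * poly (pderiv g) (zon (\<phi> z) y) * grad_inner e0 (\<phi> z) y) \<partial>\<mu>)
      = (\<integral>y. 2 * (poly (pderiv f) (zon e0 (\<phi> y)) * poly (pderiv g) (zon (\<phi> z) (\<phi> y)) * grad_inner e0 (\<phi> z) (\<phi> y)) \<partial>\<mu>)"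
    by (rule integral_orthogonal[OF o jordan_auto_image[OF \<phi>(1)], symmetric]) (intro continuous_intros cg)
  also have "... = (\<integral>y. 2 * (poly (pderiv f) (zon x y) * poly (pderiv g) (zon z y) * grad_inner x z y) \<partial>\<mu>)"
    unfolding \<phi>(2)[symmetric] grad_inner_auto[OF \<phi>(1)] z[symmetric] ..
  finally show ?thesis unfolding X_def .
qed

lemma projective_jacobi_op_symmetric:
  assumes S: "invariant_space \<mu> Q" and x: "x \<in> Q" and z: "z \<in> Q"
  defines "X \<equiv> invariant_space.zon 2"
  shows "(\<integral>y. poly (jacobi_op (n * d\<^sub>0) d\<^sub>0 f) (X x y) * poly g (X z y) \<partial>\<mu>) = (\<integral>y. poly f (X x y) * poly (jacobi_op (n * d\<^sub>0) d\<^sub>0 g) (X z y) \<partial>\<mu>)"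
proof -
  have "(\<integral>y. poly (jacobi_op (n * d\<^sub>0) d\<^sub>0 f) (X x y) * poly g (X z y) \<partial>\<mu>) = (\<integral>y. poly (jacobi_op (n * d\<^sub>0) d\<^sub>0 g) (X z y) * poly f (X x y) \<partial>\<mu>)"
    unfolding projective_jacobi_op[OF S x, folded X_def] projective_jacobi_op[OF S z, folded X_def] grad_inner_commute[of x z] by (simp add: mult_ac)
  thus ?thesis by (simp add: mult.commute)
qed

end

section \<open>The discrepancy bounds\<close>

lemma poly_fun_le_add:
  assumes "poly_fun_le t F" "poly_fun_le t G"
  shows "poly_fun_le t (\<lambda>x. F x + G x)"
proof -
  obtain c c' where "\<forall>x. F x = (\<Sum>\<alpha> \<in> {\<alpha> \<in> PiE Basis (\<lambda>_. {..t}). (\<Sum>b\<in>Basis. \<alpha> b) \<le> t}. c \<alpha> * (\<Prod>b\<in>Basis. (x \<bullet> b) ^ \<alpha> b))"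
    "\<forall>x. G x = (\<Sum>\<alpha> \<in> {\<alpha> \<in> PiE Basis (\<lambda>_. {..t}). (\<Sum>b\<in>Basis. \<alpha> b) \<le> t}. c' \<alpha> * (\<Prod>b\<in>Basis. (x \<bullet> b) ^ \<alpha> b))"
    using assms unfolding poly_fun_le_def by blast
  thus ?thesis unfolding poly_fun_le_def
    by (intro exI[of _ "\<lambda>\<alpha>. c \<alpha> + c' \<alpha>"]) (simp add: distrib_right sum.distrib)
qed

lemma poly_fun_le_cmult:
  assumes "poly_fun_le t F"
  shows "poly_fun_le t (\<lambda>x. r * F x)"
proof -
  obtain c where "\<forall>x. F x = (\<Sum>\<alpha> \<in> {\<alpha> \<in> PiE Basis (\<lambda>_. {..t}). (\<Sum>b\<in>Basis. \<alpha> b) \<le> t}. c \<alpha> * (\<Prod>b\<in>Basis. (x \<bullet> b) ^ \<alpha> b))"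
    using assms unfolding poly_fun_le_def by blast
  thus ?thesis unfolding poly_fun_le_def
    by (intro exI[of _ "\<lambda>\<alpha>. r * c \<alpha>"]) (simp add: sum_distrib_left mult.assoc)
qed

text \<open>The exponent is first restricted to the basis, since the index set consists of
  extensional functions.\<close>

lemma poly_fun_le_monomial:
  fixes \<alpha> :: "'a::euclidean_space \<Rightarrow> nat"
  assumes "(\<Sum>b\<in>Basis. \<alpha> b) \<le> t"
  shows "poly_fun_le t (\<lambda>x :: 'a. \<Prod>b\<in>Basis. (x \<bullet> b) ^ \<alpha> b)"
proof -
  define \<alpha>' where "\<alpha>' = restrict \<alpha> Basis"
  define I where "I = {\<alpha> \<in> PiE Basis (\<lambda>_. {..t}). (\<Sum>b\<in>(Basis :: 'a set). \<alpha> b) \<le> t}"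
  have fin: "finite I" by (simp add: I_def finite_PiE)
  have "\<alpha> b \<le> t" if "b \<in> Basis" for b
    using member_le_sum[OF that, of \<alpha>] assms by auto
  hence "\<alpha>' \<in> I" using assms by (auto simp: \<alpha>'_def I_def)
  hence "(\<Sum>\<beta>\<in>I. (if \<beta> = \<alpha>' then 1 else 0) * (\<Prod>b\<in>Basis. (x \<bullet> b) ^ \<beta> b)) = (\<Prod>b\<in>Basis. (x \<bullet> b) ^ \<alpha>' b)" for x :: 'a
    using fin by (simp add: if_distrib[of "\<lambda>z. z * _"] cong: if_cong)
  thus ?thesis unfolding poly_fun_le_def I_def[symmetric]
    by (intro exI[of _ "\<lambda>\<beta>. if \<beta> = \<alpha>' then 1 else 0"]) (simp add: \<alpha>'_def)
qed

lemma poly_fun_le_sum: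
  "finite I \<Longrightarrow> (\<And>i. i \<in> I \<Longrightarrow> poly_fun_le t (F i)) \<Longrightarrow> poly_fun_le t (\<lambda>x. \<Sum>i\<in>I. F i x)"
proof (induction I rule: finite_induct)
  case empty
  show ?case using poly_fun_le_cmult[OF poly_fun_le_monomial[of "\<lambda>_. 0" t], of 0] by simp
qed (simp add: poly_fun_le_add)

lemma poly_fun_le_const: "poly_fun_le t (\<lambda>x :: 'a::euclidean_space. c)"
  using poly_fun_le_cmult[OF poly_fun_le_monomial[of "\<lambda>_ :: 'a. 0" t], of c] by simp

lemma poly_fun_le_coordinate:
  fixes F :: "'a::euclidean_space \<Rightarrow> real"
  assumes F: "poly_fun_le t F" and b: "b \<in> Basis"
  shows "poly_fun_le (Suc t) (\<lambda>x. (x \<bullet> b) * F x)"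
proof -
  let ?I = "{\<alpha> \<in> PiE Basis (\<lambda>_. {..t}). (\<Sum>b\<in>Basis. \<alpha> b) \<le> t} :: ('a \<Rightarrow> nat) set"
  obtain c where c: "\<And>x. F x = (\<Sum>\<alpha> \<in> ?I. c \<alpha> * (\<Prod>b\<in>Basis. (x \<bullet> b) ^ \<alpha> b))"
    using F unfolding poly_fun_le_def by blast
  have m: "(x \<bullet> b) * (\<Prod>b'\<in>Basis. (x \<bullet> b') ^ \<alpha> b') = (\<Prod>b'\<in>Basis. (x \<bullet> b') ^ (\<alpha>(b := Suc (\<alpha> b))) b')" for x \<alpha>
    using b by (simp add: prod.remove[OF _ b] mult.assoc)
  have "(x \<bullet> b) * F x = (\<Sum>\<alpha> \<in> ?I. c \<alpha> * (\<Prod>b'\<in>Basis. (x \<bullet> b') ^ (\<alpha>(b := Suc (\<alpha> b))) b'))" for x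
    unfolding c sum_distrib_left m[symmetric] by (simp add: mult.left_commute)
  moreover have "poly_fun_le (Suc t) (\<lambda>x. \<Sum>\<alpha> \<in> ?I. c \<alpha> * (\<Prod>b'\<in>Basis. (x \<bullet> b') ^ (\<alpha>(b := Suc (\<alpha> b))) b'))"
  proof (intro poly_fun_le_sum poly_fun_le_cmult poly_fun_le_monomial)
    show "finite ?I" by (simp add: finite_PiE)
    fix \<alpha> assume "\<alpha> \<in> ?I"
    hence "(\<Sum>b\<in>Basis. \<alpha> b) \<le> t" by simp
    thus "(\<Sum>b'\<in>Basis. (\<alpha>(b := Suc (\<alpha> b))) b') \<le> Suc t" using b by (simp add: sum.remove[OF _ b])
  qed
  ultimately show ?thesis by simp
qed

lemma poly_fun_le_mono: "poly_fun_le t (F :: 'a::euclidean_space \<Rightarrow> real) \<Longrightarrow> t \<le> t' \<Longrightarrow> poly_fun_le t' F"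
proof -
  assume F: "poly_fun_le t F" and t: "t \<le> t'"
  let ?I = "{\<alpha> \<in> PiE Basis (\<lambda>_. {..t}). (\<Sum>b\<in>Basis. \<alpha> b) \<le> t} :: ('a \<Rightarrow> nat) set"
  obtain c where c: "\<And>x. F x = (\<Sum>\<alpha> \<in> ?I. c \<alpha> * (\<Prod>b\<in>Basis. (x \<bullet> b) ^ \<alpha> b))"
    using F unfolding poly_fun_le_def by blast
  have "poly_fun_le t' (\<lambda>x. \<Sum>\<alpha> \<in> ?I. c \<alpha> * (\<Prod>b\<in>Basis. (x \<bullet> b) ^ \<alpha> b))"
    using t by (intro poly_fun_le_sum poly_fun_le_cmult poly_fun_le_monomial) (auto simp: finite_PiE)
  thus ?thesis unfolding c[symmetric] by simp
qed

lemma poly_fun_le_inner: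
  fixes F :: "'a::euclidean_space \<Rightarrow> real"
  assumes "poly_fun_le t F" shows "poly_fun_le (Suc t) (\<lambda>y. (x \<bullet> y) * F y)"
proof -
  have "(x \<bullet> y) * F y = (\<Sum>b\<in>Basis. (x \<bullet> b) * ((y \<bullet> b) * F y))" for y
    by (subst euclidean_inner) (simp add: sum_distrib_right mult.assoc)
  thus ?thesis using assms by (simp add: poly_fun_le_sum poly_fun_le_cmult poly_fun_le_coordinate)
qed

text \<open>Horner's scheme: each step multiplies by one affine function of \<open>y\<close> and
  raises the degree by one.\<close>

lemma poly_fun_le_zonal:
  fixes x :: "'a::euclidean_space"
  assumes "degree q \<le> t" shows "poly_fun_le t (\<lambda>y. poly q (\<kappa> * (1 - x \<bullet> y)))"
  using assms
proof (induction q arbitrary: t)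
  case 0 show ?case using poly_fun_le_const[of t 0] by simp
next
  case (pCons a q)
  show ?case
  proof (cases "q = 0")
    case True thus ?thesis using poly_fun_le_const[of t a] by simp
  next
    case False
    then obtain s where t: "t = Suc s" "degree q \<le> s" using pCons.prems by (cases t) auto
    let ?F = "\<lambda>y. poly q (\<kappa> * (1 - x \<bullet> y))"
    have F: "poly_fun_le s ?F" by (rule pCons.IH[OF t(2)])
    have "poly_fun_le t (\<lambda>y. (a + \<kappa> * ?F y) + (- \<kappa>) * ((x \<bullet> y) * ?F y))"
      unfolding t(1) by (intro poly_fun_le_add poly_fun_le_cmult poly_fun_le_const poly_fun_le_inner[OF F] poly_fun_le_mono[OF F]) simp
    moreover have "(\<lambda>y. (a + \<kappa> * ?F y) + (- \<kappa>) * ((x \<bullet> y) * ?F y)) = (\<lambda>y. poly (pCons a q) (\<kappa> * (1 - x \<bullet> y)))"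
      by (simp add: fun_eq_iff algebra_simps)
    ultimately show ?thesis by simp
  qed
qed

section \<open>The concrete spaces as zonal models\<close>

lemma invariant_spaceI:
  fixes Q :: "'a::euclidean_space set"
  assumes m: "invariant_measure Q \<theta> \<mu>" and c: "compact Q"
    and th: "\<And>g x y. orthogonal_transformation g \<Longrightarrow> x \<in> Q \<Longrightarrow> y \<in> Q \<Longrightarrow> \<theta> (g x) (g y) = \<theta> x y"
  shows "invariant_space \<mu> Q"
proof -
  have p: "prob_space \<mu>" and s: "sets \<mu> = sets (restrict_space borel Q)" using m by (auto simp: invariant_measure_def)
  have "distr \<mu> \<mu> g = \<mu>" if g: "orthogonal_transformation g" "g ` Q = Q" for g
  proof -
    have "bij_betw g Q Q" using orthogonal_transformation_inj[OF g(1)] g(2) by (auto simp: bij_betw_def intro: inj_on_subset)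
    thus ?thesis using m th[OF g(1)] unfolding invariant_measure_def by blast
  qed
  thus ?thesis using p s c by (intro invariant_space.intro invariant_space_axioms.intro)
qed

text \<open>\<open>X\<close> plays the role of \<open>1 - cos \<theta>\<close>.\<close>

definition zonal_model :: "'a::euclidean_space set \<Rightarrow> ('a \<Rightarrow> 'a \<Rightarrow> real) \<Rightarrow> 'a measure \<Rightarrow> nat \<Rightarrow> nat \<Rightarrow> ('a \<Rightarrow> 'a \<Rightarrow> real) \<Rightarrow> bool" where
  "zonal_model Q \<theta> \<mu> d d\<^sub>0 X \<longleftrightarrow> zonal_space \<mu> X d d\<^sub>0 \<and> space \<mu> = Q \<and>
     (\<forall>x\<in>Q. \<forall>y\<in>Q. \<forall>r. 0 \<le> r \<longrightarrow> r \<le> pi \<longrightarrow> (\<theta> x y < r \<longleftrightarrow> X x y < 1 - cos r)) \<and>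
     (\<forall>x q t. degree q \<le> t \<longrightarrow> poly_fun_le t (\<lambda>y. poly q (X x y)))"

lemma zonal_model_sphere:
  fixes \<mu> :: "'a::euclidean_space measure"
  assumes d: "1 \<le> d" "DIM('a) = d + 1" and m: "invariant_measure (sphere 0 1) (\<lambda>x y. arccos (x \<bullet> y)) \<mu>"
  shows "zonal_model (sphere 0 1) (\<lambda>x y. arccos (x \<bullet> y)) \<mu> d d (\<lambda>x y. 1 * (1 - x \<bullet> y))"
proof -
  have inv: "invariant_space \<mu> (sphere 0 1)"
    by (rule invariant_spaceI[OF m]) (auto simp: orthogonal_transformation_def)
  interpret S: invariant_sphere \<mu> d
    using inv d(2) by (intro invariant_sphere.intro invariant_sphere_axioms.intro)
  have b: "\<bar>x \<bullet> y\<bar> \<le> 1" if "x \<in> sphere 0 1" "y \<in> sphere 0 1" for x y :: 'a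
    using Cauchy_Schwarz_ineq2[of x y] that by simp
  have "zonal_space \<mu> S.zon d d"
  proof (unfold_locales)
    fix x y :: 'a assume x: "x \<in> space \<mu>"
    hence x': "x \<in> sphere 0 1" by (simp add: S.space_mu)
    show "S.zon x \<in> borel_measurable \<mu>" unfolding S.zon_def by (intro S.continuous_measurable_mu continuous_intros)
    show "S.zon x x = 0" using x' by (simp add: S.zon_def norm_eq_1)
    assume "y \<in> space \<mu>"
    hence y': "y \<in> sphere 0 1" by (simp add: S.space_mu)
    show "0 \<le> S.zon x y" "S.zon x y \<le> 2" using b[OF x' y'] by (auto simp: S.zon_def abs_le_iff)
    show "S.zon x y = S.zon y x" by (simp add: S.zon_def inner_commute)
    fix f g
    show "(\<integral>u. poly (jacobi_op d d f) (S.zon x u) * poly g (S.zon y u) \<partial>\<mu>) = (\<integral>u. poly f (S.zon x u) * poly (jacobi_op d d g) (S.zon y u) \<partial>\<mu>)"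
      by (rule S.sphere_jacobi_op_symmetric[OF x' y'])
  qed (use d in auto)
  moreover have "arccos (x \<bullet> y) < r \<longleftrightarrow> S.zon x y < 1 - cos r" if "x \<in> sphere 0 1" "y \<in> sphere 0 1" "0 \<le> r" "r \<le> pi" for x y r
  proof -
    have c: "- 1 \<le> x \<bullet> y" "x \<bullet> y \<le> 1" using b[OF that(1,2)] by (auto simp: abs_le_iff)
    have "cos r < cos (arccos (x \<bullet> y)) \<longleftrightarrow> arccos (x \<bullet> y) < r"
      using that c by (intro cos_mono_less_eq arccos_lbound arccos_ubound)
    thus ?thesis using c by (simp add: S.zon_def cos_arccos)
  qed
  moreover have "poly_fun_le t (\<lambda>y. poly q (S.zon x y))" if "degree q \<le> t" for x q t
    unfolding S.zon_def by (rule poly_fun_le_zonal[OF that])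
  ultimately show ?thesis unfolding zonal_model_def S.zon_def[abs_def, symmetric] using S.space_mu by blast
qed

context hermitian_embedding
begin

lemma compact_Q: "compact Q"
proof -
  have ci: "continuous_on S (\<lambda>x. \<iota> x i k)" for S i k
    using iota_linear by (intro linear_continuous_on linear_conv_bounded_linear[THEN iffD1])
  have "Q = (\<Inter>i. \<Inter>k. {x. mat_mult n (\<iota> x) (\<iota> x) i k = \<iota> x i k}) \<inter> {x. mat_trace n (\<iota> x) = oct_one}"
    unfolding Q_def by (auto simp: fun_eq_iff)
  moreover have "closed ..."
    unfolding mat_mult_def mat_trace_def
    by (intro closed_Int closed_INT ballI closed_Collect_eq continuous_on_sum oct_mult.continuous_on ci continuous_on_const)
  moreover have "bounded Q" unfolding bounded_iff by (intro exI[of _ 1]) (auto simp: Q_iff norm_eq_sqrt_inner)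
  ultimately show ?thesis by (simp add: compact_eq_bounded_closed)
qed

text \<open>After \<open>x\<close> is moved to \<open>e0\<close>, the product is a diagonal entry of
  an idempotent, hence a sum of squares. It supplies the bound
  \<open>2 * (1 - x \<bullet> y) \<le> 2\<close> for the zonal variable.\<close>

lemma inner_Q_nonneg:
  assumes "x \<in> Q" "y \<in> Q" shows "0 \<le> x \<bullet> y"
proof -
  obtain g where g: "jordan_auto g" "g x = e0" using transitive[OF assms(1)] by blast
  have "x \<bullet> y = g x \<bullet> g y" using g(1) by (simp add: jordan_auto_def orthogonal_transformation_def)
  also have "... = diag (\<iota> (g y)) 0" unfolding g(2) inner_e0 ..
  also have "... \<ge> 0" using jordan_auto_image[OF g(1)] assms(2) by (intro Q_facts) blast
  finally show ?thesis .
qed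

lemma zonal_model_projective:
  assumes m: "invariant_measure Q (\<lambda>x y. 2 * arcsin (norm (x - y) / sqrt 2)) \<mu>"
  shows "zonal_model Q (\<lambda>x y. 2 * arcsin (norm (x - y) / sqrt 2)) \<mu> (n * d\<^sub>0) d\<^sub>0 (\<lambda>x y. 2 * (1 - x \<bullet> y))"
proof -
  have inv: "invariant_space \<mu> Q"
  proof (rule invariant_spaceI[OF m compact_Q])
    fix g :: "'a \<Rightarrow> 'a" and x y :: 'a assume o: "orthogonal_transformation g"
    hence "norm (g x - g y) = norm (x - y)"
      using orthogonal_transformation_norm[OF o, of "x - y"] by (simp add: linear_diff[OF orthogonal_transformation_linear[OF o]])
    thus "2 * arcsin (norm (g x - g y) / sqrt 2) = 2 * arcsin (norm (x - y) / sqrt 2)" by simp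
  qed
  interpret S: invariant_space \<mu> Q 2 "n * d\<^sub>0" d\<^sub>0 by (rule inv)
  have b: "0 \<le> x \<bullet> y" "x \<bullet> y \<le> 1" if "x \<in> Q" "y \<in> Q" for x y
  proof -
    have "norm x = 1" "norm y = 1" using that by (auto simp: Q_iff norm_eq_sqrt_inner)
    thus "x \<bullet> y \<le> 1" using norm_cauchy_schwarz[of x y] by simp
    show "0 \<le> x \<bullet> y" by (rule inner_Q_nonneg[OF that])
  qed
  have d0: "1 \<le> d\<^sub>0" using K by auto
  have "zonal_space \<mu> S.zon (n * d\<^sub>0) d\<^sub>0"
  proof (unfold_locales)
    fix x y :: 'a assume x: "x \<in> space \<mu>"
    hence x': "x \<in> Q" by (simp add: S.space_mu)
    show "S.zon x \<in> borel_measurable \<mu>" unfolding S.zon_def by (intro S.continuous_measurable_mu continuous_intros)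
    show "S.zon x x = 0" using x' by (simp add: S.zon_def Q_iff)
    assume "y \<in> space \<mu>"
    hence y': "y \<in> Q" by (simp add: S.space_mu)
    show "0 \<le> S.zon x y" "S.zon x y \<le> 2" using b[OF x' y'] by (auto simp: S.zon_def)
    show "S.zon x y = S.zon y x" by (simp add: S.zon_def inner_commute)
    fix f g
    show "(\<integral>u. poly (jacobi_op (n * d\<^sub>0) d\<^sub>0 f) (S.zon x u) * poly g (S.zon y u) \<partial>\<mu>) = (\<integral>u. poly f (S.zon x u) * poly (jacobi_op (n * d\<^sub>0) d\<^sub>0 g) (S.zon y u) \<partial>\<mu>)"
      by (rule projective_jacobi_op_symmetric[OF inv x' y'])
  qed (use d0 n2 in auto)
  moreover have "2 * arcsin (norm (x - y) / sqrt 2) < r \<longleftrightarrow> S.zon x y < 1 - cos r" if "x \<in> Q" "y \<in> Q" "0 \<le> r" "r \<le> pi" for x y r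
  proof -
    define s where "s = norm (x - y) / sqrt 2"
    have xx: "x \<bullet> x = 1" "y \<bullet> y = 1" using that by (auto simp: Q_iff)
    have s2: "s\<^sup>2 = 1 - x \<bullet> y"
      by (simp add: s_def power_divide power2_norm_eq_inner inner_diff_left inner_diff_right xx inner_commute)
    have s0: "0 \<le> s" by (simp add: s_def)
    have "s\<^sup>2 \<le> 1" using b[OF that(1,2)] s2 by simp
    hence s1: "s \<le> 1" using power2_le_imp_le[of s 1] by simp
    have r: "0 \<le> sin (r/2)" "- (pi/2) \<le> r/2" "r/2 \<le> pi/2" using that by (auto intro!: sin_ge_zero)
    have "2 * arcsin s < r \<longleftrightarrow> arcsin s < r/2" by auto
    also have "... \<longleftrightarrow> sin (arcsin s) < sin (r/2)"
      using s0 s1 r by (intro sin_mono_less_eq[symmetric] arcsin_lbound arcsin_ubound) auto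
    also have "... \<longleftrightarrow> s < sin (r/2)" using s0 s1 by simp
    also have "... \<longleftrightarrow> s\<^sup>2 < (sin (r/2))\<^sup>2" using s0 r by (simp add: power_mono_iff flip: not_le)
    also have "... \<longleftrightarrow> S.zon x y < 1 - cos r"
      using cos_double_sin[of "r/2"] unfolding s2 S.zon_def by auto
    finally show ?thesis unfolding s_def .
  qed
  moreover have "poly_fun_le t (\<lambda>y. poly q (S.zon x y))" if "degree q \<le> t" for x q t
    unfolding S.zon_def by (rule poly_fun_le_zonal[OF that])
  ultimately show ?thesis unfolding zonal_model_def S.zon_def[abs_def, symmetric] using S.space_mu by blast
qed

end

lemma homogeneous_space_zonal_model:
  assumes h: "homogeneous_space Q \<theta> d d\<^sub>0" and m: "invariant_measure Q \<theta> \<mu>"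
  shows "\<exists>X. zonal_model Q \<theta> \<mu> d d\<^sub>0 X"
  using h
proof cases
  case sphere
  thus ?thesis using zonal_model_sphere[of d \<mu>] m by blast
next
  case (projective n \<iota>)
  interpret hermitian_embedding n d\<^sub>0 \<iota> using projective by unfold_locales auto
  have "Q = hermitian_embedding.Q n \<iota>" unfolding Q_def projective(1) ..
  thus ?thesis using zonal_model_projective[of \<mu>] m projective by auto
qed

section \<open>From multisets to the analytic bounds\<close>

lemma ball_count_mset:
  assumes z: "zonal_model Q \<theta> \<mu> d d\<^sub>0 X" and xs: "set xs \<subseteq> Q" and y: "y \<in> Q" and r: "0 \<le> r" "r \<le> pi"
  shows "real (ball_count Q \<theta> (mset xs) r y) = zonal_space.count X (length xs) ((!) xs) (1 - cos r) y"
proof -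
  interpret zonal_space \<mu> X d d\<^sub>0 using z by (simp add: zonal_model_def)
  have "ball_count Q \<theta> (mset xs) r y = card {i. i < length xs \<and> xs ! i \<in> geo_ball Q \<theta> r y}"
    unfolding ball_count_def by (simp add: length_filter_conv_card flip: mset_filter)
  also have "{i. i < length xs \<and> xs ! i \<in> geo_ball Q \<theta> r y} = {i \<in> {..<length xs}. X (xs ! i) y < 1 - cos r}"
    using z xs y r nth_mem unfolding geo_ball_def zonal_model_def by (auto simp: subset_iff)
  finally show ?thesis unfolding count_def indicator_def by (simp add: sum.If_cases Int_def)
qed

lemma max_count_ge:
  assumes "y \<in> Q" shows "ball_count Q \<theta> D r y \<le> max_count Q \<theta> D r"
proof -
  have b: "ball_count Q \<theta> D r y \<le> size D" for y by (simp add: ball_count_def size_filter_mset_lesseq)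
  have "finite (ball_count Q \<theta> D r ` Q)" by (rule finite_subset[of _ "{..size D}"]) (use b in auto)
  thus ?thesis unfolding max_count_def using assms b by auto
qed

text \<open>The second bound enlarges the radius, possibly beyond \<open>pi\<close>, where
  \<open>max_count\<close> switches to the number of points.\<close>

lemma max_count_mono:
  assumes "Q \<noteq> {}" "r \<le> s" shows "max_count Q \<theta> D r \<le> max_count Q \<theta> D s"
proof (cases "r \<le> pi")
  case True
  have fin: "finite (ball_count Q \<theta> D r ` Q)"
    by (rule finite_subset[of _ "{..size D}"]) (auto simp: ball_count_def size_filter_mset_lesseq)
  have "ball_count Q \<theta> D r y \<le> max_count Q \<theta> D s" if "y \<in> Q" for y
  proof -
    have "ball_count Q \<theta> D r y \<le> ball_count Q \<theta> D s y" unfolding ball_count_def geo_ball_def using assms(2)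
      by (intro size_mset_mono filter_mset_mono_strong) auto
    also have "... \<le> max_count Q \<theta> D s" by (rule max_count_ge[OF that])
    finally show ?thesis .
  qed
  thus ?thesis unfolding max_count_def[of Q \<theta> D r] using True fin assms(1) by auto
next
  case False thus ?thesis using assms(2) by (simp add: max_count_def)
qed

lemma design_discrepancy_bound:
  assumes z: "zonal_model Q \<theta> \<mu> d d\<^sub>0 X" and des: "is_design Q \<mu> N t D"
    and LC: "1 \<le> L" "0 < C" "flux_bound d d\<^sub>0 L C"
    and t: "2 * L / pi \<le> real t"
  shows "0 \<le> r \<Longrightarrow> r \<le> pi \<Longrightarrow> ball_discrepancy Q \<theta> \<mu> D r \<le> 2 * C * L * weight d d\<^sub>0 r * real t ^ (d - 1) * (real (max_count Q \<theta> D (L / t)))\<^sup>2"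
    and "1 \<le> max_count Q \<theta> D (L / t)"
    and "weight_mass d d\<^sub>0 / pi * (real t / (2 * real d)) ^ d \<le> real N"
    and "0 < t"
proof -
  interpret zonal_space \<mu> X d d\<^sub>0 using z by (simp add: zonal_model_def)
  have sp: "space \<mu> = Q" and th: "\<And>x y r. x \<in> Q \<Longrightarrow> y \<in> Q \<Longrightarrow> 0 \<le> r \<Longrightarrow> r \<le> pi \<Longrightarrow> \<theta> x y < r \<longleftrightarrow> X x y < 1 - cos r"
    and pf: "\<And>x q t. degree q \<le> t \<Longrightarrow> poly_fun_le t (\<lambda>y. poly q (X x y))"
    using z by (auto simp: zonal_model_def)
  obtain xs where xs: "D = mset xs" using ex_mset by metis
  have N: "1 \<le> N" "length xs = N" and xQ: "set xs \<subseteq> Q" using des by (auto simp: is_design_def xs)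
  define p where "p = (!) xs"
  have p: "\<forall>i<N. p i \<in> space \<mu>" using xQ N nth_mem by (auto simp: p_def sp subset_iff)
  have de: "(\<Sum>i<N. poly q (X (p i) y)) = real N * (\<integral>x. poly q (X y x) \<partial>\<mu>)" if "degree q \<le> t" "y \<in> space \<mu>" for q y
  proof -
    have "(\<Sum>x\<in>#D. poly q (X y x)) = real N * (\<integral>x. poly q (X y x) \<partial>\<mu>)"
      using des pf[OF that(1), of y] unfolding is_design_def by blast
    also have "(\<Sum>x\<in>#D. poly q (X y x)) = (\<Sum>i<N. poly q (X y (p i)))"
      unfolding xs p_def mset_map[symmetric] sum_mset_sum_list sum_list_sum_nth
      using N by (simp add: atLeast0LessThan)
    also have "... = (\<Sum>i<N. poly q (X (p i) y))" using p that(2) by (intro sum.cong refl) (simp add: X_sym)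
    finally show ?thesis .
  qed
  show t0: "0 < t"
  proof -
    have "0 < 2 * L / pi" using LC(1) by simp
    hence "0 < real t" using t by (rule less_le_trans)
    thus ?thesis by simp
  qed
  have Lt: "0 < L / t" "L / t \<le> pi"
  proof -
    show "0 < L / t" using t0 LC(1) by simp
    have "L / t \<le> pi/2" using t t0 by (simp add: field_simps)
    thus "L / t \<le> pi" using pi_gt_zero by linarith
  qed
  let ?\<nu> = "real (max_count Q \<theta> D (L / t))"
  have nu: "count N p (1 - cos (L / t)) y \<le> ?\<nu>" if "y \<in> space \<mu>" for y
  proof -
    have y: "y \<in> Q" using that sp by simp
    show ?thesis using ball_count_mset[OF z xQ y, of "L / t"] max_count_ge[OF y, of \<theta> D "L / t"] Lt N
      by (simp add: xs p_def)
  qed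
  show "weight_mass d d\<^sub>0 / pi * (real t / (2 * real d)) ^ d \<le> real N"
    using design_size_ge[OF p _ de] N by simp
  \<comment> \<open>The ball about a point of the design contains this point. The positivity makes
    the final inequalities strict.\<close>
  show "1 \<le> max_count Q \<theta> D (L / t)"
  proof -
    have p0: "p 0 \<in> Q" using p N sp by auto
    have "0 < 1 - cos (L / t)" using cos_monotone_0_pi[of 0 "L / t"] Lt by simp
    hence "p 0 \<in> geo_ball Q \<theta> (L / t) (p 0)" using p0 th[OF p0 p0, of "L / t"] X_refl[of "p 0"] Lt sp by (simp add: geo_ball_def)
    moreover have "p 0 \<in># D" using N by (simp add: xs p_def)
    ultimately have "p 0 \<in># filter_mset (\<lambda>x. x \<in> geo_ball Q \<theta> (L / t) (p 0)) D" by simp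
    hence "filter_mset (\<lambda>x. x \<in> geo_ball Q \<theta> (L / t) (p 0)) D \<noteq> {#}" by (metis empty_iff set_mset_empty)
    hence "0 < ball_count Q \<theta> D (L / t) (p 0)" unfolding ball_count_def by (simp only: nonempty_has_size)
    thus ?thesis using max_count_ge[OF p0, of \<theta> D "L / t"] by linarith
  qed
  assume r: "0 \<le> r" "r \<le> pi"
  have v: "measure \<mu> (geo_ball Q \<theta> r y) = \<beta> (1 - cos r) 0" if "y \<in> Q" for y
  proof -
    have y': "y \<in> space \<mu>" using that sp by simp
    have "geo_ball Q \<theta> r y = {x \<in> space \<mu>. X y x < 1 - cos r}"
      using th[OF _ that r] X_sym[of y] y' that by (auto simp: geo_ball_def sp)
    moreover have "{x \<in> space \<mu>. X y x < 1 - cos r} \<inter> space \<mu> = {x \<in> space \<mu>. X y x < 1 - cos r}" by auto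
    ultimately have "measure \<mu> (geo_ball Q \<theta> r y) = (\<integral>x. indicator {x \<in> space \<mu>. X y x < 1 - cos r} x \<partial>\<mu>)" by simp
    also have "... = (\<integral>x. indicator {..<1 - cos r} (X y x) \<partial>\<mu>)"
      by (intro Bochner_Integration.integral_cong refl) (auto simp: indicator_def)
    also have "... = \<beta> (1 - cos r) 0" unfolding beta_0 by (rule integral_X[OF y']) simp
    finally show ?thesis .
  qed
  have "ball_discrepancy Q \<theta> \<mu> D r = var N p (1 - cos r)"
    unfolding ball_discrepancy_def var_def
    by (intro Bochner_Integration.integral_cong refl) (use ball_count_mset[OF z xQ _ r] N v in \<open>simp add: sp xs p_def\<close>)
  thus "ball_discrepancy Q \<theta> \<mu> D r \<le> 2 * C * L * weight d d\<^sub>0 r * real t ^ (d - 1) * ?\<nu>\<^sup>2"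
    using var_bound[OF LC p de t r nu] by simp
qed

lemma discrepancy_le:
  assumes eta: "\<eta> \<in> weight_class d d\<^sub>0" and B: "0 \<le> B"
    and b: "\<And>r. 0 \<le> r \<Longrightarrow> r \<le> pi \<Longrightarrow> ball_discrepancy Q \<theta> \<mu> D r \<le> B * weight d d\<^sub>0 r"
  shows "discrepancy Q \<theta> \<mu> \<eta> D \<le> B * (LINT r:{0..pi}|lebesgue. weight d d\<^sub>0 r * \<eta> r)"
    and "0 \<le> (LINT r:{0..pi}|lebesgue. weight d d\<^sub>0 r * \<eta> r)"
proof -
  have e0: "\<And>r. 0 \<le> r \<Longrightarrow> r \<le> pi \<Longrightarrow> 0 \<le> \<eta> r" and int: "set_integrable lebesgue {0..pi} (\<lambda>r. weight d d\<^sub>0 r * \<eta> r)"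
    using eta by (auto simp: weight_class_def weight_def)
  show I0: "0 \<le> (LINT r:{0..pi}|lebesgue. weight d d\<^sub>0 r * \<eta> r)"
    unfolding set_lebesgue_integral_def using e0 weight_nonneg by (intro Bochner_Integration.integral_nonneg) (auto simp: indicator_def)
  show "discrepancy Q \<theta> \<mu> \<eta> D \<le> B * (LINT r:{0..pi}|lebesgue. weight d d\<^sub>0 r * \<eta> r)"
  proof (cases "set_integrable lebesgue {0..pi} (\<lambda>r. ball_discrepancy Q \<theta> \<mu> D r * \<eta> r)")
    case True
    have "discrepancy Q \<theta> \<mu> \<eta> D \<le> (LINT r:{0..pi}|lebesgue. B * (weight d d\<^sub>0 r * \<eta> r))"
      unfolding discrepancy_def
    proof (rule set_integral_mono[OF True])
      show "set_integrable lebesgue {0..pi} (\<lambda>r. B * (weight d d\<^sub>0 r * \<eta> r))" using int by (rule set_integrable_mult_right)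
      fix r assume r: "r \<in> {0..pi}"
      thus "ball_discrepancy Q \<theta> \<mu> D r * \<eta> r \<le> B * (weight d d\<^sub>0 r * \<eta> r)"
        using mult_right_mono[OF b[of r] e0[of r]] by (simp add: mult.assoc)
    qed
    thus ?thesis by simp
  next
    \<comment> \<open>The integral of a function that is not integrable is 0 by convention, and the
      right side is nonnegative.\<close>
    case False
    hence "discrepancy Q \<theta> \<mu> \<eta> D = 0" unfolding discrepancy_def set_lebesgue_integral_def set_integrable_def
      by (rule not_integrable_integral_eq)
    thus ?thesis using B I0 by simp
  qed
qed

lemma homogeneous_space_dim:
  assumes "homogeneous_space Q \<theta> d d\<^sub>0" shows "1 \<le> d \<and> 1 \<le> d\<^sub>0"
  using assms by cases auto

lemma radius_le:
  fixes t N c L :: real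
  assumes d: "1 \<le> d" and t: "0 < t" and N: "1 \<le> N" and c: "0 < c" "N \<le> c * t ^ d" and L: "1 \<le> L"
  shows "L / t \<le> c powr (1 / real d) * L * N powr (- 1 / real d)"
proof -
  have td: "t ^ d = t powr real d" using t by (simp add: powr_realpow)
  have "N powr (1 / real d) \<le> (c * t powr real d) powr (1 / real d)"
    using c N unfolding td[symmetric] by (intro powr_mono2) auto
  also have "... = c powr (1 / real d) * t" using c t d by (simp add: powr_mult powr_powr)
  finally have "N powr (1 / real d) / t \<le> c powr (1 / real d)" using t by (simp add: divide_le_eq)
  hence "N powr (1 / real d) / t * (L * N powr (- 1 / real d)) \<le> c powr (1 / real d) * (L * N powr (- 1 / real d))"
    using L by (intro mult_right_mono) auto
  moreover have eq: "N powr (1 / real d) / t * (L * N powr (- 1 / real d)) = L / t"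
  proof -
    have "N powr (1 / real d) * N powr (- 1 / real d) = 1" using N by (simp flip: powr_add)
    moreover have "N powr (1 / real d) / t * (L * N powr (- 1 / real d)) = L / t * (N powr (1 / real d) * N powr (- 1 / real d))" by simp
    ultimately show ?thesis by simp
  qed
  ultimately show ?thesis unfolding eq by (simp only: mult.assoc)
qed

text \<open>Raise \<open>t ^ d \<le> N / c\<close> to the power \<open>1 - 1 / d\<close>.\<close>

lemma power_pred_le:
  fixes t N c :: real
  assumes d: "1 \<le> d" and t: "0 < t" and c: "0 < c" "c * t ^ d \<le> N"
  shows "t ^ (d - 1) \<le> (1 / c) powr (1 - 1 / real d) * N powr (1 - 1 / real d)"
proof -
  define e where "e = 1 - 1 / real d"
  have e: "0 \<le> e" "real d * e = real (d - 1)" using d by (auto simp: e_def right_diff_distrib of_nat_diff)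
  have td: "t ^ d = t powr real d" using t by (simp add: powr_realpow)
  have N: "0 \<le> N" using c t by (intro order_trans[OF _ c(2)]) simp
  have "t ^ (d - 1) = (t ^ d) powr e" unfolding td powr_powr e(2) using t by (simp add: powr_realpow)
  also have "... \<le> (1 / c * N) powr e"
    using c e t by (intro powr_mono2) (auto simp: field_simps)
  also have "... = (1 / c) powr e * N powr e" by (rule powr_mult)
  finally show ?thesis unfolding e_def .
qed

theorem theorem3p1:
  fixes d d\<^sub>0 :: nat
  shows "\<exists>L\<ge>1. \<forall>\<eta>\<in>weight_class d d\<^sub>0.
    (\<exists>C>0. \<forall>(Q :: 'a::euclidean_space set) \<theta> \<mu> N t D.
        homogeneous_space Q \<theta> d d\<^sub>0 \<longrightarrow> invariant_measure Q \<theta> \<mu> \<longrightarrow>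
        is_design Q \<mu> N t D \<longrightarrow> real t \<ge> 2 * L / pi \<longrightarrow>
        discrepancy Q \<theta> \<mu> \<eta> D
          < C * real t ^ (d - 1) * (real (max_count Q \<theta> D (L / real t)))\<^sup>2) \<and>
    (\<exists>C>0. \<forall>(Q :: 'a set) \<theta> \<mu> N t D c\<^sub>p c\<^sub>m.
        homogeneous_space Q \<theta> d d\<^sub>0 \<longrightarrow> invariant_measure Q \<theta> \<mu> \<longrightarrow>
        is_design Q \<mu> N t D \<longrightarrow> real t \<ge> 2 * L / pi \<longrightarrow>
        c\<^sub>p > 0 \<longrightarrow> c\<^sub>m > 0 \<longrightarrow>
        c\<^sub>p * real t ^ d \<ge> real N \<longrightarrow> real N \<ge> c\<^sub>m * real t ^ d \<longrightarrow>
        discrepancy Q \<theta> \<mu> \<eta> D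
          < C * real N powr (1 - 1 / real d)
              * (real (max_count Q \<theta> D
                   (c\<^sub>p powr (1 / real d) * L * real N powr (- 1 / real d))))\<^sup>2)"
proof (cases "1 \<le> d \<and> 1 \<le> d\<^sub>0")
  case False
  \<comment> \<open>For such parameters there is no space, and any positive constants serve.\<close>
  hence "\<not> homogeneous_space Q \<theta> d d\<^sub>0" for Q :: "'a set" and \<theta> using homogeneous_space_dim by blast
  thus ?thesis by (intro exI[of _ "1::real"] conjI ballI allI impI) auto
next
  case True
  hence d: "1 \<le> d" "1 \<le> d\<^sub>0" by auto
  obtain L C where LC: "L \<ge> 1" "C > 0" and
    flux: "flux_bound d d\<^sub>0 L C"
    using jacobi_flux_bound[OF d] by blast
  show ?thesis
  proof (rule exI[of _ L], intro conjI ballI LC(1))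
    fix \<eta> assume eta: "\<eta> \<in> weight_class d d\<^sub>0"
    define I where "I = (LINT r:{0..pi}|lebesgue. weight d d\<^sub>0 r * \<eta> r)"
    \<comment> \<open>The summand 1 yields strict inequality, since \<open>t ^ (d - 1)\<close> and
      the maximal count are positive. \<open>I\<close> may be zero.\<close>
    define C\<^sub>1 where "C\<^sub>1 = 2 * C * L * I + 1"
    have I0: "0 \<le> I" unfolding I_def set_lebesgue_integral_def
      using eta weight_nonneg by (intro Bochner_Integration.integral_nonneg) (auto simp: indicator_def weight_class_def)
    have C1: "C\<^sub>1 > 0" using I0 LC unfolding C\<^sub>1_def by (intro add_nonneg_pos mult_nonneg_nonneg) auto
    define c\<^sub>0 where "c\<^sub>0 = weight_mass d d\<^sub>0 / pi / (2 * real d) ^ d"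
    have c0: "c\<^sub>0 > 0" using weight_mass_pos[of d d\<^sub>0] d by (simp add: c\<^sub>0_def)
    have main: "discrepancy Q \<theta> \<mu> \<eta> D < C\<^sub>1 * real t ^ (d - 1) * (real (max_count Q \<theta> D (L / real t)))\<^sup>2"
      and size: "c\<^sub>0 * real t ^ d \<le> real N" and t0: "0 < t" and ne: "Q \<noteq> {}"
      if h: "homogeneous_space Q \<theta> d d\<^sub>0" "invariant_measure Q \<theta> \<mu>" "is_design Q \<mu> N t D" "2 * L / pi \<le> real t"
      for Q :: "'a set" and \<theta> \<mu> N t D
    proof -
      obtain X where z: "zonal_model Q \<theta> \<mu> d d\<^sub>0 X" using homogeneous_space_zonal_model[OF h(1,2)] by blast
      note D = design_discrepancy_bound[OF z h(3) LC flux h(4)]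
      show "0 < t" by (rule D(4))
      show "c\<^sub>0 * real t ^ d \<le> real N" using D(3) by (simp add: c\<^sub>0_def power_divide)
      have "D \<noteq> {#}" "set_mset D \<subseteq> Q" using h(3) by (auto simp: is_design_def)
      thus "Q \<noteq> {}" by auto
      define \<nu> where "\<nu> = real (max_count Q \<theta> D (L / real t))"
      define B where "B = 2 * C * L * real t ^ (d - 1) * \<nu>\<^sup>2"
      have B0: "0 \<le> B" using LC by (simp add: B_def)
      have "discrepancy Q \<theta> \<mu> \<eta> D \<le> B * I" unfolding I_def
        by (rule discrepancy_le(1)[OF eta B0]) (use D(1) in \<open>simp add: B_def \<nu>_def mult_ac\<close>)
      also have "... < B * I + real t ^ (d - 1) * \<nu>\<^sup>2" using D(2,4) by (simp add: \<nu>_def)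
      also have "... = C\<^sub>1 * real t ^ (d - 1) * \<nu>\<^sup>2" by (simp add: B_def C\<^sub>1_def algebra_simps)
      finally show "discrepancy Q \<theta> \<mu> \<eta> D < C\<^sub>1 * real t ^ (d - 1) * (real (max_count Q \<theta> D (L / real t)))\<^sup>2" unfolding \<nu>_def .
    qed
    show "\<exists>C>0. \<forall>(Q :: 'a set) \<theta> \<mu> N t D.
        homogeneous_space Q \<theta> d d\<^sub>0 \<longrightarrow> invariant_measure Q \<theta> \<mu> \<longrightarrow>
        is_design Q \<mu> N t D \<longrightarrow> real t \<ge> 2 * L / pi \<longrightarrow>
        discrepancy Q \<theta> \<mu> \<eta> D
          < C * real t ^ (d - 1) * (real (max_count Q \<theta> D (L / real t)))\<^sup>2"
      using C1 main by blast
    define e where "e = 1 - 1 / real d"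
    \<comment> \<open>\<open>c\<^sub>0\<close> is the constant of \<open>design_size_ge\<close>,
      valid for every design, so \<open>C\<^sub>2\<close> depends only on the dimensions and on
      \<open>\<eta>\<close>.\<close>
    define C\<^sub>2 where "C\<^sub>2 = C\<^sub>1 * (1 / c\<^sub>0) powr e"
    have C2: "C\<^sub>2 > 0" using C1 c0 by (simp add: C\<^sub>2_def)
    have ii: "discrepancy Q \<theta> \<mu> \<eta> D < C\<^sub>2 * real N powr (1 - 1 / real d)
              * (real (max_count Q \<theta> D (c\<^sub>p powr (1 / real d) * L * real N powr (- 1 / real d))))\<^sup>2"
      if h: "homogeneous_space Q \<theta> d d\<^sub>0" "invariant_measure Q \<theta> \<mu>" "is_design Q \<mu> N t D" "2 * L / pi \<le> real t"
       and cp: "c\<^sub>p > 0" "real N \<le> c\<^sub>p * real t ^ d"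
      for Q :: "'a set" and \<theta> \<mu> N t D c\<^sub>p
    proof -
      define \<rho> where "\<rho> = c\<^sub>p powr (1 / real d) * L * real N powr (- 1 / real d)"
      have t: "0 < real t" using t0[OF h] by simp
      have N: "1 \<le> real N" using h(3) by (simp add: is_design_def)
      have "L / real t \<le> \<rho>" unfolding \<rho>_def by (rule radius_le[OF d(1) t N cp LC(1)])
      hence nu: "max_count Q \<theta> D (L / real t) \<le> max_count Q \<theta> D \<rho>" by (rule max_count_mono[OF ne[OF h]])
      have tp: "real t ^ (d - 1) \<le> (1 / c\<^sub>0) powr e * real N powr e"
        unfolding e_def by (rule power_pred_le[OF d(1) t c0 size[OF h]])
      have "discrepancy Q \<theta> \<mu> \<eta> D < C\<^sub>1 * real t ^ (d - 1) * (real (max_count Q \<theta> D (L / real t)))\<^sup>2" by (rule main[OF h])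
      also have "... \<le> C\<^sub>1 * ((1 / c\<^sub>0) powr e * real N powr e) * (real (max_count Q \<theta> D \<rho>))\<^sup>2"
        using C1 tp nu by (intro mult_mono power_mono mult_left_mono) auto
      finally show ?thesis unfolding C\<^sub>2_def \<rho>_def e_def by (simp add: mult.assoc)
    qed
    show "\<exists>C>0. \<forall>(Q :: 'a set) \<theta> \<mu> N t D c\<^sub>p c\<^sub>m.
        homogeneous_space Q \<theta> d d\<^sub>0 \<longrightarrow> invariant_measure Q \<theta> \<mu> \<longrightarrow>
        is_design Q \<mu> N t D \<longrightarrow> real t \<ge> 2 * L / pi \<longrightarrow>
        c\<^sub>p > 0 \<longrightarrow> c\<^sub>m > 0 \<longrightarrow>
        c\<^sub>p * real t ^ d \<ge> real N \<longrightarrow> real N \<ge> c\<^sub>m * real t ^ d \<longrightarrow>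
        discrepancy Q \<theta> \<mu> \<eta> D
          < C * real N powr (1 - 1 / real d)
              * (real (max_count Q \<theta> D
                   (c\<^sub>p powr (1 / real d) * L * real N powr (- 1 / real d))))\<^sup>2"
      by (rule exI[of _ C\<^sub>2], intro conjI allI impI, rule C2, rule ii)
  qed
qed

end
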